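(* For each computable perfect Polish space $X$ and each $i\in\{0,1,2,3\}$, $$\mathsf{BCT}_{i,X}\equiv_{\mathrm{sW}}\mathsf{BCT}_{i,\mathbb N^{\mathbb N}}.$$
   Context: Represented spaces and Weihrauch reducibility. The symbol $\subseteq$ in front of a domain means "possibly partial". A represented space $(X,\delta_X)$ is a set $X$ with a surjective partial map $\delta_X:\subseteq\mathbb N^{\mathbb N}\to X$. A multi-valued function $f:\subseteq X\rightrightarrows Y$ assigns to each $x\in\mathrm{dom}(f)$ a nonempty set $f(x)\subseteq Y$. A realizer $F\vdash f$ is a partial function $F:\subseteq\mathbb N^{\mathbb N}\to\mathbb N^{\mathbb N}$ with $\delta_YF(p)\in f(\delta_X(p))$ for all $p\in\mathrm{dom}(f\delta_X)$. $f\le_{\mathrm{sW}}g$: there are computable $K,H:\subseteq\mathbb N^{\mathbb N}\to\mathbb N^{\mathbb N}$ with $HGK\vdash f$ for all $G\vdash g$; $\equiv_{\mathrm{sW}}$ is reducibility in both directions. With $\langle p_0,p_1,\dots\rangle(\langle i,j\rangle):=p_i(j)$, the sequence space $X^{\mathbb N}$ is represented by $\delta_X^{\mathbb N}\langle p_0,p_1,\dots\rangle:=(\delta_X(p_i))_i$. $\mathbb N$ carries its canonical representation ($p$ names $p(0)$). A computable Polish space $(X,d,\alpha)$ is a complete metric space with a dense sequence $\alpha:\mathbb N\to X$ such that $d\circ(\alpha\times\alpha):\mathbb N^2\to\mathbb R$ is computable; it is perfect if it has no isolated points. Baire space $\mathbb N^{\mathbb N}$ is a computable Polish space with its usual metric.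 The Cauchy representation is $\delta_X(p)=\lim_n\alpha(p(n))$, for those $p$ with $d(\alpha p(n),\alpha p(k))<2^{-k}$ for all $k$ and $n\ge k$. $X\sqcup\{\infty\}$ is $X$ with an additional isolated point $\infty$ at distance $1$ from all other points. $\mathcal A_-(X)$ is the set of closed subsets of $X$ with representation $\psi_-(p):=X\setminus\bigcup_iB_{p(i)}$, where $B_{\langle n,k\rangle}:=B(\alpha(n),\overline k)$ and $\overline k$ is the $k$-th rational in a standard enumeration. $\mathcal A_+(X)$ is the set of closed subsets of $X$ with representation $\psi_+(p)=A$ iff $\delta^{\mathbb N}_{X\sqcup\{\infty\}}(p)=(x_n)_n$ and $\overline{\{x_n:n\in\mathbb N\}}\cap X=A$. $\mathsf{BCT}_{0,X}:\subseteq\mathcal A_-(X)^{\mathbb N}\rightrightarrows X$ and $\mathsf{BCT}_{2,X}:\subseteq\mathcal A_+(X)^{\mathbb N}\rightrightarrows X$ both map $(A_i)_i$ to $X\setminus\bigcup_iA_i$, with domain all $(A_i)_i$ such that every $A_i$ has empty interior. $\mathsf{BCT}_{1,X}:\subseteq\mathcal A_-(X)^{\mathbb N}\rightrightarrows\mathbb N$ and $\mathsf{BCT}_{3,X}:\subseteq\mathcal A_+(X)^{\mathbb N}\rightrightarrows\mathbb N$ both map $(A_i)_i$ to $\{i\in\mathbb N:A_i^\circ\neq\emptyset\}$, with domain all $(A_i)_i$ with $X=\bigcup_iA_i$. *)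

theory Defs
  imports "HOL-Analysis.Analysis" "HOL-Library.Nat_Bijection"
begin

text \<open>
  Computability on Baire space. Programs denote unary partial functions on the natural numbers that
  are recursive relative to an oracle \<open>p\<close>; tuples are coded by the Cantor pairing \<open>prod_encode\<close>.
\<close>

type_synonym baire = "nat \<Rightarrow> nat"

datatype prog =
    Zero | Succ | Fst | Snd | Oracle
  | Pair prog prog | Comp prog prog | Prec prog prog | Mu prog

primrec run :: "prog \<Rightarrow> baire \<Rightarrow> nat \<Rightarrow> nat option" where
  "run Zero p n = Some 0"
| "run Succ p n = Some (Suc n)"
| "run Fst p n = Some (fst (prod_decode n))"
| "run Snd p n = Some (snd (prod_decode n))"
| "run Oracle p n = Some (p n)"
| "run (Pair f g) p n =
     Option.bind (run f p n) (\<lambda>a. Option.bind (run g p n) (\<lambda>b. Some (prod_encode (a, b))))"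
| "run (Comp f g) p n = Option.bind (run g p n) (run f p)"
| "run (Prec f g) p n =
     (case prod_decode n of (a, m) \<Rightarrow>
        rec_nat (run f p a)
          (\<lambda>i r. Option.bind r (\<lambda>b. run g p (prod_encode (a, prod_encode (i, b))))) m)"
| "run (Mu f) p n =
     (if \<exists>m. run f p (prod_encode (n, m)) = Some 0 \<and>
             (\<forall>i<m. run f p (prod_encode (n, i)) \<noteq> None)
      then Some (LEAST m. run f p (prod_encode (n, m)) = Some 0) else None)"

text \<open>
  A partial function on Baire space is computable if some program computes it on its domain.
  Nothing is required outside the domain, so restrictions of computable functions are computable;
  this has no effect on reducibility, as realizers may be extended.
\<close>

definition computable :: "(baire \<rightharpoonup> baire) \<Rightarrow> bool" where
  "computable F \<longleftrightarrow> (\<exists>c. \<forall>p q. F p = Some q \<longrightarrow> (\<forall>n. run c p n = Some (q n)))"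

text \<open>
  A representation is a partial map from Baire space; the represented set is its range.
\<close>

type_synonym 'x repr = "baire \<rightharpoonup> 'x"

definition nat_rep :: "nat repr" where
  "nat_rep p = Some (p 0)"

definition prod_rep :: "'x repr \<Rightarrow> 'y repr \<Rightarrow> ('x \<times> 'y) repr" where
  "prod_rep \<delta> \<epsilon> p =
     Option.bind (\<delta> (\<lambda>n. p (2 * n))) (\<lambda>x. Option.bind (\<epsilon> (\<lambda>n. p (2 * n + 1))) (\<lambda>y. Some (x, y)))"

definition seq_rep :: "'x repr \<Rightarrow> (nat \<Rightarrow> 'x) repr" where
  "seq_rep \<delta> p =
     (if \<forall>i. (\<lambda>j. p (prod_encode (i, j))) \<in> dom \<delta>
      then Some (\<lambda>i. the (\<delta> (\<lambda>j. p (prod_encode (i, j))))) else None)"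

text \<open>
  A partial multi-valued function is a set-valued function; its domain consists of the points
  with nonempty value.
\<close>

record ('x, 'y) problem =
  in_rep :: "'x repr"
  out_rep :: "'y repr"
  mv :: "'x \<Rightarrow> 'y set"

definition realizes :: "(baire \<rightharpoonup> baire) \<Rightarrow> ('x, 'y) problem \<Rightarrow> bool" where
  "realizes F f \<longleftrightarrow>
     (\<forall>p x. in_rep f p = Some x \<and> mv f x \<noteq> {} \<longrightarrow>
        (\<exists>q y. F p = Some q \<and> out_rep f q = Some y \<and> y \<in> mv f x))"

definition sW_le :: "('x, 'y) problem \<Rightarrow> ('u, 'v) problem \<Rightarrow> bool"  (infix "\<le>\<^sub>s\<^sub>W" 50) where
  "f \<le>\<^sub>s\<^sub>W g \<longleftrightarrow>
     (\<exists>H K. computable H \<and> computable K \<and>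
        (\<forall>G. realizes G g \<longrightarrow> realizes (H \<circ>\<^sub>m (G \<circ>\<^sub>m K)) f))"

definition sW_equiv :: "('x, 'y) problem \<Rightarrow> ('u, 'v) problem \<Rightarrow> bool"  (infix "\<equiv>\<^sub>s\<^sub>W" 50) where
  "f \<equiv>\<^sub>s\<^sub>W g \<longleftrightarrow> f \<le>\<^sub>s\<^sub>W g \<and> g \<le>\<^sub>s\<^sub>W f"

definition computable_map :: "'x repr \<Rightarrow> 'y repr \<Rightarrow> ('x \<Rightarrow> 'y) \<Rightarrow> bool" where
  "computable_map \<delta> \<epsilon> f \<longleftrightarrow>
     (\<exists>F. computable F \<and> realizes F \<lparr>in_rep = \<delta>, out_rep = \<epsilon>, mv = (\<lambda>x. {f x})\<rparr>)"

definition cauchy_rep :: "'a metric \<Rightarrow> (nat \<Rightarrow> 'a) \<Rightarrow> 'a repr" where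
  "cauchy_rep X \<alpha> p =
     (if (\<forall>k. \<forall>n\<ge>k. mdist X (\<alpha> (p n)) (\<alpha> (p k)) < 1 / 2 ^ k) \<and>
         (\<exists>x. limitin (mtopology_of X) (\<lambda>n. \<alpha> (p n)) x sequentially)
      then Some (THE x. limitin (mtopology_of X) (\<lambda>n. \<alpha> (p n)) x sequentially) else None)"

text \<open>The enumeration \<open>\<langle>\<langle>i, j\<rangle>, k\<rangle> \<mapsto> (i - j) / (k + 1)\<close> of the rationals.\<close>

definition rat_seq :: "nat \<Rightarrow> real" where
  "rat_seq n = (case prod_decode n of (m, k) \<Rightarrow>
     case prod_decode m of (i, j) \<Rightarrow> (real i - real j) / (real k + 1))"

definition real_rep :: "real repr" where
  "real_rep = cauchy_rep euclidean_metric rat_seq"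

definition computable_Polish :: "'a metric \<Rightarrow> (nat \<Rightarrow> 'a) \<Rightarrow> bool" where
  "computable_Polish X \<alpha> \<longleftrightarrow>
     mcomplete_of X \<and> range \<alpha> \<subseteq> mspace X \<and>
     mtopology_of X closure_of range \<alpha> = mspace X \<and>
     computable_map (prod_rep nat_rep nat_rep) real_rep (\<lambda>(i, j). mdist X (\<alpha> i) (\<alpha> j))"

definition perfect :: "'a metric \<Rightarrow> bool" where
  "perfect X \<longleftrightarrow> (\<forall>x \<in> mspace X. \<not> openin (mtopology_of X) {x})"

definition baire_dist :: "baire \<Rightarrow> baire \<Rightarrow> real" where
  "baire_dist p q = (if p = q then 0 else 1 / 2 ^ (LEAST n. p n \<noteq> q n))"

definition baire_metric :: "baire metric" where
  "baire_metric = metric (UNIV, baire_dist)"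

text \<open>The dense sequence enumerates the eventually zero sequences.\<close>

definition baire_seq :: "nat \<Rightarrow> baire" where
  "baire_seq n = (\<lambda>k. if k < length (list_decode n) then list_decode n ! k else 0)"

text \<open>
  The space \<open>X \<squnion> {\<infinity>}\<close>, with \<open>None\<close> as \<open>\<infinity>\<close>. If \<open>X\<close> has diameter greater than 2, keeping the
  distances of \<open>X\<close> would violate the triangle inequality, so they are cut off at 2. Neither the
  topology nor the Cauchy representation depends on this, since the latter only tests whether
  distances are less than numbers \<open>1 / 2 ^ k \<le> 1\<close>.
\<close>

definition infty_dist :: "'a metric \<Rightarrow> 'a option \<Rightarrow> 'a option \<Rightarrow> real" where
  "infty_dist X u v = (case (u, v) of
       (Some x, Some y) \<Rightarrow> min 2 (mdist X x y)
     | (None, None) \<Rightarrow> 0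
     | _ \<Rightarrow> 1)"

definition infty_metric :: "'a metric \<Rightarrow> 'a option metric" where
  "infty_metric X = metric (insert None (Some ` mspace X), infty_dist X)"

definition infty_seq :: "(nat \<Rightarrow> 'a) \<Rightarrow> nat \<Rightarrow> 'a option" where
  "infty_seq \<alpha> n = (case n of 0 \<Rightarrow> None | Suc m \<Rightarrow> Some (\<alpha> m))"

text \<open>The representations of the closed subsets of \<open>X\<close> by negative and by positive information.\<close>

definition closed_neg_rep :: "'a metric \<Rightarrow> (nat \<Rightarrow> 'a) \<Rightarrow> 'a set repr" where
  "closed_neg_rep X \<alpha> p =
     Some (mspace X - (\<Union>i. case prod_decode (p i) of (n, k) \<Rightarrow> mball_of X (\<alpha> n) (rat_seq k)))"

definition closed_pos_rep :: "'a metric \<Rightarrow> (nat \<Rightarrow> 'a) \<Rightarrow> 'a set repr" where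
  "closed_pos_rep X \<alpha> p =
     map_option
       (\<lambda>x. {a \<in> mspace X. Some a \<in> mtopology_of (infty_metric X) closure_of range x})
       (seq_rep (cauchy_rep (infty_metric X) (infty_seq \<alpha>)) p)"

text \<open>
  On complete nonempty \<open>X\<close>, the values below are nonempty on the respective conditions by the
  Baire category theorem, so these conditions describe the domains.
\<close>

definition BCT_point :: "'a metric \<Rightarrow> (nat \<Rightarrow> 'a set) \<Rightarrow> 'a set" where
  "BCT_point X A =
     (if \<forall>i. closedin (mtopology_of X) (A i) \<and> mtopology_of X interior_of A i = {}
      then mspace X - (\<Union>i. A i) else {})"

definition BCT_index :: "'a metric \<Rightarrow> (nat \<Rightarrow> 'a set) \<Rightarrow> nat set" where
  "BCT_index X A =
     (if (\<forall>i. closedin (mtopology_of X) (A i)) \<and> mspace X = (\<Union>i. A i)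
      then {i. mtopology_of X interior_of A i \<noteq> {}} else {})"

definition BCT0 :: "'a metric \<Rightarrow> (nat \<Rightarrow> 'a) \<Rightarrow> (nat \<Rightarrow> 'a set, 'a) problem" where
  "BCT0 X \<alpha> = \<lparr>in_rep = seq_rep (closed_neg_rep X \<alpha>), out_rep = cauchy_rep X \<alpha>, mv = BCT_point X\<rparr>"

definition BCT1 :: "'a metric \<Rightarrow> (nat \<Rightarrow> 'a) \<Rightarrow> (nat \<Rightarrow> 'a set, nat) problem" where
  "BCT1 X \<alpha> = \<lparr>in_rep = seq_rep (closed_neg_rep X \<alpha>), out_rep = nat_rep, mv = BCT_index X\<rparr>"

definition BCT2 :: "'a metric \<Rightarrow> (nat \<Rightarrow> 'a) \<Rightarrow> (nat \<Rightarrow> 'a set, 'a) problem" where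
  "BCT2 X \<alpha> = \<lparr>in_rep = seq_rep (closed_pos_rep X \<alpha>), out_rep = cauchy_rep X \<alpha>, mv = BCT_point X\<rparr>"

definition BCT3 :: "'a metric \<Rightarrow> (nat \<Rightarrow> 'a) \<Rightarrow> (nat \<Rightarrow> 'a set, nat) problem" where
  "BCT3 X \<alpha> = \<lparr>in_rep = seq_rep (closed_pos_rep X \<alpha>), out_rep = nat_rep, mv = BCT_index X\<rparr>"

lemma Metric_space_baire_dist: "Metric_space UNIV baire_dist"
proof
  fix p q r :: baire
  show "0 \<le> baire_dist p q" by (simp add: baire_dist_def)
  show "baire_dist p q = baire_dist q p"
  proof -
    have "(\<lambda>n. p n \<noteq> q n) = (\<lambda>n. q n \<noteq> p n)" by auto
    then show ?thesis by (simp add: baire_dist_def)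
  qed
  show "baire_dist p q = 0 \<longleftrightarrow> p = q" by (simp add: baire_dist_def)
  show "baire_dist p r \<le> baire_dist p q + baire_dist q r"
  proof (cases "p = q \<or> q = r \<or> p = r")
    case True
    then show ?thesis by (auto simp: baire_dist_def)
  next
    case False
    define m where "m = (LEAST n. p n \<noteq> r n)"
    have "p m \<noteq> r m" unfolding m_def by (rule LeastI_ex) (use False in auto)
    then have "p m \<noteq> q m \<or> q m \<noteq> r m" by auto
    then have "(LEAST n. p n \<noteq> q n) \<le> m \<or> (LEAST n. q n \<noteq> r n) \<le> m" by (metis (mono_tags, lifting) Least_le)
    then have "1 / 2 ^ m \<le> baire_dist p q \<or> 1 / 2 ^ m \<le> baire_dist q r"
      using False by (auto simp: baire_dist_def intro!: divide_left_mono)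
    moreover have "0 \<le> baire_dist p q" "0 \<le> baire_dist q r" by (auto simp: baire_dist_def)
    moreover have "baire_dist p r = 1 / 2 ^ m" using False by (simp add: baire_dist_def m_def)
    ultimately show ?thesis by linarith
  qed
qed

lemma Metric_space_infty_dist: "Metric_space (insert None (Some ` mspace X)) (infty_dist X)"
proof
  fix u v :: "'a option"
  show "0 \<le> infty_dist X u v" by (auto simp: infty_dist_def split: option.split)
  show "infty_dist X u v = infty_dist X v u"
    by (auto simp: infty_dist_def mdist_commute split: option.split)
next
  have zero: "min 2 (mdist X x y) = 0 \<longleftrightarrow> x = y" if "x \<in> mspace X" "y \<in> mspace X" for x y
    using mdist_zero[OF that] by (cases "x = y") auto
  fix u v assume "u \<in> insert None (Some ` mspace X)" "v \<in> insert None (Some ` mspace X)"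
  then show "infty_dist X u v = 0 \<longleftrightarrow> u = v"
    by (auto simp: infty_dist_def zero split: option.split)
next
  have triangle: "min 2 (mdist X x z) \<le> min 2 (mdist X x y) + min 2 (mdist X y z)"
    if "x \<in> mspace X" "y \<in> mspace X" "z \<in> mspace X" for x y z
    using mdist_triangle[OF that] mdist_nonneg[of X x y] mdist_nonneg[of X y z] by linarith
  fix u v w
  assume "u \<in> insert None (Some ` mspace X)" "v \<in> insert None (Some ` mspace X)"
    "w \<in> insert None (Some ` mspace X)"
  then show "infty_dist X u w \<le> infty_dist X u v + infty_dist X v w"
    by (auto simp: infty_dist_def triangle split: option.split)
qed

lemma BCT_point_nonempty:
  assumes "mcomplete_of X" "mspace X \<noteq> {}"
    and "\<And>i. closedin (mtopology_of X) (A i)" "\<And>i. mtopology_of X interior_of A i = {}"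
  shows "BCT_point X A \<noteq> {}"
proof -
  have "mtopology_of X interior_of \<Union> (range A) = {}"
    unfolding mtopology_of_def
    by (rule Metric_space.metric_Baire_category_alt)
       (use assms in \<open>auto simp: mcomplete_of_def mtopology_of_def\<close>)
  then have "\<Union> (range A) \<noteq> mspace X"
    using assms(2) by (metis interior_of_topspace topspace_mtopology_of)
  moreover have "\<Union> (range A) \<subseteq> mspace X"
    using assms(3) closedin_subset by fastforce
  ultimately show ?thesis using assms(3,4) by (auto simp: BCT_point_def)
qed

lemma BCT_index_nonempty:
  assumes "mcomplete_of X" "mspace X \<noteq> {}"
    and "\<And>i. closedin (mtopology_of X) (A i)" "mspace X = (\<Union>i. A i)"
  shows "BCT_index X A \<noteq> {}"
proof -
  have "mspace X - (\<Union>i. A i) = {}" using assms(4) by simp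
  then have "BCT_point X A = {}" unfolding BCT_point_def by (simp only: if_cancel)
  then have "\<not> (\<forall>i. mtopology_of X interior_of A i = {})"
    using BCT_point_nonempty[of X A] assms(1-3) by metis
  then have "{i. mtopology_of X interior_of A i \<noteq> {}} \<noteq> {}" by simp
  moreover have "BCT_index X A = {i. mtopology_of X interior_of A i \<noteq> {}}"
    unfolding BCT_index_def by (rule if_P) (intro conjI allI assms(3,4))
  ultimately show ?thesis by simp
qed

end

theory Submission
  imports Defs
begin

text \<open>
  Each of the four problems on a computable perfect Polish space \<open>X\<close> is equivalent to a combinatorial
  version of itself on Baire space, in which points are given as themselves and closed sets by
  cylinders (\<open>cyl_BCT0\<close> to \<open>cyl_BCT3\<close>, equivalences in \<open>BCT_equiv_cyl\<close>). As Baire space is itself a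
  computable perfect Polish space, the corollary follows by transitivity. The two directions of the
  equivalence use two different maps.

  \<^emph>\<open>From \<open>X\<close> to Baire space.\<close> A sequence of natural numbers is read as a sequence of formally nested
  balls, and \<open>proj\<close> maps it to their common point. This is a computable surjection that is open: the
  image of a cylinder is a ball. Hence \<open>A\<close> has interior points iff \<open>proj -` A\<close> contains a
  cylinder, so solutions for the preimages give solutions for the given sets. A negative name of
  \<open>proj -` A\<close> is computed from one of \<open>A\<close> by continuity. A positive one is computed by openness:
  each of the enumerated points is lifted into every cylinder whose image contains it.

  \<^emph>\<open>From Baire space to \<open>X\<close>.\<close> A diagonal argument gives radii \<open>radius j\<close>, tending to \<open>0\<close>, that differ from
  all distances between points of the dense sequence \<open>\<alpha>\<close>. So it is decidable which of these
  points lie in which of the balls of radius \<open>radius j\<close> around them. Sorting points by the first ball of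
  each level that contains them gives pairwise disjoint open cells with dense union, and on \<open>\<alpha>\<close>
  the cells are decidable. Since \<open>X\<close> is perfect, every cell contains infinitely many disjoint smaller
  cells that are dense in it; enumerating them gives a tree of cells \<open>V p n\<close> with a branch for every
  \<open>p\<close> in Baire space. A generic point \<open>x\<close>, namely one in the intersection of certain dense open
  sets \<open>W n\<close>, lies on exactly one branch, and this branch can be computed from a name of \<open>x\<close>.
  Conversely, every branch \<open>p\<close> determines a point \<open>iota p\<close>, the limit of its cells.

  Given closed sets \<open>A i\<close> in Baire space, the reduction asks for a solution with respect to closed
  sets in \<open>X\<close> whose generic points are those with their branch in \<open>A i\<close>, together with closed
  nowhere dense sets that cover the complements of the \<open>W n\<close>. The latter force the solution to be
  generic in the point problems, and they can never be the answer in the index problems. Negatively,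
  one removes the cells of all marked cylinders and takes the complements of the \<open>W n\<close> themselves.
  Positively, one takes the closure of the image of \<open>A i\<close> under \<open>iota\<close>. Since no dense sequence in the
  complement of \<open>W n\<close> is available, the set \<open>shell n\<close> takes its place: the closure of
  those points of locally finite nets in \<open>X\<close>, of increasing fineness, that are not yet seen to
  be well inside \<open>W n\<close>. It contains the complement of \<open>W n\<close>, and the points added are locally finite in
  \<open>W n\<close>, so that perfectness makes it nowhere dense.
\<close>

section \<open>Functions computed relative to an oracle\<close>

abbreviation pr :: "nat \<Rightarrow> nat \<Rightarrow> nat" where "pr a b \<equiv> prod_encode (a, b)"
abbreviation fs :: "nat \<Rightarrow> nat" where "fs n \<equiv> fst (prod_decode n)"
abbreviation sn :: "nat \<Rightarrow> nat" where "sn n \<equiv> snd (prod_decode n)"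

text \<open>
  The program has to be total only for oracles in \<open>D\<close>. Unbounded search is therefore available
  whenever its success follows from the oracle being a name of the right kind.
\<close>

definition orec :: "baire set \<Rightarrow> (baire \<Rightarrow> nat \<Rightarrow> nat) \<Rightarrow> bool" where
  "orec D f \<longleftrightarrow> (\<exists>c. \<forall>p\<in>D. \<forall>n. run c p n = Some (f p n))"

text \<open>
  Truth is coded by \<open>0\<close>, the value that \<open>Mu\<close> searches for.
\<close>

definition odec :: "baire set \<Rightarrow> (baire \<Rightarrow> nat \<Rightarrow> bool) \<Rightarrow> bool" where
  "odec D P \<longleftrightarrow> orec D (\<lambda>p n. if P p n then 0 else 1)"

lemma orecI: "(\<And>p n. p \<in> D \<Longrightarrow> run c p n = Some (f p n)) \<Longrightarrow> orec D f"
  by (auto simp: orec_def)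

lemma orec_cong: "orec D f \<Longrightarrow> (\<And>p n. p \<in> D \<Longrightarrow> f p n = g p n) \<Longrightarrow> orec D g"
  unfolding orec_def by metis

lemma orec_mono: "orec E f \<Longrightarrow> D \<subseteq> E \<Longrightarrow> orec D f"
  unfolding orec_def by blast

lemma orec_id: "orec D (\<lambda>p n. n)"
  by (rule orecI[of _ "Pair Fst Snd"]) simp

lemma orec_comp:
  assumes "orec D g" "orec D f"
  shows "orec D (\<lambda>p n. g p (f p n))"
proof -
  obtain cg cf where "\<forall>p\<in>D. \<forall>n. run cg p n = Some (g p n)" "\<forall>p\<in>D. \<forall>n. run cf p n = Some (f p n)"
    using assms unfolding orec_def by blast
  then show ?thesis by (intro orecI[of _ "Comp cg cf"]) simp
qed

lemma orec_Suc: "orec D f \<Longrightarrow> orec D (\<lambda>p n. Suc (f p n))"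
  by (rule orec_comp[of D "\<lambda>p. Suc"]) (auto intro: orecI[of _ Succ])

lemma orec_const: "orec D (\<lambda>p n. k)"
  by (induction k) (auto intro: orecI[of _ Zero] orec_Suc)

lemma orec_fs: "orec D f \<Longrightarrow> orec D (\<lambda>p n. fs (f p n))"
  by (rule orec_comp[of D "\<lambda>p n. fs n"]) (auto intro: orecI[of _ Fst])

lemma orec_sn: "orec D f \<Longrightarrow> orec D (\<lambda>p n. sn (f p n))"
  by (rule orec_comp[of D "\<lambda>p n. sn n"]) (auto intro: orecI[of _ Snd])

lemma orec_oracle: "orec D f \<Longrightarrow> orec D (\<lambda>p n. p (f p n))"
  by (rule orec_comp[of D "\<lambda>p n. p n"]) (auto intro: orecI[of _ Oracle])

lemma orec_pr:
  assumes "orec D f" "orec D g"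
  shows "orec D (\<lambda>p n. pr (f p n) (g p n))"
proof -
  obtain cf cg where "\<forall>p\<in>D. \<forall>n. run cg p n = Some (g p n)" "\<forall>p\<in>D. \<forall>n. run cf p n = Some (f p n)"
    using assms unfolding orec_def by blast
  then show ?thesis by (intro orecI[of _ "Pair cf cg"]) simp
qed

lemma orec_comp2:
  assumes "orec D (\<lambda>p n. g p (fs n) (sn n))" "orec D a" "orec D b"
  shows "orec D (\<lambda>p n. g p (a p n) (b p n))"
  using orec_comp[OF assms(1) orec_pr[OF assms(2,3)]] by simp

lemma orec_comp3:
  assumes "orec D (\<lambda>p n. g p (fs n) (fs (sn n)) (sn (sn n)))" "orec D a" "orec D b" "orec D c"
  shows "orec D (\<lambda>p n. g p (a p n) (b p n) (c p n))"
  using orec_comp[OF assms(1) orec_pr[OF assms(2) orec_pr[OF assms(3,4)]]] by simp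

lemma orec_comp4:
  assumes "orec D (\<lambda>p n. g p (fs n) (fs (sn n)) (fs (sn (sn n))) (sn (sn (sn n))))"
    "orec D a" "orec D b" "orec D c" "orec D d"
  shows "orec D (\<lambda>p n. g p (a p n) (b p n) (c p n) (d p n))"
  using orec_comp[OF assms(1) orec_pr[OF assms(2) orec_pr[OF assms(3) orec_pr[OF assms(4,5)]]]] by simp

text \<open>
  The argument of \<open>g\<close> codes the parameter, the index and the accumulated value as \<open>Prec\<close> does.
\<close>

lemma orec_rec:
  assumes f: "orec D f" and g: "orec D (\<lambda>p n. g p (fs n) (fs (sn n)) (sn (sn n)))" and h: "orec D h"
  shows "orec D (\<lambda>p n. rec_nat (f p n) (\<lambda>i r. g p n i r) (h p n))"
proof -
  obtain cf cg where cf: "\<And>p n. p \<in> D \<Longrightarrow> run cf p n = Some (f p n)"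
    and cg: "\<And>p n. p \<in> D \<Longrightarrow> run cg p n = Some (g p (fs n) (fs (sn n)) (sn (sn n)))"
    using f g unfolding orec_def by blast
  have "run (Prec cf cg) p (pr a m) = Some (rec_nat (f p a) (\<lambda>i r. g p a i r) m)" if "p \<in> D" for p a m
    using that by (induction m) (simp_all add: cf cg)
  then have "orec D (\<lambda>p n. rec_nat (f p (fs n)) (\<lambda>i r. g p (fs n) i r) (sn n))"
    by (intro orecI[of _ "Prec cf cg"]) (metis prod.collapse prod_decode_inverse)
  from orec_comp2[OF this orec_id h] show ?thesis .
qed

lemma orec_Least:
  assumes P: "odec D (\<lambda>p n. P p (fs n) (sn n))" and ex: "\<And>p n. p \<in> D \<Longrightarrow> \<exists>m. P p n m"
  shows "orec D (\<lambda>p n. LEAST m. P p n m)"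
proof -
  obtain c where c: "\<And>p n. p \<in> D \<Longrightarrow> run c p n = Some (if P p (fs n) (sn n) then 0 else 1)"
    using P unfolding odec_def orec_def by blast
  show ?thesis
    by (rule orecI[of _ "Mu c"]) (use ex in \<open>auto simp: c\<close>)
qed

text \<open>
  Oracle substitution with a parameter: on input \<open>\<langle>a, n\<rangle>\<close> the program \<open>psub g c\<close> runs \<open>c\<close> on \<open>n\<close> with
  the oracle \<open>k \<mapsto> g \<langle>a, k\<rangle>\<close>. The parameter is carried through every construct, so each subprogram
  that rearranges its input has to reinsert it.
\<close>

primrec psub :: "prog \<Rightarrow> prog \<Rightarrow> prog" where
  "psub g Zero = Zero"
| "psub g Succ = Comp Succ Snd"
| "psub g Fst = Comp Fst Snd"
| "psub g Snd = Comp Snd Snd"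
| "psub g Oracle = g"
| "psub g (Pair c d) = Pair (psub g c) (psub g d)"
| "psub g (Comp c d) = Comp (psub g c) (Pair Fst (psub g d))"
| "psub g (Prec c d) =
     Comp (Prec (psub g c) (Comp (psub g d) (Pair (Comp Fst Fst) (Pair (Comp Snd Fst) Snd))))
       (Pair (Pair Fst (Comp Fst Snd)) (Comp Snd Snd))"
| "psub g (Mu c) = Mu (Comp (psub g c) (Pair (Comp Fst Fst) (Pair (Comp Snd Fst) Snd)))"

lemma run_psub:
  assumes g: "\<And>k. run g p (pr a k) = Some (q k)"
  shows "run (psub g c) p (pr a n) = run c q n"
proof (induction c arbitrary: n)
  case (Comp c d)
  then show ?case by (cases "run d q n") simp_all
next
  case (Prec c d)
  obtain b m where n: "n = pr b m" by (metis prod.collapse prod_decode_inverse)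
  have "rec_nat (run c q b) (\<lambda>i r. Option.bind r (\<lambda>x. run d q (pr b (pr i x)))) m =
        rec_nat (run (psub g c) p (pr a b))
          (\<lambda>i r. Option.bind r (\<lambda>x. run (psub g d) p (pr a (pr b (pr i x))))) m"
    by (simp only: Prec.IH)
  then show ?case by (simp add: n)
qed (simp_all add: g)

text \<open>
  Functionals may be applied to oracles that vary with the input. A recursion along the entries of
  an oracle is thus also a recursion along the entries of a coded word.
\<close>

lemma orec_app_on:
  assumes F: "orec E F" and g: "orec D (\<lambda>p n. g p (fs n) (sn n))" and h: "orec D h"
    and E: "\<And>p n. p \<in> D \<Longrightarrow> g p n \<in> E"
  shows "orec D (\<lambda>p n. F (g p n) (h p n))"
proof -
  obtain c cg where c: "\<And>p n. p \<in> E \<Longrightarrow> run c p n = Some (F p n)"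
    and cg: "\<And>p n. p \<in> D \<Longrightarrow> run cg p n = Some (g p (fs n) (sn n))"
    using F g unfolding orec_def by blast
  have "run (psub cg c) p (pr n k) = Some (F (g p n) k)" if "p \<in> D" for p n k
    using run_psub[of cg p n "g p n" c k] c cg E that by simp
  then have "orec D (\<lambda>p n. F (g p (fs n)) (sn n))"
    by (intro orecI[of _ "psub cg c"]) (metis prod.collapse prod_decode_inverse)
  from orec_comp2[OF this orec_id h] show ?thesis .
qed

lemma orec_app:
  assumes "orec UNIV F" "orec D (\<lambda>p n. g p (fs n) (sn n))" "orec D h"
  shows "orec D (\<lambda>p n. F (\<lambda>k. g p n k) (h p n))"
  by (rule orec_app_on[OF assms]) simp

lemma orec_if:
  assumes "odec D P" "orec D f" "orec D g"
  shows "orec D (\<lambda>p n. if P p n then f p n else g p n)"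
proof -
  have "orec D (\<lambda>p n. rec_nat (f p n) (\<lambda>i r. g p n) (if P p n then 0 else 1))"
    by (intro orec_rec orec_comp[OF assms(3)] orec_fs orec_id assms assms(1)[unfolded odec_def])
  then show ?thesis by (rule orec_cong) auto
qed

lemma orec_add:
  assumes "orec D f" "orec D g"
  shows "orec D (\<lambda>p n. f p n + g p n)"
proof -
  have "orec D (\<lambda>p n. rec_nat (f p n) (\<lambda>i r. Suc r) (g p n))"
    by (intro orec_rec orec_Suc orec_sn orec_id assms)
  moreover have "rec_nat a (\<lambda>i r. Suc r) b = a + b" for a b :: nat by (induction b) auto
  ultimately show ?thesis by simp
qed

lemma orec_mult:
  assumes "orec D f" "orec D g"
  shows "orec D (\<lambda>p n. f p n * g p n)"
proof -
  have "orec D (\<lambda>p n. rec_nat 0 (\<lambda>i r. f p n + r) (g p n))"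
    by (intro orec_rec orec_add orec_comp[OF assms(1)] orec_fs orec_sn orec_id orec_const assms)
  moreover have "rec_nat 0 (\<lambda>i r. a + r) b = a * b" for a b :: nat by (induction b) auto
  ultimately show ?thesis by simp
qed

lemma orec_power:
  assumes "orec D f" "orec D g"
  shows "orec D (\<lambda>p n. f p n ^ g p n)"
proof -
  have "orec D (\<lambda>p n. rec_nat 1 (\<lambda>i r. f p n * r) (g p n))"
    by (intro orec_rec orec_mult orec_comp[OF assms(1)] orec_fs orec_sn orec_id orec_const assms)
  moreover have "rec_nat 1 (\<lambda>i r. a * r) b = a ^ b" for a b :: nat by (induction b) auto
  ultimately show ?thesis by simp
qed

lemma orec_diff:
  assumes "orec D f" "orec D g"
  shows "orec D (\<lambda>p n. f p n - g p n)"
proof -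
  have pred: "orec D (\<lambda>p n. rec_nat 0 (\<lambda>i r. i) (n::nat))"
    by (intro orec_rec orec_fs orec_sn orec_id orec_const)
  have "orec D (\<lambda>p n. rec_nat (f p n) (\<lambda>i r. rec_nat 0 (\<lambda>i r. i) r) (g p n))"
    by (intro orec_rec orec_comp[OF pred] orec_sn orec_id assms)
  moreover have "rec_nat a (\<lambda>i r. rec_nat 0 (\<lambda>i r. i) r) b = a - b" for a b :: nat
  proof (induction b)
    case (Suc b)
    then show ?case by (cases "a - b") auto
  qed simp
  ultimately show ?thesis by simp
qed

lemma odec_le:
  assumes "orec D f" "orec D g"
  shows "odec D (\<lambda>p n. f p n \<le> g p n)"
proof -
  have "orec D (\<lambda>p n. 1 - (Suc (g p n) - f p n))"
    by (intro orec_diff orec_Suc orec_const assms)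
  then show ?thesis unfolding odec_def by (rule orec_cong) auto
qed

lemma odec_not: "odec D P \<Longrightarrow> odec D (\<lambda>p n. \<not> P p n)"
  unfolding odec_def by (drule orec_diff[OF orec_const[of _ 1]]) (erule orec_cong, simp)

lemma odec_conj:
  assumes "odec D P" "odec D Q"
  shows "odec D (\<lambda>p n. P p n \<and> Q p n)"
  using orec_if[OF assms(1) assms(2)[unfolded odec_def] orec_const[of _ 1]]
  unfolding odec_def by (rule orec_cong) simp

lemma odec_disj:
  assumes "odec D P" "odec D Q"
  shows "odec D (\<lambda>p n. P p n \<or> Q p n)"
  using orec_if[OF assms(1) orec_const[of _ 0] assms(2)[unfolded odec_def]]
  unfolding odec_def by (rule orec_cong) simp

lemma odec_imp:
  assumes "odec D P" "odec D Q"
  shows "odec D (\<lambda>p n. P p n \<longrightarrow> Q p n)"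
  unfolding imp_conv_disj by (intro odec_disj odec_not assms)

lemma odec_less: "orec D f \<Longrightarrow> orec D g \<Longrightarrow> odec D (\<lambda>p n. f p n < g p n)"
  unfolding Suc_le_eq[symmetric] by (intro odec_le orec_Suc)

lemma odec_eq: "orec D f \<Longrightarrow> orec D g \<Longrightarrow> odec D (\<lambda>p n. f p n = g p n)"
  unfolding order_eq_iff by (intro odec_conj odec_le)

lemma odec_all:
  assumes P: "odec D (\<lambda>p n. P p (fs n) (sn n))" and b: "orec D b"
  shows "odec D (\<lambda>p n. \<forall>i<b p n. P p n i)"
proof -
  define ch where "ch p n i = (if P p n i then 0 else (1 :: nat))" for p n i
  have c: "orec D (\<lambda>p n. ch p (fs n) (sn n))" using P by (simp add: odec_def ch_def)
  have "orec D (\<lambda>p n. rec_nat 0 (\<lambda>i r. if r = 0 then ch p n i else 1) (b p n))"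
    by (intro orec_rec orec_if odec_eq orec_comp2[OF c] orec_sn orec_fs orec_id orec_const b)
  moreover have "rec_nat 0 (\<lambda>i r. if r = 0 then if Q i then 0 else 1 else 1) m =
      (if \<forall>i<m. Q i then 0 else (1::nat))" for Q m
    by (induction m) (auto simp: less_Suc_eq)
  ultimately show ?thesis unfolding odec_def ch_def by simp
qed

lemmas orec_intros = orec_if orec_add orec_mult orec_power orec_diff odec_le odec_conj odec_disj odec_imp
  odec_less odec_eq odec_not odec_all orec_rec orec_pr orec_fs orec_sn orec_oracle orec_Suc orec_id orec_const

section \<open>Strong Weihrauch reductions\<close>

lemma computableI: "orec D f \<Longrightarrow> computable (\<lambda>p. if p \<in> D then Some (f p) else None)"
  unfolding orec_def computable_def by (auto split: if_splits)

lemma computable_map_comp: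
  assumes "computable F" "computable G"
  shows "computable (F \<circ>\<^sub>m G)"
proof -
  obtain c d where c: "\<And>p q n. F p = Some q \<Longrightarrow> run c p n = Some (q n)"
    and d: "\<And>p q n. G p = Some q \<Longrightarrow> run d p n = Some (q n)"
    using assms unfolding computable_def by blast
  have "run (Comp (psub (Comp d Snd) c) (Pair Zero (Pair Fst Snd))) p n = Some (r n)"
    if "(F \<circ>\<^sub>m G) p = Some r" for p r n
  proof -
    obtain q where q: "G p = Some q" "F q = Some r"
      using \<open>(F \<circ>\<^sub>m G) p = Some r\<close> by (auto simp: map_comp_Some_iff)
    have "run (psub (Comp d Snd) c) p (pr 0 n) = run c q n"
      by (rule run_psub) (simp add: d[OF q(1)])
    then show ?thesis by (simp add: c[OF q(2)])
  qed
  then show ?thesis unfolding computable_def by blast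
qed

lemma map_comp_assoc: "(F \<circ>\<^sub>m G) \<circ>\<^sub>m H = F \<circ>\<^sub>m (G \<circ>\<^sub>m H)"
  by (rule ext) (simp add: map_comp_def split: option.split)

lemma sW_le_trans:
  assumes "f \<le>\<^sub>s\<^sub>W g" "g \<le>\<^sub>s\<^sub>W h"
  shows "f \<le>\<^sub>s\<^sub>W h"
proof -
  obtain H K where 1: "computable H" "computable K"
    "\<And>G. realizes G g \<Longrightarrow> realizes (H \<circ>\<^sub>m (G \<circ>\<^sub>m K)) f"
    using assms(1) unfolding sW_le_def by blast
  obtain H' K' where 2: "computable H'" "computable K'"
    "\<And>G. realizes G h \<Longrightarrow> realizes (H' \<circ>\<^sub>m (G \<circ>\<^sub>m K')) g"
    using assms(2) unfolding sW_le_def by blast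
  have "realizes ((H \<circ>\<^sub>m H') \<circ>\<^sub>m (G \<circ>\<^sub>m (K' \<circ>\<^sub>m K))) f" if "realizes G h" for G
    using 1(3)[OF 2(3)[OF that]] by (simp add: map_comp_assoc)
  then show ?thesis
    unfolding sW_le_def using computable_map_comp 1(1,2) 2(1,2) by blast
qed

text \<open>
  The functions \<open>K\<close> and \<open>H\<close> are total here. The sets \<open>D\<close> and \<open>E\<close> take the role of their domains, so
  neither has to be defined by cases.
\<close>

lemma sW_leI:
  assumes K: "orec D K" and H: "orec E H"
    and red: "\<And>p x. in_rep f p = Some x \<Longrightarrow> mv f x \<noteq> {} \<Longrightarrow> p \<in> D \<and>
      (\<exists>x'. in_rep g (K p) = Some x' \<and> mv g x' \<noteq> {} \<and>
        (\<forall>q y. out_rep g q = Some y \<longrightarrow> y \<in> mv g x' \<longrightarrow>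
           q \<in> E \<and> (\<exists>y'. out_rep f (H q) = Some y' \<and> y' \<in> mv f x)))"
  shows "f \<le>\<^sub>s\<^sub>W g"
  unfolding sW_le_def
proof (intro exI conjI allI impI)
  let ?H = "\<lambda>q. if q \<in> E then Some (H q) else None"
  let ?K = "\<lambda>p. if p \<in> D then Some (K p) else None"
  show "computable ?H" "computable ?K" using K H by (auto intro: computableI)
  fix G assume G: "realizes G g"
  show "realizes (?H \<circ>\<^sub>m (G \<circ>\<^sub>m ?K)) f"
    unfolding realizes_def
  proof (intro allI impI, elim conjE)
    fix p x assume "in_rep f p = Some x" "mv f x \<noteq> {}"
    from red[OF this] obtain x' where p: "p \<in> D" and x': "in_rep g (K p) = Some x'" "mv g x' \<noteq> {}"
      and out: "\<And>q y. out_rep g q = Some y \<Longrightarrow> y \<in> mv g x' \<Longrightarrow>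
           q \<in> E \<and> (\<exists>y'. out_rep f (H q) = Some y' \<and> y' \<in> mv f x)" by blast
    obtain q y where "G (K p) = Some q" "out_rep g q = Some y" "y \<in> mv g x'"
      using G x' unfolding realizes_def by blast
    with p out show "\<exists>q y. (?H \<circ>\<^sub>m (G \<circ>\<^sub>m ?K)) p = Some q \<and> out_rep f q = Some y \<and> y \<in> mv f x"
      by (fastforce simp: map_comp_def)
  qed
qed

section \<open>Names in complete separable metric spaces\<close>

lemma limitin_mtopology_of:
  "limitin (mtopology_of X) s x sequentially \<longleftrightarrow>
     x \<in> mspace X \<and> (\<forall>\<epsilon>>0. \<exists>N. \<forall>n\<ge>N. s n \<in> mspace X \<and> mdist X (s n) x < \<epsilon>)"
  unfolding mtopology_of_def
  by (simp add: Metric_space.limit_metric_sequentially)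

lemma limitin_mtopology_of_unique:
  "limitin (mtopology_of X) s x sequentially \<Longrightarrow> limitin (mtopology_of X) s y sequentially \<Longrightarrow> x = y"
  unfolding mtopology_of_def
  by (rule Metric_space.limitin_metric_unique) auto

lemma cauchy_repD:
  assumes "cauchy_rep X \<alpha> p = Some x" and \<alpha>: "range \<alpha> \<subseteq> mspace X"
  shows "x \<in> mspace X" and "k \<le> n \<Longrightarrow> mdist X (\<alpha> (p n)) (\<alpha> (p k)) < 1 / 2 ^ k"
    and "mdist X (\<alpha> (p k)) x \<le> 1 / 2 ^ k"
proof -
  have c: "\<forall>k. \<forall>n\<ge>k. mdist X (\<alpha> (p n)) (\<alpha> (p k)) < 1 / 2 ^ k"
    and ex: "\<exists>x. limitin (mtopology_of X) (\<lambda>n. \<alpha> (p n)) x sequentially"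
    and x: "x = (THE x. limitin (mtopology_of X) (\<lambda>n. \<alpha> (p n)) x sequentially)"
    using assms(1) unfolding cauchy_rep_def by (auto split: if_splits)
  have lim: "limitin (mtopology_of X) (\<lambda>n. \<alpha> (p n)) x sequentially"
    unfolding x using ex by (metis limitin_mtopology_of_unique theI)
  then show xM: "x \<in> mspace X" by (simp add: limitin_mtopology_of)
  show "mdist X (\<alpha> (p n)) (\<alpha> (p k)) < 1 / 2 ^ k" if "k \<le> n" using c that by simp
  show "mdist X (\<alpha> (p k)) x \<le> 1 / 2 ^ k"
  proof (rule field_le_epsilon)
    fix e :: real assume "0 < e"
    then obtain N where N: "\<And>n. n \<ge> N \<Longrightarrow> mdist X (\<alpha> (p n)) x < e"
      using lim unfolding limitin_mtopology_of by meson
    have "mdist X (\<alpha> (p k)) x \<le> mdist X (\<alpha> (p k)) (\<alpha> (p (max N k))) + mdist X (\<alpha> (p (max N k))) x"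
      using \<alpha> xM by (intro mdist_triangle) auto
    moreover have "mdist X (\<alpha> (p k)) (\<alpha> (p (max N k))) < 1 / 2 ^ k"
      using c by (simp add: mdist_commute)
    ultimately show "mdist X (\<alpha> (p k)) x \<le> 1 / 2 ^ k + e" using N[of "max N k"] by simp
  qed
qed

lemma power_half_less: "0 < e \<Longrightarrow> \<exists>n. c / 2 ^ n < (e::real)"
proof -
  assume e: "0 < e"
  obtain n where "c / e < 2 ^ n" using real_arch_pow[of 2 "c / e"] by auto
  then show ?thesis using e by (intro exI[of _ n]) (simp add: field_simps)
qed

lemma power_half_mono: "m \<le> n \<Longrightarrow> 1 / 2 ^ n \<le> 1 / (2 ^ m :: real)"
  by (simp add: field_simps)

text \<open>
  The constant \<open>C\<close> is arbitrary: the speed of convergence is already enforced by the Cauchy condition.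
\<close>

lemma cauchy_repI:
  assumes \<alpha>: "range \<alpha> \<subseteq> mspace X" and x: "x \<in> mspace X"
    and c: "\<And>n k. k \<le> n \<Longrightarrow> mdist X (\<alpha> (p n)) (\<alpha> (p k)) < 1 / 2 ^ k"
    and lim: "\<And>k. mdist X (\<alpha> (p k)) x \<le> C / 2 ^ k"
  shows "cauchy_rep X \<alpha> p = Some x"
proof -
  have L: "limitin (mtopology_of X) (\<lambda>n. \<alpha> (p n)) x sequentially"
    unfolding limitin_mtopology_of
  proof (intro conjI allI impI x)
    fix \<epsilon> :: real assume "0 < \<epsilon>"
    then obtain N where N: "\<bar>C\<bar> / 2 ^ N < \<epsilon>" using power_half_less by blast
    have "mdist X (\<alpha> (p n)) x < \<epsilon>" if "n \<ge> N" for n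
    proof -
      have "C / 2 ^ n \<le> \<bar>C\<bar> / 2 ^ n" by (simp add: divide_right_mono)
      also have "\<dots> \<le> \<bar>C\<bar> / 2 ^ N" using that by (intro divide_left_mono) auto
      finally show ?thesis using lim[of n] N by simp
    qed
    then show "\<exists>N. \<forall>n\<ge>N. \<alpha> (p n) \<in> mspace X \<and> mdist X (\<alpha> (p n)) x < \<epsilon>" using \<alpha> by blast
  qed
  have "(THE x. limitin (mtopology_of X) (\<lambda>n. \<alpha> (p n)) x sequentially) = x"
    using L limitin_mtopology_of_unique by (intro the_equality) auto
  then show ?thesis unfolding cauchy_rep_def using c L by auto
qed

locale separable_complete =
  fixes X :: "'a metric" and \<alpha> :: "nat \<Rightarrow> 'a"
  assumes complete: "mcomplete_of X" and range_\<alpha>: "range \<alpha> \<subseteq> mspace X"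
    and closure_\<alpha>: "mtopology_of X closure_of range \<alpha> = mspace X"
begin

abbreviation M where "M \<equiv> mspace X"
abbreviation d where "d \<equiv> mdist X"

definition bball :: "nat \<Rightarrow> 'a set" where
  "bball b = {x \<in> M. d (\<alpha> (fs b)) x < 1 / 2 ^ sn b}"

lemma in_bball: "x \<in> bball (pr k e) \<longleftrightarrow> x \<in> M \<and> d (\<alpha> k) x < 1 / 2 ^ e"
  by (simp add: bball_def)

lemma \<alpha>_in [simp]: "\<alpha> k \<in> M" using range_\<alpha> by auto

lemma M_nonempty: "M \<noteq> {}" using \<alpha>_in by blast

lemma tri: "x \<in> M \<Longrightarrow> y \<in> M \<Longrightarrow> z \<in> M \<Longrightarrow> d x z \<le> d x y + d y z"
  by (rule mdist_triangle)

lemma d_\<alpha>_self [simp]: "d (\<alpha> k) (\<alpha> k) = 0" using mdist_zero[of "\<alpha> k" X "\<alpha> k"] by simp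

lemma dense: "x \<in> M \<Longrightarrow> 0 < e \<Longrightarrow> \<exists>k. d (\<alpha> k) x < e"
  using closure_\<alpha> unfolding mtopology_of_def
  by (auto simp: Metric_space.metric_closure_of mdist_commute Metric_space.in_mball)

lemma ball_at:
  assumes "x \<in> M" "0 < e"
  shows "\<exists>b. x \<in> bball b \<and> (\<forall>y\<in>bball b. d x y < e)"
proof -
  obtain n where n: "2 / 2 ^ n < e" using power_half_less assms by blast
  obtain k where k: "d (\<alpha> k) x < 1 / 2 ^ n" using dense[OF assms(1), of "1 / 2 ^ n"] by auto
  have "d x y < e" if "y \<in> bball (pr k n)" for y
    using tri[of x "\<alpha> k" y] that assms n k by (auto simp: in_bball mdist_commute[of X x])
  then show ?thesis using k assms by (intro exI[of _ "pr k n"]) (auto simp: in_bball)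
qed

lemma bball_open:
  assumes "x \<in> bball b"
  shows "\<exists>e>0. \<forall>y\<in>M. d x y < e \<longrightarrow> y \<in> bball b"
proof (intro exI[of _ "1 / 2 ^ sn b - d (\<alpha> (fs b)) x"] conjI ballI impI)
  show "0 < 1 / 2 ^ sn b - d (\<alpha> (fs b)) x" using assms by (simp add: bball_def)
  fix y assume "y \<in> M" "d x y < 1 / 2 ^ sn b - d (\<alpha> (fs b)) x"
  then show "y \<in> bball b" using assms tri[of "\<alpha> (fs b)" x y] by (simp add: bball_def)
qed

lemma closedin_iff:
  "closedin (mtopology_of X) A \<longleftrightarrow> A \<subseteq> M \<and> (\<forall>x\<in>M - A. \<exists>b. x \<in> bball b \<and> bball b \<inter> A = {})"
  (is "?L \<longleftrightarrow> ?R")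
proof
  assume ?L
  then have A: "A \<subseteq> M" and r: "\<And>x. x \<in> M - A \<Longrightarrow> \<exists>r>0. disjnt A (mball_of X x r)"
    unfolding mtopology_of_def mball_of_def by (auto simp: Metric_space.closedin_metric)
  have "\<exists>b. x \<in> bball b \<and> bball b \<inter> A = {}" if x: "x \<in> M - A" for x
  proof -
    obtain r where "r > 0" "disjnt A (mball_of X x r)" using r[OF x] by blast
    moreover obtain b where "x \<in> bball b" "\<forall>y\<in>bball b. d x y < r" using ball_at \<open>r > 0\<close> x by blast
    ultimately show ?thesis using x by (intro exI[of _ b]) (auto simp: disjnt_iff bball_def)
  qed
  with A show ?R by blast
next
  assume R: ?R
  have "\<exists>r>0. disjnt A (mball_of X x r)" if x: "x \<in> M - A" for x
  proof -
    obtain b where b: "x \<in> bball b" "bball b \<inter> A = {}" using R x by blast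
    obtain e where e: "e > 0" "\<forall>y\<in>M. d x y < e \<longrightarrow> y \<in> bball b" using bball_open b by blast
    then show ?thesis using b by (intro exI[of _ e]) (auto simp: disjnt_iff)
  qed
  then show ?L using R
    unfolding mtopology_of_def mball_of_def by (auto simp: Metric_space.closedin_metric)
qed

lemma interior_nonempty_iff:
  "mtopology_of X interior_of A \<noteq> {} \<longleftrightarrow> (\<exists>b. bball b \<subseteq> A)" (is "?L \<longleftrightarrow> ?R")
proof
  assume ?L
  then obtain x e where x: "x \<in> M" "e > 0" "mball_of X x e \<subseteq> A"
    unfolding mtopology_of_def mball_of_def by (auto simp: Metric_space.metric_interior_of)
  obtain b where "x \<in> bball b" "\<forall>y\<in>bball b. d x y < e" using ball_at x by blast
  then have "bball b \<subseteq> mball_of X x e" using x by (auto simp: bball_def)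
  then show ?R using x by blast
next
  assume ?R
  then obtain b where b: "bball b \<subseteq> A" by blast
  have "\<alpha> (fs b) \<in> bball b" by (simp add: bball_def)
  from bball_open[OF this] obtain e where "e > 0" "mball_of X (\<alpha> (fs b)) e \<subseteq> bball b"
    by (auto simp: subset_iff)
  then have "\<alpha> (fs b) \<in> mtopology_of X interior_of A" using b
    unfolding mtopology_of_def mball_of_def by (auto simp: Metric_space.metric_interior_of)
  then show ?L by blast
qed

lemma name_exists: "x \<in> M \<Longrightarrow> \<exists>q. cauchy_rep X \<alpha> q = Some x"
proof -
  assume x: "x \<in> M"
  have "\<forall>n. \<exists>m. d (\<alpha> m) x < 1 / 2 ^ Suc n" by (intro allI dense x) simp
  then obtain q where q: "\<And>n. d (\<alpha> (q n)) x < 1 / 2 ^ Suc n" by metis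
  have "cauchy_rep X \<alpha> q = Some x"
  proof (rule cauchy_repI[OF range_\<alpha> x, of _ 1])
    show "d (\<alpha> (q n)) (\<alpha> (q k)) < 1 / 2 ^ k" if "k \<le> n" for n k
      using tri[of "\<alpha> (q n)" x "\<alpha> (q k)"] q[of n] q[of k] power_half_mono[of "Suc k" "Suc n"] that x
      by (simp add: mdist_commute[of X x])
    show "d (\<alpha> (q k)) x \<le> 1 / 2 ^ k" for k
      using less_le_trans[OF q[of k] power_half_mono[of k "Suc k"]] by simp
  qed
  then show ?thesis by blast
qed

lemma neg_rep_closed:
  assumes "closed_neg_rep X \<alpha> p = Some A"
  shows "closedin (mtopology_of X) A"
proof -
  let ?B = "\<lambda>i. case prod_decode (p i) of (n, k) \<Rightarrow> mball_of X (\<alpha> n) (rat_seq k)"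
  have "openin (mtopology_of X) (?B i)" for i
    unfolding mtopology_of_def mball_of_def
    by (auto split: prod.split intro: Metric_space.openin_mball)
  then have "openin (mtopology_of X) (\<Union>i. ?B i)" by (intro openin_Union) auto
  moreover have "A = topspace (mtopology_of X) - (\<Union>i. ?B i)"
    using assms by (simp add: closed_neg_rep_def)
  ultimately show ?thesis by blast
qed

lemma seq_neg_rep:
  "seq_rep (closed_neg_rep X \<alpha>) p =
     Some (\<lambda>i. {x \<in> M. \<forall>l. \<not> d (\<alpha> (fs (p (pr i l)))) x < rat_seq (sn (p (pr i l)))})"
  unfolding seq_rep_def
  by (auto simp: closed_neg_rep_def dom_def fun_eq_iff split_beta)

end

lemma infty_metric_simps [simp]:
  "mspace (infty_metric X) = insert None (Some ` mspace X)" "mdist (infty_metric X) = infty_dist X"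
  using Metric_space.mspace_metric[OF Metric_space_infty_dist]
    Metric_space.mdist_metric[OF Metric_space_infty_dist]
  by (auto simp: infty_metric_def)

context separable_complete
begin

lemma range_infty_seq: "range (infty_seq \<alpha>) \<subseteq> mspace (infty_metric X)"
  by (auto simp: infty_seq_def split: nat.splits)

text \<open>
  The point at infinity has distance \<open>1\<close> from \<open>X\<close>, and a name moves by less than that from its first
  entry on. So all entries of a name are codes of \<open>\<infinity>\<close>, or none is.
\<close>

lemma infty_name_cases:
  assumes "cauchy_rep (infty_metric X) (infty_seq \<alpha>) q = Some u"
  obtains "u = None" "\<And>n. q n = 0"
  | x where "u = Some x" "x \<in> M" "\<And>n. q n \<noteq> 0" "\<And>k n. k \<le> n \<Longrightarrow> d (\<alpha> (q n - 1)) (\<alpha> (q k - 1)) < 1 / 2 ^ k"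
    "\<And>k. d (\<alpha> (q k - 1)) x \<le> 1 / 2 ^ k"
proof -
  note D = cauchy_repD[OF assms range_infty_seq, simplified]
  have one: "1 / 2 ^ k \<le> (1::real)" for k by simp
  have 0: "q n = 0 \<longleftrightarrow> q 0 = 0" for n
    using D(2)[of 0 n] by (auto simp: infty_seq_def infty_dist_def split: nat.splits)
  show thesis
  proof (cases "q 0 = 0")
    case True
    then have q: "q n = 0" for n using 0 by blast
    have "u = None"
    proof (cases u)
      case (Some x)
      then show ?thesis using D(3)[of 1] by (simp add: q infty_seq_def infty_dist_def)
    qed
    then show thesis using that(1) q by blast
  next
    case False
    then have q: "q n \<noteq> 0" for n using 0[of n] by simp
    have s: "infty_seq \<alpha> (q n) = Some (\<alpha> (q n - 1))" for n
      using q[of n] by (auto simp: infty_seq_def split: nat.splits)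
    show thesis
    proof (cases u)
      case None
      then show thesis using D(3)[of 1] by (simp add: s infty_dist_def)
    next
      case (Some x)
      show thesis
      proof (rule that(2)[OF Some])
        show "x \<in> M" using D(1) Some by auto
        show "q n \<noteq> 0" for n by (rule q)
        show "d (\<alpha> (q n - 1)) (\<alpha> (q k - 1)) < 1 / 2 ^ k" if "k \<le> n" for k n
          using D(2)[OF that] one[of k] by (simp add: s infty_dist_def min_less_iff_disj)
        show "d (\<alpha> (q k - 1)) x \<le> 1 / 2 ^ k" for k
          using D(3)[of k] one[of k] by (simp add: s infty_dist_def Some min_le_iff_disj)
      qed
    qed
  qed
qed

lemma infty_name_None: "cauchy_rep (infty_metric X) (infty_seq \<alpha>) (\<lambda>n. 0) = Some None"
  by (rule cauchy_repI[OF range_infty_seq, of _ _ 1]) (auto simp: infty_seq_def infty_dist_def)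

lemma infty_name_Some:
  assumes "cauchy_rep X \<alpha> q = Some x"
  shows "cauchy_rep (infty_metric X) (infty_seq \<alpha>) (\<lambda>n. Suc (q n)) = Some (Some x)"
proof -
  note D = cauchy_repD[OF assms range_\<alpha>]
  show ?thesis
    by (rule cauchy_repI[OF range_infty_seq, of _ _ 1])
      (use D in \<open>auto simp: infty_seq_def infty_dist_def min_less_iff_disj min_le_iff_disj\<close>)
qed

lemma closure_infty:
  "{a \<in> M. Some a \<in> mtopology_of (infty_metric X) closure_of S} =
   {a \<in> M. \<forall>b. a \<in> bball b \<longrightarrow> (\<exists>x\<in>bball b. Some x \<in> S)}" (is "?L = ?R")
proof (intro equalityI subsetI)
  have clos: "Some a \<in> mtopology_of (infty_metric X) closure_of S \<longleftrightarrow>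
     (\<forall>r>0. \<exists>y\<in>S. y \<in> insert None (Some ` M) \<and> infty_dist X (Some a) y < r)" if "a \<in> M" for a
    using that unfolding mtopology_of_def infty_metric_simps
      Metric_space.metric_closure_of[OF Metric_space_infty_dist]
    by (auto simp: Metric_space.in_mball[OF Metric_space_infty_dist])
  { fix a assume a: "a \<in> ?L"
    have "\<exists>x\<in>bball b. Some x \<in> S" if b: "a \<in> bball b" for b
    proof -
      obtain e where e: "e > 0" "\<forall>y\<in>M. d a y < e \<longrightarrow> y \<in> bball b" using bball_open b by blast
      obtain y where "y \<in> S" "y \<in> insert None (Some ` M)" "infty_dist X (Some a) y < min e 1"
        using clos[of a] a e by (auto dest!: spec[of _ "min e 1"])
      then show ?thesis using e by (auto simp: infty_dist_def min_def split: option.splits if_splits)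
    qed
    then show "a \<in> ?R" using a by blast }
  { fix a assume a: "a \<in> ?R"
    have "\<exists>y\<in>S. y \<in> insert None (Some ` M) \<and> infty_dist X (Some a) y < r" if r: "r > 0" for r
    proof -
      obtain b where b: "a \<in> bball b" "\<forall>y\<in>bball b. d a y < r" using ball_at[of a r] r a by blast
      then obtain x where "x \<in> bball b" "Some x \<in> S" using a by blast
      then show ?thesis using b by (intro bexI[of _ "Some x"]) (auto simp: infty_dist_def bball_def)
    qed
    then show "a \<in> ?L" using clos[of a] a by auto }
qed

lemma seq_pos_repD:
  assumes "seq_rep (closed_pos_rep X \<alpha>) p = Some A"
  obtains u where "\<And>i k. cauchy_rep (infty_metric X) (infty_seq \<alpha>) (\<lambda>j. p (pr i (pr k j))) = Some (u i k)"
    and "\<And>i. A i = {a \<in> M. \<forall>b. a \<in> bball b \<longrightarrow> (\<exists>x\<in>bball b. \<exists>k. u i k = Some x)}"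
proof -
  let ?c = "cauchy_rep (infty_metric X) (infty_seq \<alpha>)"
  let ?q = "\<lambda>i k j. p (pr i (pr k j))"
  have "\<forall>i. (\<lambda>j. p (pr i j)) \<in> dom (closed_pos_rep X \<alpha>)"
    using assms unfolding seq_rep_def by (auto split: if_splits)
  then have v: "\<exists>v. seq_rep ?c (\<lambda>j. p (pr i j)) = Some v" for i
    by (auto simp: closed_pos_rep_def dom_def)
  have *: "\<exists>y. ?c (?q i k) = Some y" for i k
    using v[of i] unfolding seq_rep_def dom_def by (auto split: if_splits)
  have u: "?c (?q i k) = Some (the (?c (?q i k)))" for i k using *[of i k] by auto
  have "A i = {a \<in> M. Some a \<in> mtopology_of (infty_metric X) closure_of range (\<lambda>k. the (?c (?q i k)))}" for i
    using assms * unfolding seq_rep_def closed_pos_rep_def by (auto split: if_splits)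
  then have "A i = {a \<in> M. \<forall>b. a \<in> bball b \<longrightarrow> (\<exists>x\<in>bball b. \<exists>k. the (?c (?q i k)) = Some x)}" for i
    unfolding closure_infty by (simp add: image_iff eq_commute)
  from that[OF u this] show thesis .
qed

lemma seq_pos_repI:
  assumes u: "\<And>i k. cauchy_rep (infty_metric X) (infty_seq \<alpha>) (\<lambda>j. p (pr i (pr k j))) = Some (u i k)"
    and A: "\<And>i. A i = {a \<in> M. \<forall>b. a \<in> bball b \<longrightarrow> (\<exists>x\<in>bball b. \<exists>k. u i k = Some x)}"
  shows "seq_rep (closed_pos_rep X \<alpha>) p = Some A"
proof -
  define c where "c = cauchy_rep (infty_metric X) (infty_seq \<alpha>)"
  define q where "q i k = (\<lambda>j. p (pr i (pr k j)))" for i k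
  have c: "c (q i k) = Some (u i k)" for i k
    unfolding c_def q_def by (rule u)
  have "seq_rep c (\<lambda>j. p (pr i j)) = Some (u i)" for i
  proof -
    have "seq_rep c (\<lambda>j. p (pr i j)) =
        (if \<forall>k. q i k \<in> dom c then Some (\<lambda>k. the (c (q i k))) else None)"
      unfolding q_def seq_rep_def ..
    then show ?thesis by (simp add: c dom_def)
  qed
  moreover have "A i = {a \<in> M. \<forall>b. a \<in> bball b \<longrightarrow> (\<exists>x\<in>bball b. Some x \<in> range (u i))}" for i
    unfolding A by (simp add: image_iff eq_commute)
  ultimately have "closed_pos_rep X \<alpha> (\<lambda>j. p (pr i j)) = Some (A i)" for i
    unfolding closed_pos_rep_def closure_infty c_def by simp
  then show ?thesis unfolding seq_rep_def by (simp add: dom_def)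
qed

lemma closedin_of_closure:
  "closedin (mtopology_of X) {a \<in> M. \<forall>b. a \<in> bball b \<longrightarrow> (\<exists>x\<in>bball b. P x)}"
  unfolding closedin_iff by blast

end

section \<open>Baire category problems in terms of cylinders\<close>

definition agree :: "nat \<Rightarrow> baire \<Rightarrow> baire \<Rightarrow> bool" where
  "agree n x y \<longleftrightarrow> (\<forall>k<n. x k = y k)"

lemma agree_refl [simp]: "agree n x x" by (simp add: agree_def)
lemma agree_sym: "agree n x y \<Longrightarrow> agree n y x" by (simp add: agree_def)
lemma agree_trans: "agree n x y \<Longrightarrow> agree n y z \<Longrightarrow> agree n x z" by (simp add: agree_def)
lemma agree_mono: "agree n x y \<Longrightarrow> m \<le> n \<Longrightarrow> agree m x y" by (simp add: agree_def)

definition fat :: "baire set \<Rightarrow> bool" where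
  "fat A \<longleftrightarrow> (\<exists>x n. \<forall>y. agree n x y \<longrightarrow> y \<in> A)"

definition cyl_closed :: "baire set \<Rightarrow> bool" where
  "cyl_closed A \<longleftrightarrow> (\<forall>x. x \<notin> A \<longrightarrow> (\<exists>n. \<forall>y. agree n x y \<longrightarrow> y \<notin> A))"

text \<open>
  A negative name marks cylinders \<open>\<langle>w, n\<rangle>\<close> of the complement. The component \<open>l\<close> is a witness that may
  have to be searched for, so being marked is only a semidecidable property of \<open>\<langle>w, n\<rangle>\<close>.
\<close>

definition neg_set :: "baire \<Rightarrow> nat \<Rightarrow> baire set" where
  "neg_set p i = {x. \<forall>w n l. agree n (baire_seq w) x \<longrightarrow> p (pr i (pr w (pr n l))) = 0}"

text \<open>
  Each block \<open>k\<close> of a positive name may hold a point; entry \<open>0\<close> of the block tells whether it does. This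
  takes the role of the point at infinity.
\<close>

definition pos_set :: "baire \<Rightarrow> nat \<Rightarrow> baire set" where
  "pos_set p i = {x. \<forall>n. \<exists>k. p (pr i (pr k 0)) \<noteq> 0 \<and> agree n (\<lambda>j. p (pr i (pr k (Suc j)))) x}"

definition off_point :: "(nat \<Rightarrow> baire set) \<Rightarrow> baire set" where
  "off_point A = (if \<forall>i. \<not> fat (A i) then - (\<Union>i. A i) else {})"

definition fat_index :: "(nat \<Rightarrow> baire set) \<Rightarrow> nat set" where
  "fat_index A = (if (\<Union>i. A i) = UNIV then {i. fat (A i)} else {})"

text \<open>
  The middle terms of the equivalences. They are the problems on Baire space up to the choice of names,
  which refer neither to rational balls nor to fast Cauchy sequences.
\<close>

definition cyl_BCT0 :: "(nat \<Rightarrow> baire set, baire) problem" where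
  "cyl_BCT0 = \<lparr>in_rep = (\<lambda>p. Some (neg_set p)), out_rep = Some, mv = off_point\<rparr>"

definition cyl_BCT1 :: "(nat \<Rightarrow> baire set, nat) problem" where
  "cyl_BCT1 = \<lparr>in_rep = (\<lambda>p. Some (neg_set p)), out_rep = nat_rep, mv = fat_index\<rparr>"

definition cyl_BCT2 :: "(nat \<Rightarrow> baire set, baire) problem" where
  "cyl_BCT2 = \<lparr>in_rep = (\<lambda>p. Some (pos_set p)), out_rep = Some, mv = off_point\<rparr>"

definition cyl_BCT3 :: "(nat \<Rightarrow> baire set, nat) problem" where
  "cyl_BCT3 = \<lparr>in_rep = (\<lambda>p. Some (pos_set p)), out_rep = nat_rep, mv = fat_index\<rparr>"

lemma cyl_closed_neg_set: "cyl_closed (neg_set p i)"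
proof -
  have "\<exists>n. \<forall>y. agree n x y \<longrightarrow> y \<notin> neg_set p i" if x: "x \<notin> neg_set p i" for x
  proof -
    obtain w n l where "agree n (baire_seq w) x" "p (pr i (pr w (pr n l))) \<noteq> 0"
      using x by (auto simp: neg_set_def)
    then have "\<forall>y. agree n x y \<longrightarrow> y \<notin> neg_set p i"
      unfolding neg_set_def using agree_trans by fastforce
    then show ?thesis by blast
  qed
  then show ?thesis by (simp add: cyl_closed_def)
qed

lemma cyl_closed_pos_set: "cyl_closed (pos_set p i)"
proof -
  have "\<exists>n. \<forall>y. agree n x y \<longrightarrow> y \<notin> pos_set p i" if x: "x \<notin> pos_set p i" for x
  proof -
    obtain n where n: "\<And>k. p (pr i (pr k 0)) \<noteq> 0 \<Longrightarrow> \<not> agree n (\<lambda>j. p (pr i (pr k (Suc j)))) x"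
      using x unfolding pos_set_def by blast
    have "y \<notin> pos_set p i" if "agree n x y" for y
    proof
      assume "y \<in> pos_set p i"
      then obtain k where "p (pr i (pr k 0)) \<noteq> 0" "agree n (\<lambda>j. p (pr i (pr k (Suc j)))) y"
        unfolding pos_set_def by blast
      then show False using n agree_trans agree_sym \<open>agree n x y\<close> by blast
    qed
    then show ?thesis by blast
  qed
  then show ?thesis by (simp add: cyl_closed_def)
qed

section \<open>Codes of words and of rational balls\<close>

definition tailc :: "nat \<Rightarrow> nat" where "tailc w = (if w = 0 then 0 else sn (w - 1))"

lemma baire_seq_rec: "baire_seq w 0 = (if w = 0 then 0 else fs (w - 1))"
  "baire_seq w (Suc k) = baire_seq (tailc w) k"
  by (cases w; simp add: baire_seq_def tailc_def split_beta)+

text \<open>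
  The iteration of a function on codes shows that \<open>baire_seq\<close> is computable. Code \<open>0\<close> is the empty
  list and is mapped to itself, which yields the padding by zeros.
\<close>

lemma baire_seq_iter:
  "baire_seq w k = (let v = rec_nat w (\<lambda>i r. tailc r) k in if v = 0 then 0 else fs (v - 1))"
proof (induction k arbitrary: w)
  case 0
  then show ?case by (simp add: baire_seq_rec)
next
  case (Suc k)
  have "rec_nat (tailc w) (\<lambda>i r. tailc r) k = tailc (rec_nat w (\<lambda>i r. tailc r) k)"
    by (induction k) auto
  then show ?case by (simp add: Suc baire_seq_rec)
qed

lemma orec_tailc: "orec D a \<Longrightarrow> orec D (\<lambda>p n. tailc (a p n))"
  unfolding tailc_def by (intro orec_intros)

lemma orec_baire_seq: "orec D a \<Longrightarrow> orec D b \<Longrightarrow> orec D (\<lambda>p n. baire_seq (a p n) (b p n))"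
  unfolding baire_seq_iter Let_def by (intro orec_tailc orec_intros)

lemma word_exists: "\<exists>w. agree n (baire_seq w) x"
  by (rule exI[of _ "list_encode (map x [0..<n])"]) (simp add: agree_def baire_seq_def)

definition half_pow :: "nat \<Rightarrow> nat" where "half_pow e = pr (pr 1 0) (2 ^ e - 1)"

lemma rat_seq_pr: "rat_seq (pr (pr a b) k) = (real a - real b) / (real k + 1)"
  by (simp add: rat_seq_def)

lemma rat_seq_half_pow [simp]: "rat_seq (half_pow e) = 1 / 2 ^ e"
  by (simp add: half_pow_def rat_seq_pr of_nat_diff)

lemma rat_seq_0 [simp]: "rat_seq 0 = 0"
proof -
  have "pr (pr 0 0) 0 = 0" by (simp add: prod_encode_def)
  then show ?thesis using rat_seq_pr[of 0 0 0] by simp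
qed

lemma orec_half_pow: "orec D a \<Longrightarrow> orec D (\<lambda>p n. half_pow (a p n))"
  unfolding half_pow_def by (intro orec_intros)

section \<open>Approximate distances and formal inclusion of balls\<close>

text \<open>
  The computability of the distance is used only through \<open>dn m k t\<close>, an approximation of
  \<open>2 ^ t\<close> times the distance of \<open>\<alpha> m\<close> and \<open>\<alpha> k\<close> with an error below \<open>2\<close>. All tests then compare
  natural numbers.
\<close>

locale approximated_polish = separable_complete X \<alpha> for X :: "'a metric" and \<alpha> +
  fixes dn :: "nat \<Rightarrow> nat \<Rightarrow> nat \<Rightarrow> nat"
  assumes orec_dn_raw: "orec UNIV (\<lambda>p n. dn (fs n) (fs (sn n)) (sn (sn n)))"
    and dn: "\<bar>mdist X (\<alpha> m) (\<alpha> k) * 2 ^ t - dn m k t\<bar> < 2"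

text \<open>
  The rational \<open>r\<close> contributes an error of \<open>1 / 4\<close> after scaling, and rounding down less than \<open>1\<close>; if
  \<open>r\<close> is negative, rounding to \<open>0\<close> only brings it closer to \<open>x\<close>.
\<close>

lemma real_floor_approx:
  fixes r x :: real
  assumes x: "0 \<le> x" and r: "\<bar>r - x\<bar> \<le> 1 / 2 ^ (t + 2)"
    and z: "z = (LEAST z. r * 2 ^ t < real z + 1)"
  shows "\<bar>x * 2 ^ t - real z\<bar> < 2"
proof -
  have ex: "\<exists>z. r * 2 ^ t < real z + 1"
    using reals_Archimedean2[of "r * 2 ^ t"] by (metis add.commute add_strict_increasing zero_le_one less_eq_real_def less_add_one less_trans)
  have up: "r * 2 ^ t < real z + 1" unfolding z using LeastI_ex[OF ex] .
  have "\<bar>r - x\<bar> * 2 ^ t \<le> 1 / 2 ^ (t + 2) * 2 ^ t" using r by (intro mult_right_mono) auto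
  then have "\<bar>r * 2 ^ t - x * 2 ^ t\<bar> \<le> 1 / 4"
    by (simp add: abs_mult left_diff_distrib[symmetric])
  moreover have "z = 0 \<or> real z \<le> r * 2 ^ t"
  proof (cases z)
    case (Suc y)
    then have "\<not> r * 2 ^ t < real y + 1" using not_less_Least[of y "\<lambda>z. r * 2 ^ t < real z + 1"] z by simp
    then show ?thesis using Suc by simp
  qed simp
  moreover have "0 \<le> x * 2 ^ t" using x by simp
  ultimately show ?thesis using up unfolding abs_less_iff abs_le_iff by auto
qed

lemma computable_Polish_dn:
  assumes "computable_Polish X \<alpha>"
  shows "\<exists>dn. approximated_polish X \<alpha> dn"
proof -
  have sep: "separable_complete X \<alpha>"
    using assms unfolding computable_Polish_def separable_complete_def by blast
  obtain F where F: "computable F"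
    and re: "realizes F \<lparr>in_rep = prod_rep nat_rep nat_rep, out_rep = real_rep,
                          mv = (\<lambda>x. {(\<lambda>(i, j). mdist X (\<alpha> i) (\<alpha> j)) x})\<rparr>"
    using assms unfolding computable_Polish_def computable_map_def by blast
  \<comment> \<open>The sequence \<open>ora i j\<close> names the pair of \<open>i\<close> and \<open>j\<close>: only its entries \<open>0\<close> and \<open>1\<close> are looked at.\<close>
  define ora where "ora i j k = (if k = 0 then i else j)" for i j k :: nat
  have "prod_rep nat_rep nat_rep (ora i j) = Some (i, j)" for i j
    by (simp add: prod_rep_def nat_rep_def ora_def)
  then have "\<exists>q. F (ora i j) = Some q \<and> real_rep q = Some (mdist X (\<alpha> i) (\<alpha> j))" for i j
    using re unfolding realizes_def by fastforce
  then obtain q where q: "\<And>i j. F (ora i j) = Some (q i j)"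
    and rq: "\<And>i j. real_rep (q i j) = Some (mdist X (\<alpha> i) (\<alpha> j))" by metis
  obtain c where c: "\<And>p r n. F p = Some r \<Longrightarrow> run c p n = Some (r n)"
    using F unfolding computable_def by blast
  have cmpc: "orec (dom F) (\<lambda>p n. the (F p) n)"
    by (rule orecI[of _ c]) (auto simp: c)
  have "orec UNIV (\<lambda>p n. the (F (ora (fs n) (fs (sn n)))) (sn (sn n)))"
    by (rule orec_app_on[OF cmpc, where g = "\<lambda>p n. ora (fs n) (fs (sn n))"])
      (auto simp: q ora_def intro!: orec_intros)
  then have cmpq': "orec UNIV (\<lambda>p n. q (fs n) (fs (sn n)) (sn (sn n)))" by (simp add: q)
  have cmpq: "orec UNIV (\<lambda>p n. q (a p n) (b p n) (e p n))"
    if "orec UNIV a" "orec UNIV b" "orec UNIV e" for a b e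
    by (rule orec_comp3[where g = "\<lambda>p. q", OF cmpq']) (use that in auto)
  define num where "num i j t = fs (fs (q i j (t + 2))) * 2 ^ t" for i j t
  define den where "den i j t = Suc (sn (q i j (t + 2)))" for i j t
  define offset where "offset i j t = sn (fs (q i j (t + 2))) * 2 ^ t" for i j t
  define dn where "dn i j t = (LEAST z. num i j t < (z + 1) * den i j t + offset i j t)" for i j t
  have iff: "num i j t < (z + 1) * den i j t + offset i j t \<longleftrightarrow>
      rat_seq (q i j (t + 2)) * 2 ^ t < real z + 1" for i j t z
  proof -
    let ?r = "q i j (t + 2)"
    have "num i j t < (z + 1) * den i j t + offset i j t \<longleftrightarrow>
        real (num i j t) < real ((z + 1) * den i j t + offset i j t)" by (simp only: of_nat_less_iff)
    also have "\<dots> \<longleftrightarrow> (real (fs (fs ?r)) - real (sn (fs ?r))) * 2 ^ t < (real z + 1) * (real (sn ?r) + 1)"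
      by (simp add: num_def den_def offset_def algebra_simps)
    also have "\<dots> \<longleftrightarrow> (real (fs (fs ?r)) - real (sn (fs ?r))) / (real (sn ?r) + 1) * 2 ^ t < real z + 1"
      by (simp add: field_simps)
    finally show ?thesis by (simp add: rat_seq_def split_beta)
  qed
  have "\<bar>mdist X (\<alpha> i) (\<alpha> j) * 2 ^ t - dn i j t\<bar> < 2" for i j t
  proof (rule real_floor_approx)
    show "\<bar>rat_seq (q i j (t + 2)) - mdist X (\<alpha> i) (\<alpha> j)\<bar> \<le> 1 / 2 ^ (t + 2)"
      using cauchy_repD(3)[OF rq[unfolded real_rep_def], where k = "t + 2"]
      unfolding mdist_euclidean_metric dist_real_def by simp
    show "dn i j t = (LEAST z. rat_seq (q i j (t + 2)) * 2 ^ t < real z + 1)"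
      unfolding dn_def iff ..
  qed simp
  moreover have "orec UNIV (\<lambda>p n. dn (fs n) (fs (sn n)) (sn (sn n)))"
    unfolding dn_def
  proof (rule orec_Least)
    show "\<exists>m. num (fs n) (fs (sn n)) (sn (sn n)) < (m + 1) * den (fs n) (fs (sn n)) (sn (sn n)) + offset (fs n) (fs (sn n)) (sn (sn n))" for n
      by (rule exI[of _ "num (fs n) (fs (sn n)) (sn (sn n))"]) (simp add: den_def)
  qed (unfold num_def den_def offset_def, intro cmpq orec_intros)
  ultimately have "approximated_polish X \<alpha> dn"
    by (intro approximated_polish.intro[OF sep] approximated_polish_axioms.intro)
  then show ?thesis by blast
qed

context approximated_polish
begin

lemma orec_dn: "orec D a \<Longrightarrow> orec D b \<Longrightarrow> orec D e \<Longrightarrow> orec D (\<lambda>p n. dn (a p n) (b p n) (e p n))"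
  by (rule orec_comp3[where g = "\<lambda>p. dn", OF orec_mono[OF orec_dn_raw]]) auto

lemma dn_up: "d (\<alpha> m) (\<alpha> k) < (dn m k t + 2) / 2 ^ t"
  and dn_low: "(real (dn m k t) - 2) / 2 ^ t < d (\<alpha> m) (\<alpha> k)"
  using dn[of m k t] by (auto simp: field_simps abs_less_iff)

text \<open>
  Evidence that the ball coded by \<open>z = \<langle>g, T\<rangle>\<close>, with centre \<open>\<alpha> g\<close> and radius \<open>1 / 2 ^ T\<close>, lies inside the
  rational ball \<open>b\<close>. The distance of the centres is tested at precision \<open>T\<close>; the margin \<open>3\<close> pays for the
  error \<open>2\<close> of \<open>dn\<close> and for the radius of \<open>z\<close>.
\<close>

definition ball_inside :: "nat \<Rightarrow> nat \<Rightarrow> bool" where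
  "ball_inside z b \<longleftrightarrow> (dn (fs z) (fs b) (sn z) + 3) * (sn (sn b) + 1) + sn (fs (sn b)) * 2 ^ sn z
     \<le> fs (fs (sn b)) * 2 ^ sn z"

lemma odec_ball_inside: "orec D a \<Longrightarrow> orec D b \<Longrightarrow> odec D (\<lambda>p n. ball_inside (a p n) (b p n))"
  unfolding ball_inside_def by (intro orec_intros orec_dn)

lemma ball_inside_iff: "ball_inside z b \<longleftrightarrow> (real (dn (fs z) (fs b) (sn z)) + 3) / 2 ^ sn z \<le> rat_seq (sn b)"
proof -
  have "ball_inside z b \<longleftrightarrow> real ((dn (fs z) (fs b) (sn z) + 3) * (sn (sn b) + 1) + sn (fs (sn b)) * 2 ^ sn z)
     \<le> real (fs (fs (sn b)) * 2 ^ sn z)" unfolding ball_inside_def by (simp only: of_nat_le_iff)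
  also have "\<dots> \<longleftrightarrow> (real (dn (fs z) (fs b) (sn z)) + 3) * (real (sn (sn b)) + 1)
     \<le> (real (fs (fs (sn b))) - real (sn (fs (sn b)))) * 2 ^ sn z"
    by (simp add: algebra_simps)
  also have "\<dots> \<longleftrightarrow> (real (dn (fs z) (fs b) (sn z)) + 3) / 2 ^ sn z
     \<le> (real (fs (fs (sn b))) - real (sn (fs (sn b)))) / (real (sn (sn b)) + 1)"
    by (simp add: field_simps)
  finally show ?thesis by (simp add: rat_seq_def split_beta)
qed

lemma ball_inside_sound:
  assumes "ball_inside z b" "x \<in> M" "d (\<alpha> (fs z)) x \<le> 1 / 2 ^ sn z"
  shows "d (\<alpha> (fs b)) x < rat_seq (sn b)"
proof -
  have "d (\<alpha> (fs b)) x \<le> d (\<alpha> (fs z)) (\<alpha> (fs b)) + d (\<alpha> (fs z)) x"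
    using tri[of "\<alpha> (fs b)" "\<alpha> (fs z)" x] assms by (simp add: mdist_commute)
  also have "\<dots> < (dn (fs z) (fs b) (sn z) + 2) / 2 ^ sn z + 1 / 2 ^ sn z"
    using dn_up[of "fs z" "fs b" "sn z"] assms by simp
  also have "\<dots> = (real (dn (fs z) (fs b) (sn z)) + 3) / 2 ^ sn z" by (simp add: add_divide_distrib[symmetric])
  finally show ?thesis using assms(1) by (simp add: ball_inside_iff)
qed

lemma eventually_power: "0 < e \<Longrightarrow> \<exists>T0. \<forall>T\<ge>T0. c / 2 ^ T < (e::real)"
proof -
  assume "0 < e"
  then obtain N where N: "\<bar>c\<bar> / 2 ^ N < e" using power_half_less by blast
  have "c / 2 ^ T < e" if "N \<le> T" for T
  proof -
    have "c / 2 ^ T \<le> \<bar>c\<bar> / 2 ^ T" by (simp add: divide_right_mono)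
    also have "\<dots> \<le> \<bar>c\<bar> / 2 ^ N" using that by (intro divide_left_mono) auto
    finally show ?thesis using N by simp
  qed
  then show ?thesis by blast
qed

text \<open>
  The evidence is found as soon as the margin is small compared to the distance of \<open>x\<close> from the
  boundary, for every centre that is close to \<open>x\<close>.
\<close>

lemma ball_inside_complete:
  assumes x: "x \<in> M" and b: "d (\<alpha> (fs b)) x < rat_seq (sn b)"
  shows "\<exists>T0. \<forall>T\<ge>T0. \<forall>g. d (\<alpha> g) x \<le> 1 / 2 ^ T \<longrightarrow> ball_inside (pr g T) b"
proof -
  \<comment> \<open>The margin \<open>3\<close>, the error \<open>2\<close> of \<open>dn\<close>, and \<open>1\<close> for the distance of \<open>\<alpha> g\<close> from \<open>x\<close>.\<close>
  obtain T0 where T0: "\<And>T. T \<ge> T0 \<Longrightarrow> 6 / 2 ^ T < rat_seq (sn b) - d (\<alpha> (fs b)) x"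
    using eventually_power[of "rat_seq (sn b) - d (\<alpha> (fs b)) x" 6] b by auto
  have "ball_inside (pr g T) b" if T: "T \<ge> T0" and g: "d (\<alpha> g) x \<le> 1 / 2 ^ T" for T g
  proof -
    have "(real (dn g (fs b) T) - 2) / 2 ^ T < d (\<alpha> g) (\<alpha> (fs b))" by (rule dn_low)
    also have "\<dots> \<le> 1 / 2 ^ T + d (\<alpha> (fs b)) x"
      using tri[of "\<alpha> g" x "\<alpha> (fs b)"] x g by (simp add: mdist_commute[of X x])
    finally have "(real (dn g (fs b) T) + 3) / 2 ^ T < d (\<alpha> (fs b)) x + 6 / 2 ^ T"
      by (simp add: field_simps)
    then show ?thesis using T0[OF T] by (simp add: ball_inside_iff)
  qed
  then show ?thesis by blast
qed

end

section \<open>A computable open surjection from Baire space\<close>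

context separable_complete
begin

lemma cauchy_rep_total:
  assumes c: "\<And>n k. k \<le> n \<Longrightarrow> d (\<alpha> (q n)) (\<alpha> (q k)) < 1 / 2 ^ k"
  shows "\<exists>x. cauchy_rep X \<alpha> q = Some x"
proof -
  have "Metric_space.MCauchy M d (\<lambda>n. \<alpha> (q n))"
    unfolding Metric_space.MCauchy_def[OF Metric_space_mspace_mdist]
  proof (intro conjI allI impI)
    fix e :: real assume "0 < e"
    then obtain N where N: "2 / 2 ^ N < e" using power_half_less by blast
    have "d (\<alpha> (q n)) (\<alpha> (q n')) < e" if "N \<le> n" "N \<le> n'" for n n'
      using tri[of "\<alpha> (q n)" "\<alpha> (q N)" "\<alpha> (q n')"] c[OF that(1)] c[OF that(2)] N
      by (simp add: mdist_commute[of X "\<alpha> (q N)"])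
    then show "\<exists>N. \<forall>n n'. N \<le> n \<longrightarrow> N \<le> n' \<longrightarrow> d (\<alpha> (q n)) (\<alpha> (q n')) < e" by blast
  qed auto
  then have "\<exists>x. limitin (mtopology_of X) (\<lambda>n. \<alpha> (q n)) x sequentially"
    using complete unfolding mcomplete_of_def mtopology_of_def
      Metric_space.mcomplete_def[OF Metric_space_mspace_mdist] by blast
  then show ?thesis using c unfolding cauchy_rep_def by auto
qed

lemma name_limit_le:
  assumes q: "cauchy_rep X \<alpha> q = Some x" and y: "y \<in> M" and r: "\<And>n. n \<ge> k \<Longrightarrow> d y (\<alpha> (q n)) \<le> r"
  shows "d y x \<le> r"
proof (rule field_le_epsilon)
  fix e :: real assume "0 < e"
  then obtain n where n: "1 / 2 ^ n < e" using power_half_less by blast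
  note D = cauchy_repD[OF q range_\<alpha>]
  have "d y x \<le> d y (\<alpha> (q (max n k))) + d (\<alpha> (q (max n k))) x" using tri y D(1) by simp
  moreover have "d (\<alpha> (q (max n k))) x \<le> 1 / 2 ^ n"
    using D(3)[of "max n k"] power_half_mono[of n "max n k"] by simp
  ultimately show "d y x \<le> r + e" using r[of "max n k"] n by simp
qed

definition bcball :: "nat \<Rightarrow> 'a set" where
  "bcball b = {x \<in> M. d (\<alpha> (fs b)) x \<le> 1 / 2 ^ sn b}"

lemma bball_subset_bcball: "bball b \<subseteq> bcball b" by (auto simp: bball_def bcball_def)

lemma \<alpha>_in_bball: "\<alpha> (fs b) \<in> bball b" by (simp add: bball_def)

end

context approximated_polish
begin

definition well_inside :: "nat \<Rightarrow> nat \<Rightarrow> bool" where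
  "well_inside z s \<longleftrightarrow> ball_inside z (pr (fs s) (half_pow (sn s)))"

lemma well_inside_iff: "well_inside z s \<longleftrightarrow> (real (dn (fs z) (fs s) (sn z)) + 3) / 2 ^ sn z \<le> 1 / 2 ^ sn s"
  by (simp add: well_inside_def ball_inside_iff)

lemma well_inside_sound: "well_inside z s \<Longrightarrow> bcball z \<subseteq> bball s"
  using ball_inside_sound[of z "pr (fs s) (half_pow (sn s))"] by (auto simp: well_inside_def bcball_def bball_def)

lemma well_inside_less: "well_inside z s \<Longrightarrow> sn s < sn z"
proof -
  assume "well_inside z s"
  have "3 / (2::real) ^ sn z \<le> (real (dn (fs z) (fs s) (sn z)) + 3) / 2 ^ sn z"
    by (intro divide_right_mono) auto
  with \<open>well_inside z s\<close> have "3 / (2::real) ^ sn z \<le> 1 / 2 ^ sn s" unfolding well_inside_iff by linarith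
  then have "3 * (2::real) ^ sn s \<le> 2 ^ sn z" by (simp add: field_simps)
  moreover have "0 < (2::real) ^ sn s" by simp
  ultimately have "(2::real) ^ sn s < 2 ^ sn z" by linarith
  then show ?thesis by simp
qed

lemma well_inside_complete:
  "x \<in> bball s \<Longrightarrow> \<exists>T0. \<forall>T\<ge>T0. \<forall>g. d (\<alpha> g) x \<le> 1 / 2 ^ T \<longrightarrow> well_inside (pr g T) s"
  using ball_inside_complete[of x "pr (fs s) (half_pow (sn s))"] by (simp add: well_inside_def bball_def)

lemma odec_well_inside: "orec D a \<Longrightarrow> orec D b \<Longrightarrow> odec D (\<lambda>p n. well_inside (a p n) (b p n))"
  unfolding well_inside_def by (intro odec_ball_inside orec_half_pow orec_intros)

text \<open>
  Entries of a Cauchy name that are four apart give formally nested balls: their centres have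
  distance at most half of the larger radius, and the radius shrinks by the factor \<open>16\<close>. So
  nested balls around a named point are found without search.
\<close>

lemma well_inside_chain:
  assumes "\<And>n k. k \<le> n \<Longrightarrow> d (\<alpha> (q n)) (\<alpha> (q k)) < 1 / 2 ^ k"
  shows "well_inside (pr (q (T + 5)) (T + 4)) (pr (q (T + 1)) T)"
proof -
  have "(real (dn (q (T + 5)) (q (T + 1)) (T + 4)) - 2) / 2 ^ (T + 4) < 1 / 2 ^ (T + 1)"
    using dn_low[of "q (T + 5)" "q (T + 1)" "T + 4"] assms[of "T + 1" "T + 5"] by simp
  then show ?thesis by (simp add: well_inside_iff field_simps power_add)
qed

text \<open>
  A digit that does not code a ball well inside \<open>s\<close> stands for the concentric ball of half the
  radius. So every sequence of digits is meaningful.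
\<close>

definition refine :: "nat \<Rightarrow> nat \<Rightarrow> nat" where
  "refine s z = (if well_inside z s then z else pr (fs s) (Suc (sn s)))"

primrec state :: "baire \<Rightarrow> nat \<Rightarrow> nat" where
  "state p 0 = pr (p 0) 0"
| "state p (Suc n) = refine (state p n) (p (Suc n))"

lemma orec_state:
  assumes "orec D (\<lambda>p n. g p (fs n) (sn n))" "orec D h"
  shows "orec D (\<lambda>p n. state (g p n) (h p n))"
proof -
  have "state p n = rec_nat (pr (p 0) 0) (\<lambda>i s. refine s (p (Suc i))) n" for p n
    by (induction n) auto
  moreover have "orec UNIV (\<lambda>p n. rec_nat (pr (p 0) 0) (\<lambda>i s. refine s (p (Suc i))) n)"
    unfolding refine_def by (intro orec_intros odec_well_inside)
  ultimately have "orec UNIV state" by (simp add: orec_def)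
  from orec_app[OF this assms] show ?thesis by simp
qed

lemma bcball_refine: "bcball (refine s z) \<subseteq> bball s"
proof (cases "well_inside z s")
  case False
  have "x \<in> bball s" if "x \<in> bcball (pr (fs s) (Suc (sn s)))" for x
  proof -
    have "(1::real) / 2 ^ Suc (sn s) < 1 / 2 ^ sn s" by (simp add: field_simps)
    then show ?thesis using that unfolding bcball_def bball_def by simp
  qed
  then show ?thesis using False by (auto simp: refine_def)
qed (simp add: refine_def well_inside_sound)

lemma le_sn_state: "n \<le> sn (state p n)"
proof (induction n)
  case (Suc n)
  then show ?case using well_inside_less[of "p (Suc n)" "state p n"] by (auto simp: refine_def)
qed simp

lemma bball_state_mono: "k \<le> n \<Longrightarrow> bball (state p n) \<subseteq> bball (state p k)"
proof (induction n)
  case (Suc n)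
  have "bball (state p (Suc n)) \<subseteq> bball (state p n)" using bball_subset_bcball bcball_refine by simp blast
  then show ?case using Suc le_Suc_eq by blast
qed simp

lemma state_agree: "agree (Suc n) x y \<Longrightarrow> state x n = state y n"
  by (induction n) (auto simp: agree_def)

definition proj :: "baire \<Rightarrow> 'a" where
  "proj p = (SOME x. cauchy_rep X \<alpha> (\<lambda>k. fs (state p k)) = Some x)"

lemma state_center: "k \<le> n \<Longrightarrow> d (\<alpha> (fs (state p k))) (\<alpha> (fs (state p n))) < 1 / 2 ^ sn (state p k)"
  using subsetD[OF bball_state_mono \<alpha>_in_bball, of k n p] by (simp add: bball_def)

lemma proj_name: "cauchy_rep X \<alpha> (\<lambda>k. fs (state p k)) = Some (proj p)"
  unfolding proj_def
proof (rule someI_ex[OF cauchy_rep_total])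
  fix n k :: nat assume "k \<le> n"
  then show "d (\<alpha> (fs (state p n))) (\<alpha> (fs (state p k))) < 1 / 2 ^ k"
    using state_center[of k n p] power_half_mono[OF le_sn_state[of k p]]
    by (simp add: mdist_commute)
qed

lemma proj_in_M: "proj p \<in> M" using cauchy_repD(1)[OF proj_name range_\<alpha>] .

lemma proj_in_bball: "proj p \<in> bball (state p n)"
proof -
  have "d (\<alpha> (fs (state p (Suc n)))) (proj p) \<le> 1 / 2 ^ sn (state p (Suc n))"
    by (rule name_limit_le[OF proj_name, where k = "Suc n"]) (auto intro!: less_imp_le state_center simp del: state.simps)
  then have "proj p \<in> bcball (state p (Suc n))" by (simp add: bcball_def proj_in_M)
  then show ?thesis using bcball_refine by auto
qed

lemma state_small:
  assumes x: "x \<in> bball (state p n)" and y: "y \<in> bball (state p n)"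
  shows "d x y < 2 / 2 ^ n"
proof -
  have "d x y \<le> d (\<alpha> (fs (state p n))) x + d (\<alpha> (fs (state p n))) y"
    using tri[of x "\<alpha> (fs (state p n))" y] x y by (simp add: bball_def mdist_commute)
  also have "\<dots> < 1 / 2 ^ sn (state p n) + 1 / 2 ^ sn (state p n)" using x y by (simp add: bball_def)
  also have "\<dots> \<le> 1 / 2 ^ n + 1 / 2 ^ n"
    using power_half_mono[OF le_sn_state[of n p]] by (intro add_mono)
  finally show ?thesis by simp
qed

lemma proj_unique:
  assumes "\<And>n. n \<ge> k \<Longrightarrow> x \<in> bball (state p n)"
  shows "proj p = x"
proof (rule ccontr)
  assume ne: "proj p \<noteq> x"
  have x: "x \<in> M" using assms[of k] by (simp add: bball_def)
  then have "0 < d (proj p) x" using ne mdist_zero[OF proj_in_M x, of p] mdist_nonneg[of X "proj p" x] by (simp add: less_le)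
  then obtain n where "2 / 2 ^ n < d (proj p) x" using power_half_less by blast
  moreover have "(2::real) / 2 ^ max n k \<le> 2 / 2 ^ n" by (intro divide_left_mono) auto
  moreover have "d (proj p) x < 2 / 2 ^ max n k" by (rule state_small[OF proj_in_bball assms]) simp
  ultimately show False by simp
qed

lemma proj_neighbourhood:
  assumes "proj p \<in> bball b"
  shows "\<exists>n. bball (state p n) \<subseteq> bball b"
proof -
  obtain e where e: "e > 0" "\<forall>y\<in>M. d (proj p) y < e \<longrightarrow> y \<in> bball b" using bball_open[OF assms] by blast
  obtain n where n: "2 / 2 ^ n < e" using power_half_less e by blast
  have "bball (state p n) \<subseteq> bball b"
  proof
    fix y assume y: "y \<in> bball (state p n)"
    then have "y \<in> M" by (simp add: bball_def)
    then show "y \<in> bball b" using state_small[OF proj_in_bball y] n e by auto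
  qed
  then show ?thesis by blast
qed

definition glue :: "baire \<Rightarrow> nat \<Rightarrow> baire \<Rightarrow> baire" where
  "glue v n z j = (if j < n then v j else z (j - n))"

lemma agree_glue: "agree n (glue v n z) v" by (simp add: agree_def glue_def)

lemma state_glue:
  assumes "n > 0" "well_inside (z 0) (state v (n - 1))" "\<And>i. well_inside (z (Suc i)) (z i)"
  shows "state (glue v n z) (n + i) = z i"
proof (induction i)
  case 0
  obtain m where m: "n = Suc m" using assms(1) by (cases n) auto
  have "state (glue v n z) m = state v m" using state_agree agree_glue m by simp
  then show ?case using assms(2) by (simp add: m refine_def glue_def[of v "Suc m" z "Suc m"])
next
  case (Suc i)
  then show ?case using assms(3)[of i] by (simp add: refine_def glue_def[of v n z "Suc (n + i)"] Suc_diff_le)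
qed

text \<open>
  Any admissible beginning \<open>v\<close> can be continued by the balls that a Cauchy name provides.
\<close>

lemma proj_glue:
  assumes n: "n > 0" and c: "\<And>n k. k \<le> n \<Longrightarrow> d (\<alpha> (q n)) (\<alpha> (q k)) < 1 / 2 ^ k"
    and x: "x \<in> M" "\<And>k. d (\<alpha> (q k)) x \<le> 1 / 2 ^ k"
    and T: "well_inside (pr (q (T + 1)) T) (state v (n - 1))"
  shows "proj (glue v n (\<lambda>i. pr (q (T + 4 * i + 1)) (T + 4 * i))) = x"
proof (rule proj_unique[of n])
  let ?z = "\<lambda>i. pr (q (T + 4 * i + 1)) (T + 4 * i)"
  have s: "well_inside (?z (Suc i)) (?z i)" for i
    using well_inside_chain[of q "T + 4 * i", OF c] by (simp add: ac_simps)
  fix m assume "n \<le> m"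
  then have "state (glue v n ?z) m = ?z (m - n)"
    using state_glue[of n ?z v "m - n"] n T s by simp
  moreover have "x \<in> bball (?z i)" for i
  proof -
    have "(1::real) / 2 ^ Suc (T + 4 * i) < 1 / 2 ^ (T + 4 * i)" by (simp add: field_simps)
    then show ?thesis using x(1) x(2)[of "Suc (T + 4 * i)"] unfolding in_bball by simp
  qed
  ultimately show "x \<in> bball (state (glue v n ?z) m)" by simp
qed

text \<open>
  This is the openness of \<open>proj\<close>: it maps the cylinder of the first \<open>Suc n\<close> entries of \<open>v\<close> onto the ball
  \<open>state v n\<close>.
\<close>

lemma proj_open:
  assumes "x \<in> bball (state v n)"
  shows "\<exists>p. agree (Suc n) p v \<and> proj p = x"
proof -
  have x: "x \<in> M" using assms by (simp add: bball_def)
  obtain q where q: "cauchy_rep X \<alpha> q = Some x" using name_exists[OF x] by blast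
  note D = cauchy_repD[OF q range_\<alpha>]
  obtain T where T: "\<And>g. d (\<alpha> g) x \<le> 1 / 2 ^ T \<Longrightarrow> well_inside (pr g T) (state v n)"
    using well_inside_complete[OF assms] by blast
  have "well_inside (pr (q (T + 1)) T) (state v (Suc n - 1))"
    using T[of "q (T + 1)"] D(3)[of "T + 1"] power_half_mono[of T "T + 1"] by simp
  from proj_glue[OF _ D(2) x D(3) this] agree_glue[of "Suc n" v] show ?thesis by blast
qed

lemma proj_surj: "x \<in> M \<Longrightarrow> \<exists>p. proj p = x"
proof -
  assume x: "x \<in> M"
  obtain k where "d (\<alpha> k) x < 1" using dense[OF x, of 1] by auto
  then have "x \<in> bball (state (\<lambda>_. k) 0)" using x by (simp add: in_bball)
  from proj_open[OF this] show ?thesis by blast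
qed

text \<open>
  From left to right by openness, from right to left by continuity and surjectivity.
\<close>

lemma fat_vimage_proj: "fat (proj -` A) \<longleftrightarrow> (\<exists>b. bball b \<subseteq> A)"
proof
  assume "fat (proj -` A)"
  then obtain v n where v: "\<And>y. agree n v y \<Longrightarrow> proj y \<in> A" by (auto simp: fat_def)
  have "bball (state v n) \<subseteq> A"
  proof
    fix y assume "y \<in> bball (state v n)"
    from proj_open[OF this] obtain p where "agree (Suc n) p v" "proj p = y" by blast
    then show "y \<in> A" using v[of p] by (auto simp: agree_def)
  qed
  then show "\<exists>b. bball b \<subseteq> A" by blast
next
  assume "\<exists>b. bball b \<subseteq> A"
  then obtain b where b: "bball b \<subseteq> A" by blast
  obtain p where p: "proj p = \<alpha> (fs b)" using proj_surj by force
  then obtain n where n: "bball (state p n) \<subseteq> bball b" using proj_neighbourhood[of p b] \<alpha>_in_bball by auto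
  have "proj y \<in> A" if "agree (Suc n) p y" for y
    using proj_in_bball[of y n] state_agree[OF that] n b by auto
  then show "fat (proj -` A)" unfolding fat_def by (intro exI[of _ p] exI[of _ "Suc n"]) auto
qed

lemma BCT_point_vimage:
  assumes "BCT_point X A \<noteq> {}"
  shows "off_point (\<lambda>i. proj -` A i) = proj -` BCT_point X A" "proj -` BCT_point X A \<noteq> {}"
proof -
  have A: "\<And>i. mtopology_of X interior_of A i = {}" and B: "BCT_point X A = M - (\<Union>i. A i)"
    using assms unfolding BCT_point_def by (auto split: if_splits)
  have "\<not> fat (proj -` A i)" for i using A interior_nonempty_iff[of "A i"] by (simp add: fat_vimage_proj)
  then show "off_point (\<lambda>i. proj -` A i) = proj -` BCT_point X A"
    unfolding off_point_def B using proj_in_M by auto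
  obtain x where "x \<in> BCT_point X A" using assms by blast
  then show "proj -` BCT_point X A \<noteq> {}" using proj_surj[of x] unfolding B by auto
qed

lemma BCT_index_vimage:
  assumes "BCT_index X A \<noteq> {}"
  shows "fat_index (\<lambda>i. proj -` A i) = BCT_index X A"
proof -
  have A: "M = (\<Union>i. A i)" and B: "BCT_index X A = {i. mtopology_of X interior_of A i \<noteq> {}}"
    using assms unfolding BCT_index_def by (auto split: if_splits)
  have "(\<Union>i. proj -` A i) = UNIV" using proj_in_M A by blast
  then show ?thesis unfolding fat_index_def B by (simp add: fat_vimage_proj interior_nonempty_iff)
qed

text \<open>
  A cylinder is marked when its image is formally inside one of the balls of the complement.
\<close>

definition pull_neg :: "baire \<Rightarrow> baire" where
  "pull_neg p t = (let i = fs t; w = fs (sn t); n = fs (sn (sn t)); l = sn (sn (sn t)) in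
     if n \<noteq> 0 \<and> ball_inside (state (baire_seq w) (n - 1)) (p (pr i l)) then 1 else 0)"

lemma orec_pull_neg: "orec UNIV pull_neg"
  unfolding pull_neg_def Let_def
  by (intro orec_if odec_conj odec_not odec_eq odec_ball_inside orec_state orec_baire_seq orec_intros)

lemma neg_set_pull:
  assumes "seq_rep (closed_neg_rep X \<alpha>) p = Some A"
  shows "neg_set (pull_neg p) = (\<lambda>i. proj -` A i)"
proof (intro ext set_eqI)
  fix i x
  have A: "A i = {x \<in> M. \<forall>l. \<not> d (\<alpha> (fs (p (pr i l)))) x < rat_seq (sn (p (pr i l)))}"
    using assms by (auto simp: seq_neg_rep)
  have "x \<notin> neg_set (pull_neg p) i \<longleftrightarrow> (\<exists>w n l. agree n (baire_seq w) x \<and> n \<noteq> 0 \<and>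
      ball_inside (state (baire_seq w) (n - 1)) (p (pr i l)))"
    unfolding neg_set_def pull_neg_def Let_def by simp
  also have "\<dots> \<longleftrightarrow> (\<exists>n l. ball_inside (state x n) (p (pr i l)))"
  proof
    assume "\<exists>w n l. agree n (baire_seq w) x \<and> n \<noteq> 0 \<and> ball_inside (state (baire_seq w) (n - 1)) (p (pr i l))"
    then obtain w n l where "agree n (baire_seq w) x" "n \<noteq> 0"
      "ball_inside (state (baire_seq w) (n - 1)) (p (pr i l))" by blast
    then show "\<exists>n l. ball_inside (state x n) (p (pr i l))"
      using state_agree[of "n - 1" "baire_seq w" x] by auto
  next
    assume "\<exists>n l. ball_inside (state x n) (p (pr i l))"
    then obtain n l where "ball_inside (state x n) (p (pr i l))" by blast
    moreover obtain w where "agree (Suc n) (baire_seq w) x" using word_exists by blast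
    ultimately show "\<exists>w n l. agree n (baire_seq w) x \<and> n \<noteq> 0 \<and> ball_inside (state (baire_seq w) (n - 1)) (p (pr i l))"
      using state_agree by (intro exI[of _ w] exI[of _ "Suc n"] exI[of _ l]) auto
  qed
  also have "\<dots> \<longleftrightarrow> (\<exists>l. d (\<alpha> (fs (p (pr i l)))) (proj x) < rat_seq (sn (p (pr i l))))"
  proof
    assume "\<exists>n l. ball_inside (state x n) (p (pr i l))"
    then show "\<exists>l. d (\<alpha> (fs (p (pr i l)))) (proj x) < rat_seq (sn (p (pr i l)))"
      using ball_inside_sound[OF _ proj_in_M] proj_in_bball bball_subset_bcball unfolding bcball_def by blast
  next
    assume "\<exists>l. d (\<alpha> (fs (p (pr i l)))) (proj x) < rat_seq (sn (p (pr i l)))"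
    then obtain l where "d (\<alpha> (fs (p (pr i l)))) (proj x) < rat_seq (sn (p (pr i l)))" by blast
    from ball_inside_complete[OF proj_in_M this] obtain T where
      T: "\<And>T' g. T \<le> T' \<Longrightarrow> d (\<alpha> g) (proj x) \<le> 1 / 2 ^ T' \<Longrightarrow> ball_inside (pr g T') (p (pr i l))" by blast
    have "ball_inside (state x T) (p (pr i l))"
      using T[OF le_sn_state[of T x], of "fs (state x T)"] proj_in_bball[of x T] bball_subset_bcball
      by (auto simp: bcball_def)
    then show "\<exists>n l. ball_inside (state x n) (p (pr i l))" by blast
  qed
  finally show "x \<in> neg_set (pull_neg p) i \<longleftrightarrow> x \<in> proj -` A i" by (auto simp: A proj_in_M)
qed

lemma ex_code: "(\<exists>k. P k) \<longleftrightarrow> (\<exists>a b. P (pr a b))"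
  by (metis prod.collapse prod_decode_inverse)

lemma ex_code4: "(\<exists>k. P k) \<longleftrightarrow> (\<exists>a b c e. P (pr a (pr b (pr c e))))"
  by (subst ex_code, subst (2) ex_code, subst (3) ex_code) (rule refl)

text \<open>
  Block \<open>\<langle>k, \<langle>w, \<langle>n, T\<rangle>\<rangle>\<rangle>\<close> holds a preimage of the \<open>k\<close>-th point in the cylinder of the first \<open>n\<close>
  entries of \<open>w\<close>, provided that precision \<open>T\<close> suffices to see that the point is in the image of
  this cylinder. The entry \<open>T + 1\<close> of the name of the point is used because it is strictly within
  \<open>1 / 2 ^ T\<close>. Codes of points of \<open>X\<close> are shifted by one in a space with a point at infinity.
\<close>

definition pull_pos :: "baire \<Rightarrow> baire" where
  "pull_pos p t = (let i = fs t; k = fs (fs (sn t)); w = fs (sn (fs (sn t)));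
      n = fs (sn (sn (fs (sn t)))); T = sn (sn (sn (fs (sn t)))); j = sn (sn t) in
     if j = 0
     then if n \<noteq> 0 \<and> p (pr i (pr k (T + 1))) \<noteq> 0 \<and>
           well_inside (pr (p (pr i (pr k (T + 1))) - 1) T) (state (baire_seq w) (n - 1)) then 1 else 0
     else if j - 1 < n then baire_seq w (j - 1)
     else pr (p (pr i (pr k (T + 4 * (j - 1 - n) + 1))) - 1) (T + 4 * (j - 1 - n)))"

lemma orec_pull_pos: "orec UNIV pull_pos"
  unfolding pull_pos_def Let_def
  by (intro orec_if odec_conj odec_not odec_eq odec_well_inside orec_state orec_baire_seq orec_intros)

lemma pos_set_pull:
  assumes "seq_rep (closed_pos_rep X \<alpha>) p = Some A"
  shows "pos_set (pull_pos p) = (\<lambda>i. proj -` A i)"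
proof (intro ext set_eqI)
  fix i x
  obtain u where u: "\<And>i k. cauchy_rep (infty_metric X) (infty_seq \<alpha>) (\<lambda>j. p (pr i (pr k j))) = Some (u i k)"
    and A: "\<And>i. A i = {a \<in> M. \<forall>b. a \<in> bball b \<longrightarrow> (\<exists>x\<in>bball b. \<exists>k. u i k = Some x)}"
    by (rule seq_pos_repD[OF assms], rule that)
  define q where "q k j = p (pr i (pr k j))" for k j
  define z where "z k T m = pr (q k (T + 4 * m + 1) - 1) (T + 4 * m)" for k T m
  define ok where "ok k w n T \<longleftrightarrow> n \<noteq> 0 \<and> q k (T + 1) \<noteq> 0 \<and>
    well_inside (pr (q k (T + 1) - 1) T) (state (baire_seq w) (n - 1))" for k w n T
  have qu: "cauchy_rep (infty_metric X) (infty_seq \<alpha>) (q k) = Some (u i k)" for k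
    unfolding q_def by (rule u)
  have flag: "pull_pos p (pr i (pr (pr k (pr w (pr n T))) 0)) \<noteq> 0 \<longleftrightarrow> ok k w n T" for k w n T
    by (simp add: pull_pos_def ok_def q_def)
  have point: "(\<lambda>j. pull_pos p (pr i (pr (pr k (pr w (pr n T))) (Suc j)))) = glue (baire_seq w) n (z k T)"
    for k w n T by (simp add: pull_pos_def glue_def z_def q_def fun_eq_iff)
  have pos: "x \<in> pos_set (pull_pos p) i \<longleftrightarrow>
      (\<forall>m. \<exists>k w n T. ok k w n T \<and> agree m (glue (baire_seq w) n (z k T)) x)"
  proof -
    have "x \<in> pos_set (pull_pos p) i \<longleftrightarrow> (\<forall>m. \<exists>k w n T.
      pull_pos p (pr i (pr (pr k (pr w (pr n T))) 0)) \<noteq> 0 \<and>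
      agree m (\<lambda>j. pull_pos p (pr i (pr (pr k (pr w (pr n T))) (Suc j)))) x)"
      unfolding pos_set_def mem_Collect_eq by (rule arg_cong[where f = All], rule ext) (rule ex_code4)
    then show ?thesis by (simp only: flag point)
  qed
  have val: "\<exists>y. u i k = Some y \<and> proj (glue (baire_seq w) n (z k T)) = y" if "ok k w n T" for k w n T
    using qu[of k]
  proof (cases rule: infty_name_cases)
    case (2 y)
    have "proj (glue (baire_seq w) n (z k T)) = y"
      unfolding z_def
      by (rule proj_glue[of n "\<lambda>m. q k m - 1" y T "baire_seq w"])
        (use that 2 in \<open>auto simp: ok_def\<close>)
    then show ?thesis using 2 by blast
  qed (use that in \<open>simp add: ok_def\<close>)
  have "proj x \<in> A i" if "x \<in> pos_set (pull_pos p) i"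
  proof -
    have "\<exists>y\<in>bball b. \<exists>k. u i k = Some y" if b: "proj x \<in> bball b" for b
    proof -
      obtain m where m: "bball (state x m) \<subseteq> bball b" using proj_neighbourhood[OF b] by blast
      obtain k w n T where ok: "ok k w n T" and a: "agree (Suc m) (glue (baire_seq w) n (z k T)) x"
        using \<open>x \<in> pos_set (pull_pos p) i\<close> unfolding pos by blast
      have "proj (glue (baire_seq w) n (z k T)) \<in> bball (state x m)"
        using proj_in_bball[of _ m] state_agree[OF a] by metis
      then show ?thesis using val[OF ok] m by blast
    qed
    then show ?thesis by (simp add: A proj_in_M)
  qed
  moreover have "x \<in> pos_set (pull_pos p) i" if xA: "proj x \<in> A i"
    unfolding pos
  proof
    fix m
    obtain y k where y: "y \<in> bball (state x m)" "u i k = Some y"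
      using xA proj_in_bball[of x m] unfolding A by blast
    obtain T where T: "\<And>g. d (\<alpha> g) y \<le> 1 / 2 ^ T \<Longrightarrow> well_inside (pr g T) (state x m)"
      using well_inside_complete[OF y(1)] by blast
    obtain w where w: "agree (Suc m) (baire_seq w) x" using word_exists by blast
    have "ok k w (Suc m) T"
      using qu[of k]
    proof (cases rule: infty_name_cases)
      case (2 y')
      have "d (\<alpha> (q k (T + 1) - 1)) y \<le> 1 / 2 ^ T"
        using 2(5)[of "T + 1"] power_half_mono[of T "T + 1"] 2(1) y(2) by simp
      then show ?thesis using T 2(3) state_agree[OF w] by (simp add: ok_def)
    qed (use y in simp)
    moreover have "agree m (glue (baire_seq w) (Suc m) (z k T)) x"
      using w agree_mono[OF agree_trans[OF agree_glue w], of m] by simp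
    ultimately show "\<exists>k w n T. ok k w n T \<and> agree m (glue (baire_seq w) n (z k T)) x" by blast
  qed
  ultimately show "x \<in> pos_set (pull_pos p) i \<longleftrightarrow> x \<in> proj -` A i" by auto
qed

lemma orec_proj_name: "orec UNIV (\<lambda>p k. fs (state p k))"
proof -
  have "orec UNIV (\<lambda>p n. p (sn n))" by (intro orec_intros)
  from orec_state[of UNIV "\<lambda>p n. p", OF this orec_id] show ?thesis by (rule orec_fs)
qed

lemma BCT0_le_cyl_BCT0: "BCT0 X \<alpha> \<le>\<^sub>s\<^sub>W cyl_BCT0"
  by (rule sW_leI[OF orec_pull_neg orec_proj_name])
    (auto simp: BCT0_def cyl_BCT0_def neg_set_pull BCT_point_vimage proj_name)

lemma BCT2_le_cyl_BCT2: "BCT2 X \<alpha> \<le>\<^sub>s\<^sub>W cyl_BCT2"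
  by (rule sW_leI[OF orec_pull_pos orec_proj_name])
    (auto simp: BCT2_def cyl_BCT2_def pos_set_pull BCT_point_vimage proj_name)

lemma BCT1_le_cyl_BCT1: "BCT1 X \<alpha> \<le>\<^sub>s\<^sub>W cyl_BCT1"
  by (rule sW_leI[where H = "\<lambda>p. p", OF orec_pull_neg orec_oracle[OF orec_id, where D = UNIV]])
    (auto simp: BCT1_def cyl_BCT1_def neg_set_pull BCT_index_vimage)

lemma BCT3_le_cyl_BCT3: "BCT3 X \<alpha> \<le>\<^sub>s\<^sub>W cyl_BCT3"
  by (rule sW_leI[where H = "\<lambda>p. p", OF orec_pull_pos orec_oracle[OF orec_id, where D = UNIV]])
    (auto simp: BCT3_def cyl_BCT3_def pos_set_pull BCT_index_vimage)

end

section \<open>Basic open sets of a perfect space\<close>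

context separable_complete
begin

lemma bball_refine:
  assumes "x \<in> bball b" "0 < e"
  shows "\<exists>b'. x \<in> bball b' \<and> bball b' \<subseteq> bball b \<and> (\<forall>y\<in>bball b'. d x y < e)"
proof -
  obtain e' where e': "e' > 0" "\<forall>y\<in>M. d x y < e' \<longrightarrow> y \<in> bball b" using bball_open[OF assms(1)] by blast
  have "x \<in> M" using assms by (simp add: bball_def)
  then obtain b' where "x \<in> bball b'" "\<forall>y\<in>bball b'. d x y < min e e'"
    using ball_at[of x "min e e'"] e' assms by auto
  then show ?thesis using e' by (intro exI[of _ b']) (auto simp: bball_def)
qed

lemma d_pos: "x \<in> M \<Longrightarrow> y \<in> M \<Longrightarrow> x \<noteq> y \<Longrightarrow> 0 < d x y"
  using mdist_zero[of x X y] mdist_nonneg[of X x y] by (simp add: less_le)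

text \<open>
  The sense in which evidence for an open condition on \<open>x\<close> is eventually found. Unlike the mere existence
  of a ball \<open>\<langle>g, T\<rangle>\<close> with \<open>P g T\<close> around \<open>x\<close>, it is closed under finite conjunctions, and it applies to every
  name of \<open>x\<close>.
\<close>

definition near :: "'a \<Rightarrow> (nat \<Rightarrow> nat \<Rightarrow> bool) \<Rightarrow> bool" where
  "near x P \<longleftrightarrow> (\<exists>\<delta>>0. \<forall>g T. d (\<alpha> g) x < \<delta> \<longrightarrow> 1 / 2 ^ T < \<delta> \<longrightarrow> P g T)"

lemma near_conj:
  assumes "near x P" "near x Q"
  shows "near x (\<lambda>g T. P g T \<and> Q g T)"
proof -
  obtain \<delta> \<epsilon> where "\<delta> > 0" "\<epsilon> > 0" "\<And>g T. d (\<alpha> g) x < \<delta> \<Longrightarrow> 1 / 2 ^ T < \<delta> \<Longrightarrow> P g T"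
    "\<And>g T. d (\<alpha> g) x < \<epsilon> \<Longrightarrow> 1 / 2 ^ T < \<epsilon> \<Longrightarrow> Q g T"
    using assms unfolding near_def by blast
  then show ?thesis unfolding near_def by (intro exI[of _ "min \<delta> \<epsilon>"]) auto
qed

lemma near_all:
  fixes n :: nat
  shows "(\<And>i. i < n \<Longrightarrow> near x (P i)) \<Longrightarrow> near x (\<lambda>g T. \<forall>i<n. P i g T)"
proof (induction n)
  case 0
  show ?case unfolding near_def by (intro exI[of _ 1]) simp
next
  case (Suc n)
  have "near x (\<lambda>g T. P n g T \<and> (\<forall>i<n. P i g T))" by (rule near_conj) (use Suc in auto)
  moreover have "(\<forall>i<Suc n. Q i) \<longleftrightarrow> Q n \<and> (\<forall>i<n. Q i)" for Q by (auto simp: less_Suc_eq)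
  ultimately show ?case by simp
qed

lemma nearE:
  assumes "near x P" "x \<in> M"
  obtains g T where "P g T" "d (\<alpha> g) x < 1 / 2 ^ T"
proof -
  obtain \<delta> where \<delta>: "\<delta> > 0" "\<And>g T. d (\<alpha> g) x < \<delta> \<Longrightarrow> 1 / 2 ^ T < \<delta> \<Longrightarrow> P g T"
    using assms unfolding near_def by blast
  obtain T where T: "1 / 2 ^ T < \<delta>" using power_half_less[OF \<delta>(1)] by blast
  obtain g where g: "d (\<alpha> g) x < 1 / 2 ^ T" using dense[OF assms(2), of "1 / 2 ^ T"] by auto
  show thesis by (rule that[OF \<delta>(2) g]) (use g T in auto)
qed

lemma near_name:
  assumes "near x P"
  shows "\<exists>T0. \<forall>T\<ge>T0. \<forall>g. d (\<alpha> g) x \<le> 1 / 2 ^ T \<longrightarrow> P g T"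
proof -
  obtain \<delta> where \<delta>: "\<delta> > 0" "\<And>g T. d (\<alpha> g) x < \<delta> \<Longrightarrow> 1 / 2 ^ T < \<delta> \<Longrightarrow> P g T"
    using assms unfolding near_def by blast
  obtain T0 where T0: "1 / 2 ^ T0 < \<delta>" using power_half_less[OF \<delta>(1)] by blast
  have "P g T" if "T \<ge> T0" "d (\<alpha> g) x \<le> 1 / 2 ^ T" for T g
    using \<delta>(2)[of g T] that T0 power_half_mono[of T0 T] by auto
  then show ?thesis by blast
qed

end

locale perfect_polish = approximated_polish X \<alpha> dn for X :: "'a metric" and \<alpha> dn +
  assumes perfect: "perfect X"
begin

lemma bball_avoid_point: "\<exists>k. \<alpha> k \<in> bball b \<and> \<alpha> k \<noteq> x"
proof (rule ccontr)
  assume "\<not> ?thesis"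
  then have k: "\<And>k. \<alpha> k \<in> bball b \<Longrightarrow> \<alpha> k = x" by blast
  have x: "x \<in> bball b" using k[of "fs b"] \<alpha>_in_bball[of b] by simp
  then have xM: "x \<in> M" by (simp add: bball_def)
  have "bball b \<subseteq> {x}"
  proof
    fix y assume y: "y \<in> bball b"
    then have yM: "y \<in> M" by (simp add: bball_def)
    show "y \<in> {x}"
    proof (rule ccontr)
      assume "y \<notin> {x}"
      then have "0 < d y x" using d_pos yM xM by simp
      then obtain b' where b': "y \<in> bball b'" "bball b' \<subseteq> bball b" "\<forall>z\<in>bball b'. d y z < d y x"
        using bball_refine[OF y] by blast
      have "\<alpha> (fs b') = x" using k \<alpha>_in_bball[of b'] b' by blast
      then show False using b'(3) \<alpha>_in_bball[of b'] by auto
    qed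
  qed
  obtain e where "e > 0" "\<forall>y\<in>M. d x y < e \<longrightarrow> y \<in> bball b" using bball_open[OF x] by blast
  with \<open>bball b \<subseteq> {x}\<close> have "\<exists>r>0. mball_of X x r \<subseteq> {x}" by (intro exI[of _ e]) auto
  then have "openin (mtopology_of X) {x}"
    using xM unfolding mtopology_of_def mball_of_def
    by (simp add: Metric_space.openin_mtopology[OF Metric_space_mspace_mdist])
  then show False using perfect xM by (simp add: perfect_def)
qed

text \<open>
  Nonempty open sets of a perfect space are infinite.
\<close>

lemma bball_avoid_finite: "finite F \<Longrightarrow> \<exists>b'. bball b' \<subseteq> bball b \<and> bball b' \<inter> F = {}"
proof (induction F rule: finite_induct)
  case (insert x F)
  then obtain b' where b': "bball b' \<subseteq> bball b" "bball b' \<inter> F = {}" by blast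
  obtain k where k: "\<alpha> k \<in> bball b'" "\<alpha> k \<noteq> x" using bball_avoid_point by blast
  show ?case
  proof (cases "x \<in> M")
    case True
    then have "0 < d (\<alpha> k) x" using d_pos k by simp
    then obtain b'' where "bball b'' \<subseteq> bball b'" "\<forall>y\<in>bball b''. d (\<alpha> k) y < d (\<alpha> k) x"
      using bball_refine[OF k(1)] by blast
    then show ?thesis using b' by (intro exI[of _ b'']) auto
  next
    case False
    then show ?thesis using b' by (intro exI[of _ b']) (auto simp: bball_def)
  qed
qed auto

section \<open>Radii that avoid all distances of the dense sequence\<close>

text \<open>
  The radius of level \<open>j\<close> is \<open>1 / 2 ^ j\<close> times a number between \<open>1\<close> and \<open>2\<close> with fractional digits in base
  \<open>4\<close>. Stage \<open>s = \<langle>m, l\<rangle>\<close> takes care of the distance of \<open>\<alpha> m\<close> and \<open>\<alpha> l\<close>. If \<open>c\<close> collects the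
  digits so far, the radius is confined, in units of \<open>1 / 2 ^ (j + 2 * s + 4)\<close>, to the
  interval from \<open>2 ^ (2 * s + 4) + 16 * c\<close> of length \<open>16\<close>. The test compares the distance
  with the midpoint of this interval, with an error below \<open>2\<close>.
\<close>

definition digit :: "nat \<Rightarrow> nat \<Rightarrow> nat \<Rightarrow> bool" where
  "digit j s c \<longleftrightarrow> dn (fs s) (sn s) (j + 2 * s + 4) < 2 ^ (2 * s + 4) + 16 * c + 8"

text \<open>
  The next digit selects the last quarter of the interval if the distance appears to be below the midpoint,
  and the first quarter otherwise. Either way the distance falls outside the new interval, and
  the side is known.
\<close>

primrec digits :: "nat \<Rightarrow> nat \<Rightarrow> nat" where
  "digits j 0 = 0"
| "digits j (Suc s) = 4 * digits j s + (if digit j s (digits j s) then 3 else 0)"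

definition hits :: "nat \<Rightarrow> nat \<Rightarrow> nat \<Rightarrow> bool" where
  "hits j m l \<longleftrightarrow> digit j (pr m l) (digits j (pr m l))"

definition rad_lo :: "nat \<Rightarrow> nat \<Rightarrow> real" where "rad_lo j s = (1 + digits j s / 4 ^ s) / 2 ^ j"
definition rad_hi :: "nat \<Rightarrow> nat \<Rightarrow> real" where "rad_hi j s = (1 + (digits j s + 1) / 4 ^ s) / 2 ^ j"
definition rad :: "nat \<Rightarrow> real" where "rad j = (SUP s. rad_lo j s)"

lemma orec_digits: "orec D a \<Longrightarrow> orec D b \<Longrightarrow> orec D (\<lambda>p n. digits (a p n) (b p n))"
proof -
  assume ab: "orec D a" "orec D b"
  have "digits j s = rec_nat 0 (\<lambda>i r. 4 * r + (if digit j i r then 3 else 0)) s" for j s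
    by (induction s) auto
  moreover have "orec D (\<lambda>p n. rec_nat 0 (\<lambda>i r. 4 * r + (if digit (a p n) i r then 3 else 0)) (b p n))"
    unfolding digit_def by (intro orec_rec orec_add orec_if odec_less orec_dn orec_mult orec_power
        orec_comp[OF ab(1)] orec_fs orec_sn orec_id orec_const ab)
  ultimately show ?thesis by simp
qed

lemma odec_hits: "orec D a \<Longrightarrow> orec D b \<Longrightarrow> orec D e \<Longrightarrow> odec D (\<lambda>p n. hits (a p n) (b p n) (e p n))"
  unfolding hits_def digit_def by (intro orec_dn orec_digits orec_intros)

lemma rad_lo_step: "rad_lo j s \<le> rad_lo j (Suc s)" and rad_hi_step: "rad_hi j (Suc s) \<le> rad_hi j s"
  by (auto simp: rad_lo_def rad_hi_def field_simps)

lemma rad_lo_mono: "s \<le> t \<Longrightarrow> rad_lo j s \<le> rad_lo j t" and rad_hi_mono: "s \<le> t \<Longrightarrow> rad_hi j t \<le> rad_hi j s"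
  using lift_Suc_mono_le[of "rad_lo j"] lift_Suc_antimono_le[of "rad_hi j"] rad_lo_step rad_hi_step by auto

lemma rad_hi_eq: "rad_hi j s = rad_lo j s + 1 / (2 ^ j * 4 ^ s)"
  by (simp add: rad_lo_def rad_hi_def field_simps)

lemma rad_lo_le_rad_hi: "rad_lo j s \<le> rad_hi j t"
proof -
  have "rad_lo j s \<le> rad_lo j (max s t)" "rad_hi j (max s t) \<le> rad_hi j t" by (intro rad_lo_mono rad_hi_mono; simp)+
  moreover have "rad_lo j (max s t) \<le> rad_hi j (max s t)" by (simp add: rad_hi_eq)
  ultimately show ?thesis by linarith
qed

lemma rad_lo_le_rad: "rad_lo j s \<le> rad j"
  unfolding rad_def by (rule cSUP_upper) (auto intro!: bdd_aboveI2[of _ _ "rad_hi j 0"] rad_lo_le_rad_hi)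

lemma rad_le_rad_hi: "rad j \<le> rad_hi j s"
  unfolding rad_def by (rule cSUP_least) (auto intro: rad_lo_le_rad_hi)

lemma rad_bounds: "1 / 2 ^ j \<le> rad j" "rad j \<le> 2 / 2 ^ j" "0 < rad j"
proof -
  show 1: "1 / 2 ^ j \<le> rad j" using rad_lo_le_rad[of j 0] by (simp add: rad_lo_def)
  show "rad j \<le> 2 / 2 ^ j" using rad_le_rad_hi[of j 0] by (simp add: rad_hi_def)
  have "0 < 1 / (2::real) ^ j" by simp
  with 1 show "0 < rad j" by linarith
qed

lemma rad_hi_rad_lo_close: "rad_hi j T \<le> rad_lo j T + 1 / 2 ^ T"
proof -
  have "(2::real) ^ T \<le> 2 ^ T * 2 ^ T" by simp
  also have "\<dots> = 4 ^ T" by (simp flip: power_mult_distrib)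
  also have "\<dots> \<le> 2 ^ j * 4 ^ T" by simp
  finally have "1 / (2 ^ j * 4 ^ T) \<le> 1 / (2::real) ^ T" by (intro divide_left_mono) auto
  then show ?thesis by (simp add: rad_hi_eq)
qed

lemma rad_close: "rad j - 1 / 2 ^ T \<le> rad_lo j T" "rad_hi j T \<le> rad j + 1 / 2 ^ T"
  using rad_hi_rad_lo_close[of j T] rad_le_rad_hi[of j T] rad_lo_le_rad[of j T] by auto

text \<open>
  Hence \<open>hits\<close> decides on which side of the radius a distance lies, and equality does not occur.
\<close>

lemma hits_less: "hits j m l \<Longrightarrow> d (\<alpha> m) (\<alpha> l) < rad j"
  and not_hits_greater: "\<not> hits j m l \<Longrightarrow> rad j < d (\<alpha> m) (\<alpha> l)"
proof -
  \<comment> \<open>Stage \<open>s\<close> of the construction is the one that takes care of this distance.\<close>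
  define s where "s = pr m l"
  define c where "c = digits j s"
  let ?D = "dn m l (j + 2 * s + 4)"
  have pw: "(2::real) ^ (j + 2 * s + 4) = 2 ^ j * (16 * 4 ^ s)" "(2::real) ^ (2 * s + 4) = 16 * 4 ^ s"
    by (simp_all add: power_add power_mult)
  have h: "hits j m l \<longleftrightarrow> ?D < 2 ^ (2 * s + 4) + 16 * c + 8"
    by (simp add: hits_def digit_def s_def c_def)
  { assume H: "hits j m l"
    then have "real ?D < real (2 ^ (2 * s + 4) + 16 * c + 8)" unfolding h by (simp only: of_nat_less_iff)
    then have D: "real ?D < 16 * 4 ^ s + 16 * c + 8" by (simp add: pw)
    have "d (\<alpha> m) (\<alpha> l) < (?D + 2) / (2 ^ j * (16 * 4 ^ s))" using dn_up[of m l "j + 2 * s + 4"] by (simp add: pw)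
    also have "\<dots> \<le> (16 * 4 ^ s + 16 * c + 12) / (2 ^ j * (16 * 4 ^ s))"
      using D by (intro divide_right_mono) auto
    also have "\<dots> = rad_lo j (Suc s)" using H by (simp add: rad_lo_def hits_def s_def c_def field_simps)
    finally show "d (\<alpha> m) (\<alpha> l) < rad j" using rad_lo_le_rad[of j "Suc s"] by linarith }
  { assume H: "\<not> hits j m l"
    then have "real (2 ^ (2 * s + 4) + 16 * c + 8) \<le> real ?D" unfolding h not_less by (simp only: of_nat_le_iff)
    then have D: "16 * 4 ^ s + 16 * c + 8 \<le> real ?D" by (simp add: pw)
    have "rad_hi j (Suc s) = (16 * 4 ^ s + 16 * c + 4) / (2 ^ j * (16 * 4 ^ s))"
      using H by (simp add: rad_hi_def hits_def s_def c_def field_simps)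
    also have "\<dots> \<le> (real ?D - 2) / (2 ^ j * (16 * 4 ^ s))"
      using D by (intro divide_right_mono) auto
    also have "\<dots> < d (\<alpha> m) (\<alpha> l)" using dn_low[of m l "j + 2 * s + 4"] by (simp add: pw)
    finally show "rad j < d (\<alpha> m) (\<alpha> l)" using rad_le_rad_hi[of j "Suc s"] by linarith }
qed

lemma hits_self: "hits j l l"
  using not_hits_greater[of j l l] rad_bounds(3)[of j] by auto

section \<open>Cells\<close>

definition addr :: "nat \<Rightarrow> nat \<Rightarrow> nat" where "addr j l = (LEAST m. hits j m l)"

lemma addr_hits: "hits j (addr j l) l" unfolding addr_def by (rule LeastI, rule hits_self)

lemma addr_not_hits: "m < addr j l \<Longrightarrow> \<not> hits j m l" unfolding addr_def by (rule not_less_Least)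

lemma orec_addr: "orec D a \<Longrightarrow> orec D b \<Longrightarrow> orec D (\<lambda>p n. addr (a p n) (b p n))"
proof -
  assume ab: "orec D a" "orec D b"
  have "orec D (\<lambda>p n. LEAST m. hits (fs n) m (sn n))"
    by (rule orec_Least) (auto intro!: odec_hits orec_intros hits_self)
  then have "orec D (\<lambda>p n. addr (fs n) (sn n))" by (simp add: addr_def)
  from orec_comp2[OF this ab] show ?thesis .
qed

text \<open>
  The points whose first ball of level \<open>j\<close> is the one around \<open>\<alpha> m\<close>. Points on a sphere of an earlier ball
  are left out, so that the set is open.
\<close>

definition slab :: "nat \<Rightarrow> nat \<Rightarrow> 'a set" where
  "slab j m = {x \<in> M. d (\<alpha> m) x < rad j \<and> (\<forall>m'<m. rad j < d (\<alpha> m') x)}"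

definition cell :: "nat \<Rightarrow> nat \<Rightarrow> 'a set" where
  "cell l n = {x \<in> M. \<forall>j<n. x \<in> slab j (addr j l)}"

definition same_addr :: "nat \<Rightarrow> nat \<Rightarrow> nat \<Rightarrow> bool" where
  "same_addr k l n \<longleftrightarrow> (\<forall>j<n. addr j k = addr j l)"

lemma slab_disjoint: "x \<in> slab j m \<Longrightarrow> x \<in> slab j m' \<Longrightarrow> m = m'"
  by (cases m m' rule: linorder_cases) (force simp: slab_def)+

lemma \<alpha>_in_slab: "\<alpha> l \<in> slab j (addr j l)"
  using hits_less[OF addr_hits] not_hits_greater[OF addr_not_hits] by (simp add: slab_def)

lemma \<alpha>_in_cell: "\<alpha> l \<in> cell l n" by (simp add: cell_def \<alpha>_in_slab)

lemma cell_cong: "same_addr k l n \<Longrightarrow> cell k n = cell l n" by (auto simp: cell_def same_addr_def)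

lemma cell_same_addr: "x \<in> cell k n \<Longrightarrow> x \<in> cell l n \<Longrightarrow> same_addr k l n"
  unfolding cell_def same_addr_def using slab_disjoint by blast

lemma cell_mono: "m \<le> n \<Longrightarrow> cell l n \<subseteq> cell l m" by (auto simp: cell_def)

lemma cell_small:
  assumes "x \<in> cell l (Suc j)" "y \<in> cell l (Suc j)"
  shows "d x y < 4 / 2 ^ j"
proof -
  let ?a = "\<alpha> (addr j l)"
  have "x \<in> slab j (addr j l)" "y \<in> slab j (addr j l)" using assms by (auto simp: cell_def)
  then have "x \<in> M" "y \<in> M" "d ?a x < rad j" "d ?a y < rad j" by (auto simp: slab_def)
  then show ?thesis using tri[of x ?a y] rad_bounds(2)[of j] by (simp add: mdist_commute[of X x])
qed

text \<open>
  Evidence, at precision \<open>T\<close>, that the ball \<open>\<langle>g, T\<rangle>\<close> lies in \<open>cell l n\<close>. It is the comparison in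
  \<open>ball_in_cell_iff\<close>, cleared of denominators.
\<close>

definition ball_in_cell :: "nat \<Rightarrow> nat \<Rightarrow> nat \<Rightarrow> nat \<Rightarrow> bool" where
  "ball_in_cell l n g T \<longleftrightarrow> (\<forall>j<n.
     (dn g (addr j l) T + 3) * 2 ^ j * 4 ^ T \<le> 2 ^ T * (4 ^ T + digits j T) \<and>
     (\<forall>m<addr j l. 2 ^ T * (4 ^ T + digits j T + 1) + 3 * 2 ^ j * 4 ^ T \<le> dn g m T * 2 ^ j * 4 ^ T))"

lemma odec_ball_in_cell:
  assumes "orec D a" "orec D b" "orec D e" "orec D f"
  shows "odec D (\<lambda>p n. ball_in_cell (a p n) (b p n) (e p n) (f p n))"
proof -
  have "odec D (\<lambda>p n. ball_in_cell (fs n) (fs (sn n)) (fs (sn (sn n))) (sn (sn (sn n))))"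
    unfolding ball_in_cell_def by (intro orec_dn orec_digits orec_addr orec_intros)
  then show ?thesis unfolding odec_def by (rule orec_comp4[OF _ assms])
qed

lemma ball_in_cell_iff:
  "ball_in_cell l n g T \<longleftrightarrow> (\<forall>j<n. (real (dn g (addr j l) T) + 3) / 2 ^ T \<le> rad_lo j T \<and>
     (\<forall>m<addr j l. rad_hi j T \<le> (real (dn g m T) - 3) / 2 ^ T))"
proof -
  have 1: "(D + 3) * 2 ^ j * 4 ^ T \<le> 2 ^ T * (4 ^ T + digits j T) \<longleftrightarrow> (real D + 3) / 2 ^ T \<le> rad_lo j T" for D j
  proof -
    have "(D + 3) * 2 ^ j * 4 ^ T \<le> 2 ^ T * (4 ^ T + digits j T) \<longleftrightarrow>
      real ((D + 3) * 2 ^ j * 4 ^ T) \<le> real (2 ^ T * (4 ^ T + digits j T))" by (simp only: of_nat_le_iff)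
    then show ?thesis by (simp add: rad_lo_def field_simps)
  qed
  have 2: "2 ^ T * (4 ^ T + digits j T + 1) + 3 * 2 ^ j * 4 ^ T \<le> D * 2 ^ j * 4 ^ T \<longleftrightarrow>
      rad_hi j T \<le> (real D - 3) / 2 ^ T" for D j
  proof -
    have "2 ^ T * (4 ^ T + digits j T + 1) + 3 * 2 ^ j * 4 ^ T \<le> D * 2 ^ j * 4 ^ T \<longleftrightarrow>
      real (2 ^ T * (4 ^ T + digits j T + 1) + 3 * 2 ^ j * 4 ^ T) \<le> real (D * 2 ^ j * 4 ^ T)"
      by (simp only: of_nat_le_iff)
    then show ?thesis by (simp add: rad_hi_def field_simps)
  qed
  show ?thesis unfolding ball_in_cell_def 1 2 ..
qed

lemma ball_in_cell_sound:
  assumes "ball_in_cell l n g T" "x \<in> M" "d (\<alpha> g) x \<le> 1 / 2 ^ T"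
  shows "x \<in> cell l n"
proof -
  have "x \<in> slab j (addr j l)" if "j < n" for j
  proof -
    have "d (\<alpha> (addr j l)) x < rad j"
    proof -
      have "d (\<alpha> (addr j l)) x \<le> d (\<alpha> g) (\<alpha> (addr j l)) + d (\<alpha> g) x"
        using tri[of "\<alpha> (addr j l)" "\<alpha> g" x] assms by (simp add: mdist_commute)
      also have "\<dots> < (dn g (addr j l) T + 2) / 2 ^ T + 1 / 2 ^ T"
        using dn_up[of g "addr j l" T] assms by simp
      also have "\<dots> = (real (dn g (addr j l) T) + 3) / 2 ^ T" by (simp add: add_divide_distrib[symmetric])
      also have "\<dots> \<le> rad j" using assms(1) that rad_lo_le_rad[of j T] unfolding ball_in_cell_iff by force
      finally show ?thesis .
    qed
    moreover have "rad j < d (\<alpha> m) x" if "m < addr j l" for m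
    proof -
      have "rad j \<le> (real (dn g m T) - 3) / 2 ^ T"
        using assms(1) that \<open>j < n\<close> rad_le_rad_hi[of j T] unfolding ball_in_cell_iff by force
      also have "\<dots> = (real (dn g m T) - 2) / 2 ^ T - 1 / 2 ^ T" by (simp add: diff_divide_distrib[symmetric])
      also have "\<dots> < d (\<alpha> g) (\<alpha> m) - d (\<alpha> g) x" using dn_low[of g m T] assms by simp
      also have "\<dots> \<le> d (\<alpha> m) x" using tri[of "\<alpha> g" x "\<alpha> m"] assms by (simp add: mdist_commute)
      finally show ?thesis .
    qed
    ultimately show ?thesis using assms(2) by (simp add: slab_def)
  qed
  then show ?thesis using assms(2) by (simp add: cell_def)
qed

text \<open>
  Both margins of the evidence are within \<open>\<delta>\<close> of the true distance once every one of the few error terms is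
  below \<open>\<delta> / 6\<close>.
\<close>

lemma near_dn:
  assumes x: "x \<in> M"
  shows "\<delta> > 0 \<Longrightarrow> near x (\<lambda>g T. (real (dn g m T) + 3) / 2 ^ T < d (\<alpha> m) x + \<delta> \<and>
      d (\<alpha> m) x - \<delta> < (real (dn g m T) - 3) / 2 ^ T \<and> 1 / 2 ^ T < \<delta>)"
  unfolding near_def
proof (intro exI[of _ "\<delta> / 6"] conjI allI impI)
  fix g T assume g: "d (\<alpha> g) x < \<delta> / 6" and T: "1 / 2 ^ T < \<delta> / 6" and "0 < \<delta>"
  have "d (\<alpha> g) (\<alpha> m) \<le> d (\<alpha> g) x + d (\<alpha> m) x" "d (\<alpha> m) x \<le> d (\<alpha> g) (\<alpha> m) + d (\<alpha> g) x"
    using tri[of "\<alpha> g" x "\<alpha> m"] tri[of "\<alpha> m" "\<alpha> g" x] x by (simp_all add: mdist_commute)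
  moreover have "(real (dn g m T) + 3) / 2 ^ T = (real (dn g m T) - 2) / 2 ^ T + 5 * (1 / 2 ^ T)"
    "(real (dn g m T) - 3) / 2 ^ T = (real (dn g m T) + 2) / 2 ^ T - 5 * (1 / 2 ^ T)"
    by (simp_all add: field_simps)
  moreover note dn_up[of g m T, unfolded of_nat_add of_nat_numeral] dn_low[of g m T]
  ultimately show "(real (dn g m T) + 3) / 2 ^ T < d (\<alpha> m) x + \<delta>"
    "d (\<alpha> m) x - \<delta> < (real (dn g m T) - 3) / 2 ^ T" using g T by argo+
  show "1 / 2 ^ T < \<delta>" using T \<open>0 < \<delta>\<close> by simp
qed simp

lemma near_mono: "near x P \<Longrightarrow> (\<And>g T. P g T \<Longrightarrow> Q g T) \<Longrightarrow> near x Q"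
  unfolding near_def by meson

lemma near_ball_in_cell:
  assumes "x \<in> cell l n"
  shows "near x (ball_in_cell l n)"
proof -
  have x: "x \<in> M" using assms by (simp add: cell_def)
  have "near x (\<lambda>g T. (real (dn g (addr j l) T) + 3) / 2 ^ T \<le> rad_lo j T \<and>
     (\<forall>m<addr j l. rad_hi j T \<le> (real (dn g m T) - 3) / 2 ^ T))" if "j < n" for j
  proof (rule near_conj[OF _ near_all])
    have s: "x \<in> slab j (addr j l)" using assms that by (simp add: cell_def)
    have "(rad j - d (\<alpha> (addr j l)) x) / 2 > 0" using s by (simp add: slab_def)
    from near_dn[OF x this, of "addr j l"]
    show "near x (\<lambda>g T. (real (dn g (addr j l) T) + 3) / 2 ^ T \<le> rad_lo j T)"
    proof (rule near_mono)
      fix g T assume "(real (dn g (addr j l) T) + 3) / 2 ^ T < d (\<alpha> (addr j l)) x + (rad j - d (\<alpha> (addr j l)) x) / 2 \<and>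
          d (\<alpha> (addr j l)) x - (rad j - d (\<alpha> (addr j l)) x) / 2 < (real (dn g (addr j l) T) - 3) / 2 ^ T \<and>
          1 / 2 ^ T < (rad j - d (\<alpha> (addr j l)) x) / 2"
      then show "(real (dn g (addr j l) T) + 3) / 2 ^ T \<le> rad_lo j T" using rad_close(1)[of j T] by argo
    qed
    fix m assume "m < addr j l"
    then have "(d (\<alpha> m) x - rad j) / 2 > 0" using s by (simp add: slab_def)
    from near_dn[OF x this, of m]
    show "near x (\<lambda>g T. rad_hi j T \<le> (real (dn g m T) - 3) / 2 ^ T)"
    proof (rule near_mono)
      fix g T assume "(real (dn g m T) + 3) / 2 ^ T < d (\<alpha> m) x + (d (\<alpha> m) x - rad j) / 2 \<and>
          d (\<alpha> m) x - (d (\<alpha> m) x - rad j) / 2 < (real (dn g m T) - 3) / 2 ^ T \<and>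
          1 / 2 ^ T < (d (\<alpha> m) x - rad j) / 2"
      then show "rad_hi j T \<le> (real (dn g m T) - 3) / 2 ^ T" using rad_close(2)[of j T] by argo
    qed
  qed
  from near_all[OF this] show ?thesis by (rule near_mono) (unfold ball_in_cell_iff, assumption)
qed

lemma in_cell_iff: "x \<in> cell l n \<longleftrightarrow> x \<in> M \<and> (\<exists>g T. ball_in_cell l n g T \<and> d (\<alpha> g) x < 1 / 2 ^ T)"
proof
  assume x: "x \<in> cell l n"
  then have "x \<in> M" by (simp add: cell_def)
  then show "x \<in> M \<and> (\<exists>g T. ball_in_cell l n g T \<and> d (\<alpha> g) x < 1 / 2 ^ T)"
    using nearE[OF near_ball_in_cell[OF x]] by blast
next
  assume "x \<in> M \<and> (\<exists>g T. ball_in_cell l n g T \<and> d (\<alpha> g) x < 1 / 2 ^ T)"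
  then show "x \<in> cell l n" using ball_in_cell_sound less_imp_le by blast
qed

lemma cell_open: "x \<in> cell l n \<Longrightarrow> \<exists>b. x \<in> bball b \<and> bball b \<subseteq> cell l n"
proof -
  assume "x \<in> cell l n"
  then obtain g T where "x \<in> M" "ball_in_cell l n g T" "d (\<alpha> g) x < 1 / 2 ^ T" by (auto simp: in_cell_iff)
  then show ?thesis using ball_in_cell_sound[of l n g T]
    by (intro exI[of _ "pr g T"]) (auto simp: in_bball)
qed

section \<open>The tree of cells\<close>

definition located :: "'a \<Rightarrow> bool" where
  "located x \<longleftrightarrow> x \<in> M \<and> (\<forall>j. \<exists>l. x \<in> cell l j)"

text \<open>
  Nodes are pairs \<open>\<langle>k, n\<rangle>\<close> and stand for \<open>cell k n\<close>. The children of such a node are the cells inside it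
  whose address branches off from that of \<open>\<alpha> k\<close> exactly at their last level. Each child is represented by
  the least index of a point in it, so distinct children have disjoint cells.
\<close>

definition valid :: "nat \<Rightarrow> nat \<Rightarrow> bool" where
  "valid s b \<longleftrightarrow> sn s < sn b \<and> same_addr (fs s) (fs b) (sn b - 1) \<and>
     addr (sn b - 1) (fs s) \<noteq> addr (sn b - 1) (fs b) \<and> (\<forall>l<fs b. \<not> same_addr (fs b) l (sn b))"

lemma same_addr_mono: "same_addr k l n \<Longrightarrow> m \<le> n \<Longrightarrow> same_addr k l m" by (simp add: same_addr_def)
lemma same_addr_sym: "same_addr k l n \<Longrightarrow> same_addr l k n" by (simp add: same_addr_def)
lemma same_addr_trans: "same_addr k l n \<Longrightarrow> same_addr l m n \<Longrightarrow> same_addr k m n" by (simp add: same_addr_def)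

abbreviation ncell :: "nat \<Rightarrow> 'a set" where "ncell s \<equiv> cell (fs s) (sn s)"

lemma valid_subset: "valid s b \<Longrightarrow> ncell b \<subseteq> ncell s"
proof -
  assume v: "valid s b"
  then have "same_addr (fs s) (fs b) (sn s)" unfolding valid_def by (auto intro: same_addr_mono)
  then have "ncell s = cell (fs b) (sn s)" by (rule cell_cong)
  then show ?thesis using cell_mono[of "sn s" "sn b" "fs b"] v by (auto simp: valid_def)
qed

lemma valid_disjoint:
  assumes v: "valid s b" "valid s b'" and x: "x \<in> ncell b" "x \<in> ncell b'"
  shows "b = b'"
proof -
  \<comment> \<open>A cell that branches off earlier differs from \<open>\<alpha> (fs s)\<close> on a level on which the other one agrees with it.\<close>
  have level: "\<not> sn b < sn b'" if v: "valid s b" "valid s b'" and x: "x \<in> ncell b" "x \<in> ncell b'" for b b'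
  proof
    assume less: "sn b < sn b'"
    have "same_addr (fs b) (fs b') (sn b)"
      using cell_same_addr[OF x(1)] x(2) cell_mono[of "sn b" "sn b'" "fs b'"] less by auto
    moreover have "same_addr (fs s) (fs b') (sn b)" using v(2) less unfolding valid_def by (auto intro: same_addr_mono)
    ultimately have "same_addr (fs s) (fs b) (sn b)" using same_addr_sym same_addr_trans by blast
    then have "addr (sn b - 1) (fs s) = addr (sn b - 1) (fs b)"
      using v(1) unfolding same_addr_def valid_def by auto
    then show False using v(1) by (simp add: valid_def)
  qed
  have n: "sn b = sn b'" using level[OF v x] level[OF v(2,1) x(2,1)] by simp
  have "same_addr (fs b) (fs b') (sn b)" using cell_same_addr[OF x(1)] x(2) n by simp
  then have "\<not> fs b' < fs b" "\<not> fs b < fs b'" using v n same_addr_sym unfolding valid_def by auto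
  then show ?thesis using n by (metis linorder_neqE_nat prod.collapse prod_decode_inverse)
qed

text \<open>
  The address of \<open>x\<close> must differ from that of \<open>\<alpha> k\<close> at some level, as cells shrink to points; the
  first such level determines the child.
\<close>

lemma valid_cover:
  assumes x: "x \<in> cell k n" "x \<noteq> \<alpha> k" "located x"
  shows "\<exists>b. valid (pr k n) b \<and> x \<in> ncell b"
proof -
  have "\<exists>m. x \<notin> cell k m"
  proof (rule ccontr)
    assume "\<not> ?thesis"
    then have c: "x \<in> cell k m" for m by blast
    have "0 < d x (\<alpha> k)" using d_pos x by (simp add: located_def)
    then obtain j where "4 / 2 ^ j < d x (\<alpha> k)" using power_half_less by blast
    moreover have "d x (\<alpha> k) < 4 / 2 ^ j" by (rule cell_small[OF c \<alpha>_in_cell])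
    ultimately show False by simp
  qed
  define m where "m = (LEAST m. x \<notin> cell k m)"
  have m: "x \<notin> cell k m" "\<And>i. i < m \<Longrightarrow> x \<in> cell k i"
    unfolding m_def using LeastI_ex[OF \<open>\<exists>m. x \<notin> cell k m\<close>] not_less_Least by blast+
  have nm: "n < m" using m(1) x(1) cell_mono[of m n k] by (meson not_le subsetD)
  have exl: "\<exists>l. x \<in> cell l m" using x(3) by (simp add: located_def)
  define l where "l = (LEAST l. x \<in> cell l m)"
  have l: "x \<in> cell l m" "\<And>i. i < l \<Longrightarrow> x \<notin> cell i m"
    unfolding l_def using LeastI_ex[OF exl] not_less_Least by blast+
  have a: "same_addr k l (m - 1)" using cell_same_addr[OF m(2)] l(1) cell_mono[of "m - 1" m l] nm by auto
  have "addr (m - 1) k \<noteq> addr (m - 1) l"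
  proof
    assume e: "addr (m - 1) k = addr (m - 1) l"
    have "same_addr k l m"
      unfolding same_addr_def
    proof (intro allI impI)
      fix j assume "j < m"
      then show "addr j k = addr j l" using a e by (cases "j = m - 1") (auto simp: same_addr_def)
    qed
    then show False using cell_cong m(1) l(1) by blast
  qed
  moreover have "\<not> same_addr l i m" if "i < l" for i using cell_cong l that by blast
  ultimately have "valid (pr k n) (pr l m)" using nm a by (simp add: valid_def)
  then show ?thesis using l(1) by (intro exI[of _ "pr l m"]) simp
qed

lemma located_\<alpha>: "located (\<alpha> k)"
  unfolding located_def using \<alpha>_in_cell by auto

text \<open>
  Since \<open>\<alpha> k\<close> is not isolated, the dense sequence has points that branch off arbitrarily late.
\<close>

lemma infinite_valid: "infinite {b. valid s b}"
proof
  assume fin: "finite {b. valid s b}"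
  \<comment> \<open>Beyond the levels of all children, if there were finitely many.\<close>
  define N where "N = Suc (Max (insert (sn s) (sn ` {b. valid s b})))"
  have bound: "sn b < N" if "valid s b" for b
    unfolding N_def using fin that by (auto simp: less_Suc_eq_le intro!: Max_ge)
  have sN: "sn s \<le> N" unfolding N_def using fin by (auto intro!: le_SucI Max_ge)
  obtain b' where b': "\<alpha> (fs s) \<in> bball b'" "bball b' \<subseteq> cell (fs s) N"
    using cell_open[OF \<alpha>_in_cell] by blast
  obtain k where k: "\<alpha> k \<in> bball b'" "\<alpha> k \<noteq> \<alpha> (fs s)" using bball_avoid_point by blast
  then obtain b where b: "valid (pr (fs s) N) b"
    using valid_cover[of "\<alpha> k" "fs s" N] b' located_\<alpha> by blast
  then have "valid s b" using sN by (simp add: valid_def)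
  then show False using bound[of b] b by (simp add: valid_def)
qed

lemma odec_valid: "orec D a \<Longrightarrow> orec D b \<Longrightarrow> odec D (\<lambda>p n. valid (a p n) (b p n))"
proof -
  assume ab: "orec D a" "orec D b"
  have "odec D (\<lambda>p n. valid (fs n) (sn n))"
    unfolding valid_def same_addr_def by (intro orec_addr orec_intros)
  then show ?thesis unfolding odec_def by (rule orec_comp2[OF _ ab])
qed

definition child :: "nat \<Rightarrow> nat \<Rightarrow> nat" where "child s z = enumerate {b. valid s b} z"

lemma valid_child: "valid s (child s z)"
  using enumerate_in_set[OF infinite_valid] by (auto simp: child_def)

lemma child_inj: "child s z = child s z' \<Longrightarrow> z = z'"
  using enumerate_mono[OF _ infinite_valid] unfolding child_def by (metis less_irrefl linorder_neqE_nat)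

lemma child_surj: "valid s b \<Longrightarrow> \<exists>z. child s z = b"
  unfolding child_def by (rule enumerate_Ex) (use infinite_valid in auto)

lemma orec_child: "orec D a \<Longrightarrow> orec D b \<Longrightarrow> orec D (\<lambda>p n. child (a p n) (b p n))"
proof -
  assume ab: "orec D a" "orec D b"
  have next_ex: "\<exists>b. valid s b \<and> r < b" for s r
    using infinite_valid[of s] unfolding infinite_nat_iff_unbounded by blast
  then have first_ex: "\<exists>b. valid s b" for s by blast
  have nx: "orec D (\<lambda>p n. LEAST b. valid (fs n) b \<and> sn n < b)"
    by (rule orec_Least) (auto intro!: odec_valid orec_intros next_ex)
  have fst: "orec D (\<lambda>p n. LEAST b. valid n b)"
    by (rule orec_Least) (auto intro!: odec_valid orec_intros first_ex)
  have "orec D (\<lambda>p n. rec_nat (LEAST b. valid (a p n) b) (\<lambda>i r. LEAST b. valid (a p n) b \<and> r < b) (b p n))"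
    by (intro orec_rec orec_comp[OF fst] ab orec_comp2[where g = "\<lambda>p s r. LEAST b. valid s b \<and> r < b", OF nx]
        orec_comp[OF ab(1)] orec_fs orec_sn orec_id)
  moreover have "child s z = rec_nat (LEAST b. valid s b) (\<lambda>i r. LEAST b. valid s b \<and> r < b) z" for s z
    unfolding child_def
    by (induction z) (simp_all add: enumerate_0 enumerate_Suc''[OF infinite_valid])
  ultimately show ?thesis by simp
qed

primrec node :: "baire \<Rightarrow> nat \<Rightarrow> nat" where
  "node p 0 = 0"
| "node p (Suc n) = child (node p n) (p n)"

lemma orec_node:
  assumes "orec D (\<lambda>p n. g p (fs n) (sn n))" "orec D h"
  shows "orec D (\<lambda>p n. node (g p n) (h p n))"
proof -
  have "node p n = rec_nat 0 (\<lambda>i s. child s (p i)) n" for p n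
    by (induction n) auto
  moreover have "orec UNIV (\<lambda>p n. rec_nat 0 (\<lambda>i s. child s (p i)) n)"
    by (intro orec_rec orec_child orec_intros)
  ultimately have "orec UNIV node" by (simp add: orec_def)
  from orec_app[OF this assms] show ?thesis by simp
qed

text \<open>
  The cell of the branch \<open>p\<close> at depth \<open>n\<close>. Its address has at least \<open>n\<close> levels, but usually more.
\<close>

definition V :: "baire \<Rightarrow> nat \<Rightarrow> 'a set" where "V p n = ncell (node p n)"

definition on_branch :: "baire \<Rightarrow> 'a \<Rightarrow> bool" where "on_branch p x \<longleftrightarrow> (\<forall>n. x \<in> V p n)"

lemma V_0: "V p 0 = M"
proof -
  have "sn 0 = 0" by (simp add: prod_decode_def prod_decode_aux.simps)
  then show ?thesis by (simp add: V_def cell_def)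
qed

lemma V_Suc: "V p (Suc n) \<subseteq> V p n"
  using valid_subset[OF valid_child] by (simp add: V_def)

lemma V_mono: "m \<le> n \<Longrightarrow> V p n \<subseteq> V p m"
  by (induction n rule: dec_induct) (use V_Suc in auto)

lemma V_subset_M: "V p n \<subseteq> M" by (auto simp: V_def cell_def)

lemma node_agree: "agree n p q \<Longrightarrow> node p n = node q n"
  by (induction n) (auto simp: agree_def)

lemma V_agree: "agree n p q \<Longrightarrow> V p n = V q n" by (simp add: V_def node_agree)

lemma node_level: "n \<le> sn (node p n)"
proof (induction n)
  case (Suc n)
  then show ?case using valid_child[of "node p n" "p n"] by (simp add: valid_def)
qed simp

lemma node_in_V: "n \<le> m \<Longrightarrow> \<alpha> (fs (node p m)) \<in> V p n"
  using V_mono[of n m p] \<alpha>_in_cell unfolding V_def by blast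

lemma V_small:
  assumes "x \<in> V p (Suc n)" "y \<in> V p (Suc n)"
  shows "d x y < 4 / 2 ^ n"
proof -
  have "V p (Suc n) \<subseteq> cell (fs (node p (Suc n))) (Suc n)"
    unfolding V_def by (rule cell_mono[OF node_level])
  then show ?thesis using cell_small assms by blast
qed

lemma V_open: "x \<in> V p n \<Longrightarrow> \<exists>b. x \<in> bball b \<and> bball b \<subseteq> V p n"
  unfolding V_def by (rule cell_open)

lemma V_disjoint: "x \<in> V p n \<Longrightarrow> x \<in> V q n \<Longrightarrow> agree n p q"
proof (induction n)
  case (Suc n)
  then have a: "agree n p q" using V_Suc by blast
  then have n: "node p n = node q n" by (rule node_agree)
  have "child (node q n) (p n) = child (node q n) (q n)"
    using valid_disjoint[OF valid_child valid_child] Suc.prems by (simp add: V_def n)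
  then have "p n = q n" by (rule child_inj)
  then show ?case using a by (auto simp: agree_def less_Suc_eq)
qed (simp add: agree_def)

lemma on_branch_disjoint: "on_branch p x \<Longrightarrow> x \<in> V q n \<Longrightarrow> agree n p q"
  using V_disjoint unfolding on_branch_def by blast

section \<open>Generic points\<close>

definition generic :: "'a \<Rightarrow> bool" where "generic x \<longleftrightarrow> located x \<and> x \<notin> range \<alpha>"

text \<open>
  The points \<open>\<alpha> n\<close> have to be excluded from the generic ones: all cells with the address of \<open>\<alpha> k\<close> are passed
  over by the children of the node \<open>\<langle>k, n\<rangle>\<close>, so \<open>\<alpha> k\<close> may be on no branch.
\<close>

definition W :: "nat \<Rightarrow> 'a set" where "W n = {x \<in> M. x \<noteq> \<alpha> n \<and> (\<exists>l. x \<in> cell l n)}"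

lemma generic_iff: "generic x \<longleftrightarrow> (\<forall>n. x \<in> W n)"
  unfolding generic_def located_def W_def by auto

lemma on_branch_exists:
  assumes "generic x"
  shows "\<exists>p. on_branch p x"
proof -
  have step: "\<exists>z. x \<in> ncell (child s z)" if "x \<in> ncell s" for s
  proof -
    have "\<exists>b. valid (pr (fs s) (sn s)) b \<and> x \<in> ncell b"
      by (rule valid_cover) (use that assms in \<open>auto simp: generic_def\<close>)
    then obtain b where "valid s b" "x \<in> ncell b" by auto
    then show ?thesis using child_surj by blast
  qed
  \<comment> \<open>Descend into the child that contains \<open>x\<close>.\<close>
  define f where "f s = (SOME z. x \<in> ncell (child s z))" for s
  define sq where "sq = rec_nat 0 (\<lambda>i s. child s (f s))"
  define p where "p n = f (sq n)" for n
  have sq: "sq n = node p n" for n by (induction n) (auto simp: sq_def p_def)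
  have "x \<in> ncell (sq n)" for n
  proof (induction n)
    case 0
    have "x \<in> V p 0" using assms by (simp add: V_0 generic_def located_def)
    then show ?case by (simp add: V_def sq_def)
  next
    case (Suc n)
    then have "x \<in> ncell (child (sq n) (f (sq n)))" unfolding f_def using someI_ex[OF step] by blast
    then show ?case by (simp add: sq_def)
  qed
  then show ?thesis unfolding on_branch_def V_def sq by blast
qed

lemma near_W:
  assumes "x \<in> W n"
  shows "\<exists>l. x \<in> cell l n \<and> near x (\<lambda>g T. ball_in_cell l n g T \<and> 3 \<le> dn g n T)"
proof -
  obtain l where l: "x \<in> cell l n" and x: "x \<in> M" "x \<noteq> \<alpha> n" using assms by (auto simp: W_def)
  define \<delta> where "\<delta> = d (\<alpha> n) x / 2"
  have "0 < \<delta>" using d_pos[of "\<alpha> n" x] x by (simp add: \<delta>_def)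
  have "near x (\<lambda>g T. 3 \<le> dn g n T)"
  proof (rule near_mono[OF near_dn[OF x(1) \<open>0 < \<delta>\<close>, of n]])
    fix g T assume "(real (dn g n T) + 3) / 2 ^ T < d (\<alpha> n) x + \<delta> \<and>
      d (\<alpha> n) x - \<delta> < (real (dn g n T) - 3) / 2 ^ T \<and> 1 / 2 ^ T < \<delta>"
    moreover have "d (\<alpha> n) x - \<delta> = \<delta>" by (simp add: \<delta>_def)
    ultimately have "0 < (real (dn g n T) - 3) / 2 ^ T" using \<open>0 < \<delta>\<close> by linarith
    then show "3 \<le> dn g n T" by (simp add: zero_less_divide_iff)
  qed
  then show ?thesis using near_conj[OF near_ball_in_cell[OF l]] l by blast
qed

lemma far_from_\<alpha>:
  assumes "3 \<le> dn g n T" "x \<in> M" "d (\<alpha> g) x \<le> 1 / 2 ^ T"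
  shows "x \<noteq> \<alpha> n"
proof
  assume "x = \<alpha> n"
  have "(1::real) / 2 ^ T \<le> (real (dn g n T) - 2) / 2 ^ T"
    using assms(1) by (intro divide_right_mono) auto
  then show False using dn_low[of g n T] assms(3) \<open>x = \<alpha> n\<close> by simp
qed

lemma in_W_iff:
  "x \<in> W n \<longleftrightarrow> x \<in> M \<and> (\<exists>l g T. ball_in_cell l n g T \<and> 3 \<le> dn g n T \<and> d (\<alpha> g) x < 1 / 2 ^ T)"
proof
  assume x: "x \<in> W n"
  then have "x \<in> M" by (simp add: W_def)
  obtain l where "near x (\<lambda>g T. ball_in_cell l n g T \<and> 3 \<le> dn g n T)" using near_W[OF x] by blast
  from nearE[OF this \<open>x \<in> M\<close>]
  show "x \<in> M \<and> (\<exists>l g T. ball_in_cell l n g T \<and> 3 \<le> dn g n T \<and> d (\<alpha> g) x < 1 / 2 ^ T)"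
    using \<open>x \<in> M\<close> by metis
next
  assume "x \<in> M \<and> (\<exists>l g T. ball_in_cell l n g T \<and> 3 \<le> dn g n T \<and> d (\<alpha> g) x < 1 / 2 ^ T)"
  then obtain l g T where x: "x \<in> M" "ball_in_cell l n g T" "3 \<le> dn g n T" "d (\<alpha> g) x \<le> 1 / 2 ^ T"
    using less_imp_le by blast
  then have "x \<in> cell l n" "x \<noteq> \<alpha> n" using ball_in_cell_sound far_from_\<alpha> by auto
  then show "x \<in> W n" using x(1) by (auto simp: W_def)
qed

lemma W_open: "x \<in> W n \<Longrightarrow> \<exists>b. x \<in> bball b \<and> bball b \<subseteq> W n"
proof -
  assume "x \<in> W n"
  then obtain l g T where "x \<in> M" "ball_in_cell l n g T" "3 \<le> dn g n T" "d (\<alpha> g) x < 1 / 2 ^ T"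
    unfolding in_W_iff by blast
  moreover from this have "bball (pr g T) \<subseteq> W n" unfolding in_W_iff in_bball subset_iff by blast
  ultimately show ?thesis by (intro exI[of _ "pr g T"]) (auto simp: in_bball)
qed

lemma W_dense: "\<exists>x\<in>bball b. x \<in> W n"
proof -
  obtain k where "\<alpha> k \<in> bball b" "\<alpha> k \<noteq> \<alpha> n" using bball_avoid_point by blast
  moreover from this have "\<alpha> k \<in> W n" using \<alpha>_in_cell[of k n] \<alpha>_in[of k] unfolding W_def by blast
  ultimately show ?thesis by blast
qed

lemma closed_compl_W: "closedin (mtopology_of X) (M - W n)"
  unfolding closedin_iff using W_open by blast

lemma interior_compl_W: "mtopology_of X interior_of (M - W n) = {}"
  using interior_nonempty_iff[of "M - W n"] W_dense[of _ n] by blast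

lemma generic_dense: "\<exists>x\<in>bball b. generic x"
proof -
  have "mtopology_of X interior_of (\<Union>n. M - W n) = {}"
    unfolding mtopology_of_def
    by (rule Metric_space.metric_Baire_category_alt)
      (use complete closed_compl_W interior_compl_W in \<open>auto simp: mcomplete_of_def mtopology_of_def\<close>)
  then have "\<not> bball b \<subseteq> (\<Union>n. M - W n)" using interior_nonempty_iff by metis
  then show ?thesis by (auto simp: generic_iff bball_def)
qed

lemma generic_in_V: "\<exists>q x. agree n p q \<and> generic x \<and> on_branch q x"
proof -
  obtain b where b: "bball b \<subseteq> V p n" using V_open node_in_V[of n n p] by blast
  obtain x where x: "x \<in> bball b" "generic x" using generic_dense by blast
  obtain q where q: "on_branch q x" using on_branch_exists x by blast
  then have "agree n q p" using on_branch_disjoint b x by blast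
  then show ?thesis using q x agree_sym by blast
qed

lemma V_in_bball:
  assumes "x \<in> bball b" "on_branch p x"
  shows "\<exists>n. V p n \<subseteq> bball b"
proof -
  obtain e where e: "e > 0" "\<forall>y\<in>M. d x y < e \<longrightarrow> y \<in> bball b" using bball_open[OF assms(1)] by blast
  obtain n where n: "4 / 2 ^ n < e" using power_half_less e by blast
  have "V p (Suc n) \<subseteq> bball b"
  proof
    fix y assume y: "y \<in> V p (Suc n)"
    have "x \<in> V p (Suc n)" using assms by (simp add: on_branch_def)
    moreover have "y \<in> M" using y V_subset_M by blast
    ultimately show "y \<in> bball b" using V_small[of x p n y] y e n by auto
  qed
  then show ?thesis by blast
qed

text \<open>
  Since generic points are dense and their cells shrink, the ball contains a cell \<open>V p n\<close>. All smaller cells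
  contain generic points, too, so \<open>A'\<close> is dense in the cylinder of the first \<open>n\<close> entries of \<open>p\<close>.
\<close>

lemma fat_if_interior:
  assumes A: "\<And>p x. generic x \<Longrightarrow> on_branch p x \<Longrightarrow> x \<in> A \<Longrightarrow> p \<in> A'" and "cyl_closed A'" and b: "bball b \<subseteq> A"
  shows "fat A'"
proof -
  obtain x where x: "x \<in> bball b" "generic x" using generic_dense by blast
  obtain p where p: "on_branch p x" using on_branch_exists x by blast
  obtain n where n: "V p n \<subseteq> bball b" using V_in_bball[OF x(1) p] by blast
  have "z \<in> A'" if z: "agree n p z" for z
  proof (rule ccontr)
    assume "z \<notin> A'"
    then obtain m where m: "\<And>y. agree m z y \<Longrightarrow> y \<notin> A'" using \<open>cyl_closed A'\<close> unfolding cyl_closed_def by blast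
    obtain q y where q: "agree (max m n) z q" "generic y" "on_branch q y" using generic_in_V by blast
    have "agree n p q" using agree_trans[OF z agree_mono[OF q(1)]] by simp
    then have "y \<in> V p n" using V_agree q(3) unfolding on_branch_def by blast
    then have "q \<in> A'" using A q n b by blast
    then show False using m agree_mono[OF q(1)] by simp
  qed
  then show ?thesis unfolding fat_def by blast
qed

section \<open>The point determined by a branch\<close>

text \<open>
  This point exists for all \<open>p\<close> by completeness. It is in the closures of the cells of \<open>p\<close>, but
  possibly on their boundaries, so that different branches may determine the same point.
\<close>

definition iota :: "baire \<Rightarrow> 'a" where
  "iota p = (SOME x. cauchy_rep X \<alpha> (\<lambda>t. fs (node p (t + 3))) = Some x)"

lemma node_close: "k \<le> n \<Longrightarrow> d (\<alpha> (fs (node p (n + 3)))) (\<alpha> (fs (node p (k + 3)))) < 1 / 2 ^ k"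
proof -
  assume "k \<le> n"
  then have "\<alpha> (fs (node p (n + 3))) \<in> V p (Suc (k + 2))" "\<alpha> (fs (node p (k + 3))) \<in> V p (Suc (k + 2))"
    by (auto intro: node_in_V)
  from V_small[OF this] show ?thesis by simp
qed

lemma iota_name: "cauchy_rep X \<alpha> (\<lambda>t. fs (node p (t + 3))) = Some (iota p)"
  unfolding iota_def by (rule someI_ex[OF cauchy_rep_total]) (rule node_close)

lemma iota_in_M: "iota p \<in> M" using cauchy_repD(1)[OF iota_name range_\<alpha>] .

lemma iota_near:
  assumes "x \<in> V p (Suc n)"
  shows "d x (iota p) \<le> 4 / 2 ^ n"
  by (rule name_limit_le[OF iota_name, where k = n])
    (use assms V_subset_M V_small[OF assms node_in_V] in \<open>auto intro!: less_imp_le\<close>)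

lemma iota_on_branch:
  assumes "on_branch p x"
  shows "iota p = x"
proof (rule ccontr)
  have x: "x \<in> M" using assms V_subset_M[of p 0] by (auto simp: on_branch_def)
  assume "iota p \<noteq> x"
  then have "0 < d x (iota p)" using d_pos x iota_in_M by auto
  then obtain n where "4 / 2 ^ n < d x (iota p)" using power_half_less by blast
  moreover have "d x (iota p) \<le> 4 / 2 ^ n" by (rule iota_near) (use assms in \<open>simp add: on_branch_def\<close>)
  ultimately show False by simp
qed

text \<open>
  An open cell that contains a limit of cells of \<open>q\<close> meets a cell of \<open>q\<close>, and distinct cells of the same
  depth are disjoint.
\<close>

lemma iota_closure:
  assumes "iota q \<in> V p n"
  shows "agree n q p"
proof -
  obtain b where b: "iota q \<in> bball b" "bball b \<subseteq> V p n" using V_open assms by blast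
  obtain e where e: "e > 0" "\<forall>y\<in>M. d (iota q) y < e \<longrightarrow> y \<in> bball b" using bball_open[OF b(1)] by blast
  obtain m where m: "4 / 2 ^ m < e" using power_half_less e by blast
  \<comment> \<open>A centre that is deep enough both to be close to \<open>iota q\<close> and to be in \<open>V q n\<close>.\<close>
  let ?y = "\<alpha> (fs (node q (Suc (max m n))))"
  have "d ?y (iota q) \<le> 4 / 2 ^ m"
    by (rule iota_near) (rule node_in_V, simp)
  then have "?y \<in> V p n" using e m b(2) by (auto simp: mdist_commute)
  moreover have "?y \<in> V q n" by (rule node_in_V) simp
  ultimately show ?thesis using V_disjoint by blast
qed

lemma iota_approx:
  assumes "iota p \<in> bball b"
  shows "\<exists>n. \<forall>q. agree n p q \<longrightarrow> iota q \<in> bball b"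
proof -
  obtain e where e: "e > 0" "\<forall>y\<in>M. d (iota p) y < e \<longrightarrow> y \<in> bball b" using bball_open[OF assms] by blast
  obtain n where n: "8 / 2 ^ n < e" using power_half_less e by blast
  have "iota q \<in> bball b" if q: "agree (Suc n) p q" for q
  proof -
    let ?y = "\<alpha> (fs (node p (Suc n)))"
    have y: "?y \<in> V p (Suc n)" "?y \<in> V q (Suc n)" using node_in_V[of "Suc n" "Suc n" p] V_agree[OF q] by auto
    have "d (iota p) (iota q) \<le> d ?y (iota p) + d ?y (iota q)"
      using tri[OF iota_in_M _ iota_in_M, of ?y] by (simp add: mdist_commute)
    also have "\<dots> \<le> 4 / 2 ^ n + 4 / 2 ^ n" by (intro add_mono iota_near y)
    finally show ?thesis using e n iota_in_M by simp
  qed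
  then show ?thesis by blast
qed

section \<open>Nowhere dense supersets with positive information\<close>

text \<open>
  One index for each address at a single level. The points with these indices form a locally finite net, as
  near any point only finitely many balls of a level can be the first one.
\<close>

definition first_rep :: "nat \<Rightarrow> nat \<Rightarrow> bool" where
  "first_rep e l \<longleftrightarrow> (\<forall>l'<l. addr (e + 3) l' \<noteq> addr (e + 3) l)"

text \<open>
  The representatives of level \<open>e + 3\<close> are within \<open>1 / 2 ^ e\<close> of all points: two points with the same
  address at this level have distance below \<open>4 / 2 ^ (e + 3)\<close>, which is half of that bound. A
  representative is kept unless the ball of this radius around it is seen to be in \<open>W n\<close>.
\<close>

definition dot :: "nat \<Rightarrow> nat \<Rightarrow> nat \<Rightarrow> bool" where
  "dot n e l \<longleftrightarrow> first_rep e l \<and> \<not> (ball_in_cell l n l e \<and> 3 \<le> dn l n e)"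

lemma odec_dot:
  assumes "orec D a" "orec D b" "orec D e"
  shows "odec D (\<lambda>p n. dot (a p n) (b p n) (e p n))"
proof -
  have "odec D (\<lambda>p n. dot (fs n) (fs (sn n)) (sn (sn n)))"
    unfolding dot_def first_rep_def by (intro odec_ball_in_cell orec_dn orec_addr orec_intros)
  then show ?thesis unfolding odec_def by (rule orec_comp3[OF _ assms])
qed

text \<open>
  A point outside of \<open>W n\<close> prevents all representatives that are close to it from being discarded.
\<close>

lemma dots_cover:
  assumes x: "x \<in> M" "x \<notin> W n" "x \<in> bball b"
  shows "\<exists>e l. dot n e l \<and> \<alpha> l \<in> bball b"
proof -
  obtain \<epsilon> where \<epsilon>: "\<epsilon> > 0" "\<forall>y\<in>M. d x y < \<epsilon> \<longrightarrow> y \<in> bball b" using bball_open x by blast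
  obtain e where e: "1 / 2 ^ e < \<epsilon>" using power_half_less \<epsilon> by blast
  obtain k where k: "d (\<alpha> k) x < 1 / 2 ^ Suc e" using dense[OF x(1), of "1 / 2 ^ Suc e"] by auto
  define l where "l = (LEAST l. addr (e + 3) l = addr (e + 3) k)"
  have l: "addr (e + 3) l = addr (e + 3) k" unfolding l_def by (rule LeastI) simp
  have "first_rep e l"
    unfolding first_rep_def l using not_less_Least unfolding l_def by blast
  have "d (\<alpha> l) (\<alpha> k) < 1 / 2 ^ Suc e"
  proof -
    let ?a = "\<alpha> (addr (e + 3) k)"
    have "d ?a (\<alpha> l) < rad (e + 3)" "d ?a (\<alpha> k) < rad (e + 3)"
      using \<alpha>_in_slab[of l "e + 3"] \<alpha>_in_slab[of k "e + 3"] by (simp_all add: slab_def l)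
    then have "d (\<alpha> l) (\<alpha> k) < 4 / 2 ^ (e + 3)"
      using tri[of "\<alpha> l" ?a "\<alpha> k"] rad_bounds(2)[of "e + 3"] by (simp add: mdist_commute[of X "\<alpha> l"])
    then show ?thesis by (simp add: power_add)
  qed
  then have lx: "d (\<alpha> l) x < 1 / 2 ^ e" using tri[of "\<alpha> l" "\<alpha> k" x] k x(1) by simp
  have "\<not> (ball_in_cell l n l e \<and> 3 \<le> dn l n e)"
    using x lx unfolding in_W_iff by blast
  then have "dot n e l" using \<open>first_rep e l\<close> by (simp add: dot_def)
  moreover have "\<alpha> l \<in> bball b" using \<epsilon> e lx by (simp add: mdist_commute)
  ultimately show ?thesis by blast
qed

lemma reps_locally_finite:
  assumes x: "x \<in> M"
  shows "\<exists>\<eta>>0. finite {l. first_rep e l \<and> d (\<alpha> l) x < \<eta>}"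
proof -
  obtain m where m: "d (\<alpha> m) x < rad (e + 3)" using dense[OF x rad_bounds(3)] by blast
  have fin: "finite {l. first_rep e l \<and> addr (e + 3) l \<le> m}"
  proof (rule finite_imageD)
    show "inj_on (addr (e + 3)) {l. first_rep e l \<and> addr (e + 3) l \<le> m}"
      unfolding first_rep_def by (auto intro!: inj_onI) (metis linorder_neqE_nat)
  qed (auto intro: finite_subset[of _ "{..m}"])
  have le: "addr (e + 3) l \<le> m" if "d (\<alpha> l) x < rad (e + 3) - d (\<alpha> m) x" for l
  proof (rule ccontr)
    assume "\<not> ?thesis"
    then have "rad (e + 3) < d (\<alpha> m) (\<alpha> l)" using not_hits_greater addr_not_hits by simp
    also have "\<dots> \<le> d (\<alpha> m) x + d (\<alpha> l) x" using tri[of "\<alpha> m" x "\<alpha> l"] x by (simp add: mdist_commute)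
    finally show False using that by simp
  qed
  have "finite {l. first_rep e l \<and> d (\<alpha> l) x < rad (e + 3) - d (\<alpha> m) x}"
    by (rule finite_subset[OF _ fin]) (use le in blast)
  then show ?thesis using m by (intro exI[of _ "rad (e + 3) - d (\<alpha> m) x"]) simp
qed

lemma reps_below_locally_finite:
  assumes "x \<in> M"
  shows "\<exists>\<eta>>0. finite {l. (\<exists>e<N. first_rep e l) \<and> d (\<alpha> l) x < \<eta>}"
proof (induction N)
  case 0
  show ?case by (intro exI[of _ 1]) simp
next
  case (Suc N)
  then obtain \<eta> where \<eta>: "\<eta> > 0" "finite {l. (\<exists>e<N. first_rep e l) \<and> d (\<alpha> l) x < \<eta>}" by blast
  obtain \<theta> where \<theta>: "\<theta> > 0" "finite {l. first_rep N l \<and> d (\<alpha> l) x < \<theta>}"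
    using reps_locally_finite[OF assms] by blast
  have "finite {l. (\<exists>e<Suc N. first_rep e l) \<and> d (\<alpha> l) x < min \<eta> \<theta>}"
    by (rule finite_subset[OF _ finite_UnI[OF \<eta>(2) \<theta>(2)]]) (auto simp: less_Suc_eq)
  then show ?case using \<eta>(1) \<theta>(1) by (intro exI[of _ "min \<eta> \<theta>"]) simp
qed

lemma ball_in_cell_cong: "same_addr k l n \<Longrightarrow> ball_in_cell k n g T = ball_in_cell l n g T"
  by (simp add: ball_in_cell_def same_addr_def)

text \<open>
  Around a point of \<open>W n\<close> all representatives of sufficiently fine nets are discarded, and the remaining
  finitely many nets are locally finite.
\<close>

lemma dots_locally_finite:
  assumes "x \<in> W n"
  shows "\<exists>\<eta>>0. finite {l. (\<exists>e. dot n e l) \<and> d (\<alpha> l) x < \<eta>}"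
proof -
  have x: "x \<in> M" using assms by (simp add: W_def)
  obtain l where l: "x \<in> cell l n" "near x (\<lambda>g T. ball_in_cell l n g T \<and> 3 \<le> dn g n T)"
    using near_W[OF assms] by blast
  then obtain \<delta> where \<delta>: "\<delta> > 0"
      "\<And>g T. d (\<alpha> g) x < \<delta> \<Longrightarrow> 1 / 2 ^ T < \<delta> \<Longrightarrow> ball_in_cell l n g T \<and> 3 \<le> dn g n T"
    unfolding near_def by blast
  obtain b where b: "x \<in> bball b" "bball b \<subseteq> cell l n" using cell_open l(1) by blast
  obtain \<theta> where \<theta>: "\<theta> > 0" "\<forall>y\<in>M. d x y < \<theta> \<longrightarrow> y \<in> bball b" using bball_open[OF b(1)] by blast
  obtain N where N: "1 / 2 ^ N < \<delta>" using power_half_less \<delta>(1) by blast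
  obtain \<eta> where \<eta>: "\<eta> > 0" "finite {l. (\<exists>e<N. first_rep e l) \<and> d (\<alpha> l) x < \<eta>}"
    using reps_below_locally_finite[OF x] by blast
  have small: "e < N" if "dot n e g" "d (\<alpha> g) x < min \<delta> \<theta>" for e g
  proof (rule ccontr)
    assume "\<not> e < N"
    then have "1 / 2 ^ e < \<delta>" using N power_half_mono[of N e] by simp
    then have "ball_in_cell l n g e \<and> 3 \<le> dn g n e" using \<delta>(2) that by simp
    moreover have "\<alpha> g \<in> cell l n" using \<theta>(2) b(2) that by (auto simp: mdist_commute)
    then have "same_addr g l n" using cell_same_addr \<alpha>_in_cell by blast
    ultimately show False using that(1) ball_in_cell_cong unfolding dot_def by blast
  qed
  have "finite {l. (\<exists>e. dot n e l) \<and> d (\<alpha> l) x < min \<eta> (min \<delta> \<theta>)}"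
    by (rule finite_subset[OF _ \<eta>(2)]) (use small in \<open>auto simp: dot_def\<close>)
  then show ?thesis using \<eta>(1) \<delta>(1) \<theta>(1) by (intro exI[of _ "min \<eta> (min \<delta> \<theta>)"]) simp
qed

definition dots :: "nat \<Rightarrow> nat \<Rightarrow> 'a option" where
  "dots n k = (if dot n (fs k) (sn k) then Some (\<alpha> (sn k)) else None)"

definition shell :: "nat \<Rightarrow> 'a set" where
  "shell n = {a \<in> M. \<forall>b. a \<in> bball b \<longrightarrow> (\<exists>x\<in>bball b. \<exists>k. dots n k = Some x)}"

lemma compl_W_subset_shell: "M - W n \<subseteq> shell n"
proof
  fix x assume x: "x \<in> M - W n"
  have "\<exists>y\<in>bball b. \<exists>k. dots n k = Some y" if xb: "x \<in> bball b" for b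
  proof -
    obtain e l where "dot n e l" "\<alpha> l \<in> bball b" using dots_cover[of x n b] xb x by blast
    then show ?thesis by (intro bexI[of _ "\<alpha> l"] exI[of _ "pr e l"]) (simp_all add: dots_def)
  qed
  then show "x \<in> shell n" using x by (simp add: shell_def)
qed

text \<open>
  Being dense, \<open>W n\<close> meets any open set, and close to a point of \<open>W n\<close> the set \<open>shell n\<close> is finite.
\<close>

lemma interior_shell: "mtopology_of X interior_of (shell n) = {}"
proof (rule ccontr)
  assume "\<not> ?thesis"
  then obtain b where b: "bball b \<subseteq> shell n" using interior_nonempty_iff by blast
  obtain x where x: "x \<in> bball b" "x \<in> W n" using W_dense by blast
  obtain \<eta> where \<eta>: "\<eta> > 0" "finite {l. (\<exists>e. dot n e l) \<and> d (\<alpha> l) x < \<eta>}"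
    using dots_locally_finite[OF x(2)] by blast
  obtain b' where b': "bball b' \<subseteq> bball b" "\<forall>y\<in>bball b'. d x y < \<eta>" using bball_refine[OF x(1) \<eta>(1)] by blast
  let ?F = "\<alpha> ` {l. (\<exists>e. dot n e l) \<and> d (\<alpha> l) x < \<eta>}"
  obtain c where c: "bball c \<subseteq> bball b'" "bball c \<inter> ?F = {}"
    using bball_avoid_finite[of ?F b'] \<eta>(2) by blast
  have "\<alpha> (fs c) \<in> shell n" using \<alpha>_in_bball[of c] c(1) b'(1) b by blast
  then obtain y k where y: "y \<in> bball c" "dots n k = Some y" using \<alpha>_in_bball[of c] unfolding shell_def by blast
  then have k: "dot n (fs k) (sn k)" "y = \<alpha> (sn k)" by (auto simp: dots_def split: if_splits)
  have "d (\<alpha> (sn k)) x < \<eta>" using y(1) c(1) b'(2) k(2) by (auto simp: mdist_commute)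
  then have "y \<in> ?F" using k by blast
  then show False using y(1) c(2) by blast
qed

section \<open>Transfer of solutions\<close>

text \<open>
  Index \<open>\<langle>0, i\<rangle>\<close> carries the counterpart of \<open>A' i\<close>, any other index \<open>\<langle>s, i\<rangle>\<close> a nowhere dense set that
  contains all points outside of \<open>W i\<close>.
\<close>

definition transfers :: "(nat \<Rightarrow> 'a set) \<Rightarrow> (nat \<Rightarrow> baire set) \<Rightarrow> bool" where
  "transfers A A' \<longleftrightarrow> (\<forall>k. closedin (mtopology_of X) (A k)) \<and> (\<forall>i. cyl_closed (A' i)) \<and>
     (\<forall>i p x. generic x \<longrightarrow> on_branch p x \<longrightarrow> (x \<in> A (pr 0 i) \<longleftrightarrow> p \<in> A' i)) \<and>
     (\<forall>s i. s \<noteq> 0 \<longrightarrow> M - W i \<subseteq> A (pr s i) \<and> mtopology_of X interior_of A (pr s i) = {})"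

lemma transfers_fat:
  assumes t: "transfers A A'" and k: "mtopology_of X interior_of A k \<noteq> {}"
  shows "fs k = 0 \<and> fat (A' (sn k))"
proof -
  have "fs k = 0"
  proof (rule ccontr)
    assume "fs k \<noteq> 0"
    then have "mtopology_of X interior_of A (pr (fs k) (sn k)) = {}"
      using t unfolding transfers_def by blast
    then show False using k by simp
  qed
  then have e: "k = pr 0 (sn k)" by (metis prod.collapse prod_decode_inverse)
  obtain b where b: "bball b \<subseteq> A k" using k interior_nonempty_iff by blast
  have "fat (A' (sn k))"
  proof (rule fat_if_interior[OF _ _ b])
    show "p \<in> A' (sn k)" if "generic x" "on_branch p x" "x \<in> A k" for p x
    proof -
      have "x \<in> A (pr 0 (sn k))" using that(3) e by metis
      then show ?thesis using t that(1,2) unfolding transfers_def by blast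
    qed
    show "cyl_closed (A' (sn k))" using t by (simp add: transfers_def)
  qed
  then show ?thesis using \<open>fs k = 0\<close> by blast
qed

lemma transfers_point:
  assumes t: "transfers A A'" and ne: "off_point A' \<noteq> {}"
  shows "BCT_point X A \<noteq> {}"
    and "x \<in> BCT_point X A \<Longrightarrow> generic x \<and> (\<forall>p. on_branch p x \<longrightarrow> p \<in> off_point A')"
proof -
  have nf: "\<not> fat (A' i)" for i using ne unfolding off_point_def by (auto split: if_splits)
  have clos: "closedin (mtopology_of X) (A k)" for k using t by (simp add: transfers_def)
  have int: "mtopology_of X interior_of A k = {}" for k using transfers_fat[OF t] nf by blast
  show "BCT_point X A \<noteq> {}" by (rule BCT_point_nonempty[OF complete M_nonempty clos int])
  assume "x \<in> BCT_point X A"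
  then have x: "x \<in> M" "\<And>k. x \<notin> A k" using clos int by (auto simp: BCT_point_def)
  have "x \<in> W n" for n
  proof (rule ccontr)
    assume "x \<notin> W n"
    moreover have "M - W n \<subseteq> A (pr 1 n)" using t unfolding transfers_def by (metis zero_neq_one)
    ultimately show False using x by blast
  qed
  then have g: "generic x" by (simp add: generic_iff)
  moreover have "p \<in> off_point A'" if "on_branch p x" for p
  proof -
    have "p \<notin> A' i" for i using t g that x(2) unfolding transfers_def by blast
    then show ?thesis using nf by (simp add: off_point_def)
  qed
  ultimately show "generic x \<and> (\<forall>p. on_branch p x \<longrightarrow> p \<in> off_point A')" by blast
qed

lemma transfers_index:
  assumes t: "transfers A A'" and ne: "fat_index A' \<noteq> {}"
  shows "BCT_index X A \<noteq> {}" and "k \<in> BCT_index X A \<Longrightarrow> sn k \<in> fat_index A'"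
proof -
  have cov: "(\<Union>i. A' i) = UNIV" using ne unfolding fat_index_def by (auto split: if_splits)
  have clos: "closedin (mtopology_of X) (A k)" for k using t by (simp add: transfers_def)
  have "x \<in> (\<Union>k. A k)" if x: "x \<in> M" for x
  proof (cases "generic x")
    case True
    then obtain p where p: "on_branch p x" using on_branch_exists by blast
    obtain i where "p \<in> A' i" using cov by blast
    then have "x \<in> A (pr 0 i)" using t p True unfolding transfers_def by blast
    then show ?thesis by blast
  next
    case False
    then obtain n where "x \<notin> W n" by (auto simp: generic_iff)
    moreover have "M - W n \<subseteq> A (pr 1 n)" using t unfolding transfers_def by (metis zero_neq_one)
    ultimately show ?thesis using x by blast
  qed
  moreover have "A k \<subseteq> M" for k using closedin_subset[OF clos] by simp
  ultimately have un: "M = (\<Union>k. A k)" by blast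
  show "BCT_index X A \<noteq> {}" by (rule BCT_index_nonempty[OF complete M_nonempty clos un])
  assume "k \<in> BCT_index X A"
  then have "mtopology_of X interior_of A k \<noteq> {}" by (auto simp: BCT_index_def split: if_splits)
  then have "fat (A' (sn k))" using transfers_fat[OF t] by blast
  then show "sn k \<in> fat_index A'" using cov by (simp add: fat_index_def)
qed

section \<open>Reading the branch of a generic point\<close>

text \<open>
  The search looks for a whole word \<open>fs v\<close> of length \<open>Suc n\<close> whose cell contains the point, with the precision
  \<open>sn v\<close> as witness. As cells of one depth are disjoint, the words found for different \<open>n\<close> fit together, and no
  recursion over the tree is needed.
\<close>

definition read_addr :: "baire \<Rightarrow> baire" where
  "read_addr q n = baire_seq (fs (LEAST v. ball_in_cell (fs (node (baire_seq (fs v)) (Suc n)))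
     (sn (node (baire_seq (fs v)) (Suc n))) (q (Suc (sn v))) (sn v))) n"

definition generic_names :: "baire set" where
  "generic_names = {q. \<exists>x. cauchy_rep X \<alpha> q = Some x \<and> generic x}"

lemma read_addr_search:
  assumes q: "cauchy_rep X \<alpha> q = Some x" and p: "on_branch p x"
  shows "\<exists>v. ball_in_cell (fs (node (baire_seq (fs v)) (Suc n)))
     (sn (node (baire_seq (fs v)) (Suc n))) (q (Suc (sn v))) (sn v)"
proof -
  have "x \<in> ncell (node p (Suc n))" using p unfolding on_branch_def V_def by blast
  from near_name[OF near_ball_in_cell[OF this]] obtain T where
    T: "\<And>g. d (\<alpha> g) x \<le> 1 / 2 ^ T \<Longrightarrow> ball_in_cell (fs (node p (Suc n))) (sn (node p (Suc n))) g T" by blast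
  obtain w where "agree (Suc n) (baire_seq w) p" using word_exists by blast
  then have w: "node (baire_seq w) (Suc n) = node p (Suc n)" by (rule node_agree)
  have "d (\<alpha> (q (Suc T))) x \<le> 1 / 2 ^ T"
    using cauchy_repD(3)[OF q range_\<alpha>, of "Suc T"] power_half_mono[of T "Suc T"] by linarith
  then show ?thesis using T w by (intro exI[of _ "pr w T"]) simp
qed

lemma read_addr_eq:
  assumes q: "cauchy_rep X \<alpha> q = Some x" and p: "on_branch p x"
  shows "read_addr q = p"
proof
  fix n
  define v where "v = (LEAST v. ball_in_cell (fs (node (baire_seq (fs v)) (Suc n)))
     (sn (node (baire_seq (fs v)) (Suc n))) (q (Suc (sn v))) (sn v))"
  have v: "ball_in_cell (fs (node (baire_seq (fs v)) (Suc n)))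
     (sn (node (baire_seq (fs v)) (Suc n))) (q (Suc (sn v))) (sn v)"
    unfolding v_def by (rule LeastI_ex[OF read_addr_search[OF q p]])
  have "d (\<alpha> (q (Suc (sn v)))) x \<le> 1 / 2 ^ sn v"
    using cauchy_repD(3)[OF q range_\<alpha>, of "Suc (sn v)"] power_half_mono[of "sn v" "Suc (sn v)"] by linarith
  then have "x \<in> V (baire_seq (fs v)) (Suc n)"
    unfolding V_def by (rule ball_in_cell_sound[OF v cauchy_repD(1)[OF q range_\<alpha>]])
  then have "agree (Suc n) p (baire_seq (fs v))" using on_branch_disjoint[OF p] by blast
  then have "p n = baire_seq (fs v) n" by (simp add: agree_def)
  then show "read_addr q n = p n" by (simp add: read_addr_def v_def)
qed

lemma orec_read_addr: "orec generic_names read_addr"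
proof -
  have nd: "orec D (\<lambda>p n. node (baire_seq (a p n)) (b p n))" if "orec D a" "orec D b" for D a b
    by (rule orec_node) (intro orec_baire_seq orec_comp[OF that(1)] orec_fs orec_sn orec_id that)+
  have "orec generic_names (\<lambda>q n. LEAST v. ball_in_cell (fs (node (baire_seq (fs v)) (Suc n)))
     (sn (node (baire_seq (fs v)) (Suc n))) (q (Suc (sn v))) (sn v))"
  proof (rule orec_Least)
    fix q n assume "q \<in> generic_names"
    then show "\<exists>m. ball_in_cell (fs (node (baire_seq (fs m)) (Suc n)))
     (sn (node (baire_seq (fs m)) (Suc n))) (q (Suc (sn m))) (sn m)"
      using read_addr_search on_branch_exists unfolding generic_names_def by blast
  qed (intro odec_ball_in_cell orec_fs orec_sn orec_oracle orec_Suc nd orec_id)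
  then have "orec generic_names (\<lambda>q n. baire_seq (fs (LEAST v. ball_in_cell (fs (node (baire_seq (fs v)) (Suc n)))
     (sn (node (baire_seq (fs v)) (Suc n))) (q (Suc (sn v))) (sn v))) n)"
    by (intro orec_baire_seq orec_fs orec_id)
  then show ?thesis by (rule orec_cong) (simp add: read_addr_def)
qed

section \<open>Counterparts of sets in Baire space\<close>

text \<open>
  The code \<open>0\<close> denotes a ball of radius \<open>0\<close> and contributes nothing to the complement.
\<close>

definition push_neg :: "baire \<Rightarrow> baire" where
  "push_neg p t = (let s = fs (fs t); i = sn (fs t); u = sn t in
     if s = 0 then
       let w = fs u; n = fs (sn u); l = fs (sn (sn u)); g = fs (sn (sn (sn u))); T = sn (sn (sn (sn u))) in
         if p (pr i (pr w (pr n l))) \<noteq> 0 \<and>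
            ball_in_cell (fs (node (baire_seq w) n)) (sn (node (baire_seq w) n)) g T then pr g (half_pow T) else 0
     else
       let l = fs u; g = fs (sn u); T = sn (sn u) in
         if ball_in_cell l i g T \<and> 3 \<le> dn g i T then pr g (half_pow T) else 0)"

lemma orec_push_neg: "orec UNIV push_neg"
proof -
  have nd: "orec D (\<lambda>p n. node (baire_seq (a p n)) (b p n))" if "orec D a" "orec D b" for D a b
    by (rule orec_node) (intro orec_baire_seq orec_comp[OF that(1)] orec_fs orec_sn orec_id that)+
  show ?thesis
    unfolding push_neg_def Let_def
    by (intro orec_if odec_conj odec_not odec_eq odec_le odec_ball_in_cell nd orec_half_pow orec_dn orec_pr orec_fs orec_sn
        orec_oracle orec_id orec_const)
qed

definition hull_neg :: "baire \<Rightarrow> nat \<Rightarrow> 'a set" where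
  "hull_neg p k = (if fs k = 0
     then {x \<in> M. \<forall>w n l. p (pr (sn k) (pr w (pr n l))) \<noteq> 0 \<longrightarrow> x \<notin> V (baire_seq w) n}
     else M - W (sn k))"

lemma not_in_ball_0: "\<not> d (\<alpha> (fs 0)) x < rat_seq (sn 0)"
proof -
  have "prod_decode 0 = (0, 0)" by (simp add: prod_decode_def prod_decode_aux.simps)
  then show ?thesis using mdist_nonneg[of X "\<alpha> 0" x] by (simp add: not_less)
qed

lemma push_neg_rep: "seq_rep (closed_neg_rep X \<alpha>) (push_neg p) = Some (hull_neg p)"
proof -
  let ?in = "\<lambda>b x. d (\<alpha> (fs b)) x < rat_seq (sn b)"
  have "{x \<in> M. \<forall>u. \<not> ?in (push_neg p (pr k u)) x} = hull_neg p k" for k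
  proof (cases "fs k = 0")
    case True
    have *: "(\<exists>u. ?in (push_neg p (pr k u)) x) \<longleftrightarrow>
      (\<exists>w n l. p (pr (sn k) (pr w (pr n l))) \<noteq> 0 \<and> x \<in> V (baire_seq w) n)" (is "?L \<longleftrightarrow> ?R")
      if x: "x \<in> M" for x
    proof
      assume ?L
      then obtain u where u: "?in (push_neg p (pr k u)) x" by blast
      define w n l g T where "w = fs u" "n = fs (sn u)" "l = fs (sn (sn u))"
        "g = fs (sn (sn (sn u)))" "T = sn (sn (sn (sn u)))"
      have e: "push_neg p (pr k u) = (if p (pr (sn k) (pr w (pr n l))) \<noteq> 0 \<and>
            ball_in_cell (fs (node (baire_seq w) n)) (sn (node (baire_seq w) n)) g T then pr g (half_pow T) else 0)"
        unfolding push_neg_def Let_def using True by (simp add: w_n_l_g_T_def)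
      have c: "p (pr (sn k) (pr w (pr n l))) \<noteq> 0 \<and>
            ball_in_cell (fs (node (baire_seq w) n)) (sn (node (baire_seq w) n)) g T"
      proof (rule ccontr)
        assume "\<not> ?thesis"
        then have "push_neg p (pr k u) = 0" unfolding e by (rule if_not_P)
        then show False using u not_in_ball_0 by metis
      qed
      then have "d (\<alpha> g) x < 1 / 2 ^ T" using u unfolding e by simp
      then have "x \<in> V (baire_seq w) n" unfolding V_def in_cell_iff using c x by blast
      then show ?R using c by blast
    next
      assume ?R
      then obtain w n l where p: "p (pr (sn k) (pr w (pr n l))) \<noteq> 0" and "x \<in> V (baire_seq w) n" by blast
      then obtain g T where "ball_in_cell (fs (node (baire_seq w) n)) (sn (node (baire_seq w) n)) g T"
        "d (\<alpha> g) x < 1 / 2 ^ T" unfolding V_def in_cell_iff by blast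
      then have "?in (push_neg p (pr k (pr w (pr n (pr l (pr g T)))))) x"
        using p True by (simp add: push_neg_def)
      then show ?L by blast
    qed
    show ?thesis unfolding hull_neg_def if_P[OF True] using * by blast
  next
    case False
    have *: "(\<exists>u. ?in (push_neg p (pr k u)) x) \<longleftrightarrow> x \<in> W (sn k)" if x: "x \<in> M" for x
    proof
      assume "\<exists>u. ?in (push_neg p (pr k u)) x"
      then obtain u where u: "?in (push_neg p (pr k u)) x" by blast
      define l g T where "l = fs u" "g = fs (sn u)" "T = sn (sn u)"
      have e: "push_neg p (pr k u) = (if ball_in_cell l (sn k) g T \<and> 3 \<le> dn g (sn k) T then pr g (half_pow T) else 0)"
        unfolding push_neg_def Let_def using False by (simp add: l_g_T_def)
      have c: "ball_in_cell l (sn k) g T \<and> 3 \<le> dn g (sn k) T"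
      proof (rule ccontr)
        assume "\<not> ?thesis"
        then have "push_neg p (pr k u) = 0" unfolding e by (rule if_not_P)
        then show False using u not_in_ball_0 by metis
      qed
      then have "d (\<alpha> g) x < 1 / 2 ^ T" using u unfolding e by simp
      then show "x \<in> W (sn k)" unfolding in_W_iff using c x by blast
    next
      assume "x \<in> W (sn k)"
      then obtain l g T where "ball_in_cell l (sn k) g T" "3 \<le> dn g (sn k) T" "d (\<alpha> g) x < 1 / 2 ^ T"
        unfolding in_W_iff by blast
      then have "?in (push_neg p (pr k (pr l (pr g T)))) x" using False by (simp add: push_neg_def)
      then show "\<exists>u. ?in (push_neg p (pr k u)) x" by blast
    qed
    show ?thesis unfolding hull_neg_def if_not_P[OF False] using * by blast
  qed
  then show ?thesis unfolding seq_neg_rep by (simp add: fun_eq_iff)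
qed

lemma transfers_neg: "transfers (hull_neg p) (neg_set p)"
  unfolding transfers_def
proof (intro conjI allI impI)
  fix k
  let ?q = "\<lambda>j. push_neg p (pr k j)"
  have "(\<lambda>i. the (closed_neg_rep X \<alpha> (\<lambda>j. push_neg p (pr i j)))) = hull_neg p"
    using push_neg_rep[of p] unfolding seq_rep_def by (auto split: if_splits)
  then have "the (closed_neg_rep X \<alpha> ?q) = hull_neg p k" by (rule fun_cong)
  moreover have "closed_neg_rep X \<alpha> ?q = Some (the (closed_neg_rep X \<alpha> ?q))"
    by (simp add: closed_neg_rep_def)
  ultimately show "closedin (mtopology_of X) (hull_neg p k)" using neg_rep_closed by metis
next
  fix i p' x assume l: "on_branch p' x"
  then have x: "x \<in> M" using V_subset_M[of p' 0] by (auto simp: on_branch_def)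
  have *: "x \<in> V (baire_seq w) n \<longleftrightarrow> agree n (baire_seq w) p'" for w n
    using on_branch_disjoint[OF l] V_agree l agree_sym unfolding on_branch_def by metis
  have "hull_neg p (pr 0 i) =
      {x \<in> M. \<forall>w n l. p (pr i (pr w (pr n l))) \<noteq> 0 \<longrightarrow> x \<notin> V (baire_seq w) n}"
    by (simp add: hull_neg_def)
  then have "x \<in> hull_neg p (pr 0 i) \<longleftrightarrow>
      (\<forall>w n l. p (pr i (pr w (pr n l))) \<noteq> 0 \<longrightarrow> \<not> agree n (baire_seq w) p')"
    using x by (simp add: *)
  also have "\<dots> \<longleftrightarrow> p' \<in> neg_set p i"
    unfolding neg_set_def mem_Collect_eq by (intro iff_allI) auto
  finally show "x \<in> hull_neg p (pr 0 i) \<longleftrightarrow> p' \<in> neg_set p i" .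
next
  fix s i :: nat assume "s \<noteq> 0"
  then show "M - W i \<subseteq> hull_neg p (pr s i)" "mtopology_of X interior_of hull_neg p (pr s i) = {}"
    using interior_compl_W by (simp_all add: hull_neg_def)
qed (rule cyl_closed_neg_set)

text \<open>
  The entries are codes in the space with a point at infinity, whose code is \<open>0\<close>. The shift by \<open>3\<close> makes the
  centres of the cells a fast Cauchy sequence.
\<close>

definition push_pos :: "baire \<Rightarrow> baire" where
  "push_pos p t = (let s = fs (fs t); i = sn (fs t); k = fs (sn t); j = sn (sn t) in
     if s = 0 then
       if p (pr i (pr k 0)) = 0 then 0 else Suc (fs (node (\<lambda>j. p (pr i (pr k (Suc j)))) (j + 3)))
     else if dot i (fs k) (sn k) then Suc (sn k) else 0)"

lemma orec_push_pos: "orec UNIV push_pos"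
  unfolding push_pos_def Let_def
  by (intro orec_if odec_eq odec_dot orec_node orec_intros)

definition points :: "baire \<Rightarrow> nat \<Rightarrow> nat \<Rightarrow> 'a option" where
  "points p m k = (if fs m = 0 then if p (pr (sn m) (pr k 0)) = 0 then None
       else Some (iota (\<lambda>j. p (pr (sn m) (pr k (Suc j)))))
     else dots (sn m) k)"

definition hull_pos :: "baire \<Rightarrow> nat \<Rightarrow> 'a set" where
  "hull_pos p m = {a \<in> M. \<forall>b. a \<in> bball b \<longrightarrow> (\<exists>x\<in>bball b. \<exists>k. points p m k = Some x)}"

lemma const_name: "cauchy_rep X \<alpha> (\<lambda>_. l) = Some (\<alpha> l)"
  by (rule cauchy_repI[OF range_\<alpha>, of _ _ 0]) auto

lemma push_pos_rep: "seq_rep (closed_pos_rep X \<alpha>) (push_pos p) = Some (hull_pos p)"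
proof (rule seq_pos_repI[where u = "points p"])
  fix m k
  have "(\<lambda>j. push_pos p (pr m (pr k j))) =
    (if fs m = 0 then if p (pr (sn m) (pr k 0)) = 0 then (\<lambda>_. 0)
       else (\<lambda>j. Suc (fs (node (\<lambda>j. p (pr (sn m) (pr k (Suc j)))) (j + 3))))
     else if dot (sn m) (fs k) (sn k) then (\<lambda>_. Suc (sn k)) else (\<lambda>_. 0))"
    by (simp add: push_pos_def fun_eq_iff)
  then show "cauchy_rep (infty_metric X) (infty_seq \<alpha>) (\<lambda>j. push_pos p (pr m (pr k j))) = Some (points p m k)"
    unfolding points_def dots_def
    using infty_name_None infty_name_Some[OF iota_name] infty_name_Some[OF const_name] by auto
qed (rule hull_pos_def)

lemma hull_pos_iff:
  assumes l: "on_branch p' x"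
  shows "x \<in> hull_pos p (pr 0 i) \<longleftrightarrow> p' \<in> pos_set p i"
proof
  have x: "x \<in> M" using l V_subset_M[of p' 0] by (auto simp: on_branch_def)
  define q where "q k = (\<lambda>j. p (pr i (pr k (Suc j))))" for k
  have pts: "points p (pr 0 i) k = Some y \<longleftrightarrow> p (pr i (pr k 0)) \<noteq> 0 \<and> y = iota (q k)" for k y
    by (auto simp: points_def q_def)
  have hull: "x \<in> hull_pos p (pr 0 i) \<longleftrightarrow>
      (\<forall>b. x \<in> bball b \<longrightarrow> (\<exists>k. p (pr i (pr k 0)) \<noteq> 0 \<and> iota (q k) \<in> bball b))"
    unfolding hull_pos_def pts using x by blast
  { assume h: "x \<in> hull_pos p (pr 0 i)"
    have "\<exists>k. p (pr i (pr k 0)) \<noteq> 0 \<and> agree n (q k) p'" for n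
    proof -
      have "x \<in> V p' n" using l by (simp add: on_branch_def)
      then obtain b where "x \<in> bball b" "bball b \<subseteq> V p' n" using V_open by blast
      then obtain k where "p (pr i (pr k 0)) \<noteq> 0" "iota (q k) \<in> V p' n" using h hull by blast
      then show ?thesis using iota_closure by blast
    qed
    then show "p' \<in> pos_set p i" by (simp add: pos_set_def q_def) }
  { assume h: "p' \<in> pos_set p i"
    have "\<exists>k. p (pr i (pr k 0)) \<noteq> 0 \<and> iota (q k) \<in> bball b" if "x \<in> bball b" for b
    proof -
      have "iota p' \<in> bball b" using iota_on_branch[OF l] that by simp
      then obtain n where n: "\<And>r. agree n p' r \<Longrightarrow> iota r \<in> bball b" using iota_approx by blast
      obtain k where "p (pr i (pr k 0)) \<noteq> 0" "agree n (q k) p'"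
        using h unfolding pos_set_def q_def by blast
      then show ?thesis using n agree_sym by blast
    qed
    then show "x \<in> hull_pos p (pr 0 i)" unfolding hull by blast }
qed

lemma transfers_pos: "transfers (hull_pos p) (pos_set p)"
proof -
  have "hull_pos p (pr s i) = shell i" if "s \<noteq> 0" for s i
    using that by (simp add: hull_pos_def shell_def points_def)
  moreover have "closedin (mtopology_of X) (hull_pos p k)" for k
    unfolding hull_pos_def by (rule closedin_of_closure)
  ultimately show ?thesis
    unfolding transfers_def using cyl_closed_pos_set hull_pos_iff compl_W_subset_shell interior_shell by simp
qed

lemma read_addr_off_point:
  assumes t: "transfers A A'" and ne: "off_point A' \<noteq> {}"
    and q: "cauchy_rep X \<alpha> q = Some x" and x: "x \<in> BCT_point X A"
  shows "q \<in> generic_names \<and> read_addr q \<in> off_point A'"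
proof -
  have g: "generic x" and l: "\<And>p. on_branch p x \<Longrightarrow> p \<in> off_point A'"
    using transfers_point(2)[OF t ne x] by blast+
  obtain p where p: "on_branch p x" using on_branch_exists[OF g] by blast
  then show ?thesis using l read_addr_eq[OF q p] q g by (auto simp: generic_names_def)
qed

lemma cyl_BCT0_le_BCT0: "cyl_BCT0 \<le>\<^sub>s\<^sub>W BCT0 X \<alpha>"
  by (rule sW_leI[OF orec_push_neg orec_read_addr])
    (use read_addr_off_point[OF transfers_neg] transfers_point(1)[OF transfers_neg] in
      \<open>auto simp: BCT0_def cyl_BCT0_def push_neg_rep\<close>)

lemma cyl_BCT2_le_BCT2: "cyl_BCT2 \<le>\<^sub>s\<^sub>W BCT2 X \<alpha>"
  by (rule sW_leI[OF orec_push_pos orec_read_addr])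
    (use read_addr_off_point[OF transfers_pos] transfers_point(1)[OF transfers_pos] in
      \<open>auto simp: BCT2_def cyl_BCT2_def push_pos_rep\<close>)

lemma orec_second: "orec UNIV (\<lambda>q n. sn (q 0))"
  by (intro orec_intros)

lemma cyl_BCT1_le_BCT1: "cyl_BCT1 \<le>\<^sub>s\<^sub>W BCT1 X \<alpha>"
  by (rule sW_leI[OF orec_push_neg orec_second])
    (use transfers_index[OF transfers_neg] in \<open>auto simp: BCT1_def cyl_BCT1_def push_neg_rep nat_rep_def\<close>)

lemma cyl_BCT3_le_BCT3: "cyl_BCT3 \<le>\<^sub>s\<^sub>W BCT3 X \<alpha>"
  by (rule sW_leI[OF orec_push_pos orec_second])
    (use transfers_index[OF transfers_pos] in \<open>auto simp: BCT3_def cyl_BCT3_def push_pos_rep nat_rep_def\<close>)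

end

section \<open>Baire space as a computable perfect Polish space\<close>

interpretation Baire: Metric_space UNIV baire_dist by (rule Metric_space_baire_dist)

lemma baire_metric_simps [simp]: "mspace baire_metric = UNIV" "mdist baire_metric = baire_dist"
  by (simp_all add: baire_metric_def)

lemma mtopology_of_baire: "mtopology_of baire_metric = Baire.mtopology"
  by (simp add: mtopology_of_def)

lemma baire_dist_le_iff: "baire_dist p q \<le> 1 / 2 ^ n \<longleftrightarrow> agree n p q"
proof (cases "p = q")
  case False
  define L where "L = (LEAST k. p k \<noteq> q k)"
  have L: "p L \<noteq> q L" unfolding L_def by (rule LeastI_ex) (use False in auto)
  have below: "p k = q k" if "k < L" for k using not_less_Least that unfolding L_def by blast
  have "baire_dist p q \<le> 1 / 2 ^ n \<longleftrightarrow> n \<le> L"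
    using False by (simp add: baire_dist_def L_def divide_simps)
  also have "\<dots> \<longleftrightarrow> agree n p q"
  proof
    show "agree n p q" if "n \<le> L" using that below by (simp add: agree_def)
    show "n \<le> L" if "agree n p q" using that L by (force simp: agree_def not_less[symmetric])
  qed
  finally show ?thesis .
qed (simp add: baire_dist_def)

lemma complete_baire: "mcomplete_of baire_metric"
proof -
  have "\<exists>x. limitin Baire.mtopology \<sigma> x sequentially" if c: "Baire.MCauchy \<sigma>" for \<sigma>
  proof -
    have "\<exists>N. \<forall>a\<ge>N. \<forall>b\<ge>N. agree n (\<sigma> a) (\<sigma> b)" for n
    proof -
      have "\<exists>N. \<forall>a b. N \<le> a \<longrightarrow> N \<le> b \<longrightarrow> baire_dist (\<sigma> a) (\<sigma> b) < 1 / 2 ^ n"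
        using conjunct2[OF c[unfolded Baire.MCauchy_def]] by (elim allE[of _ "1 / 2 ^ n"]) simp
      then obtain N where N: "\<And>a b. N \<le> a \<Longrightarrow> N \<le> b \<Longrightarrow> baire_dist (\<sigma> a) (\<sigma> b) < 1 / 2 ^ n"
        by blast
      have "agree n (\<sigma> a) (\<sigma> b)" if "N \<le> a" "N \<le> b" for a b
        using less_imp_le[OF N[OF that]] by (simp only: baire_dist_le_iff)
      then show ?thesis by blast
    qed
    then obtain N where N: "\<And>n a b. N n \<le> a \<Longrightarrow> N n \<le> b \<Longrightarrow> agree n (\<sigma> a) (\<sigma> b)" by metis
    define x where "x k = \<sigma> (N (Suc k)) k" for k
    have "\<exists>K. \<forall>a\<ge>K. baire_dist (\<sigma> a) x < e" if "0 < e" for e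
    proof -
      obtain n where n: "1 / 2 ^ n < e" using power_half_less \<open>0 < e\<close> by blast
      have "baire_dist (\<sigma> a) x < e" if a: "a \<ge> Max (N ` {..n})" for a
      proof -
        have "\<sigma> a k = x k" if "k < n" for k
        proof -
          have "N (Suc k) \<le> a" using a that by (auto intro: order_trans[OF Max_ge])
          then show ?thesis using N[of "Suc k" a "N (Suc k)"] by (simp add: agree_def x_def)
        qed
        then have "baire_dist (\<sigma> a) x \<le> 1 / 2 ^ n" unfolding baire_dist_le_iff agree_def by blast
        then show ?thesis using n by simp
      qed
      then show ?thesis by blast
    qed
    then have "limitin Baire.mtopology \<sigma> x sequentially" by (simp add: Baire.limit_metric_sequentially)
    then show ?thesis by blast
  qed
  then show ?thesis by (simp add: mcomplete_of_def Baire.mcomplete_def)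
qed

lemma dense_baire: "mtopology_of baire_metric closure_of range baire_seq = mspace baire_metric"
proof -
  have "\<exists>w. baire_dist x (baire_seq w) < r" if "0 < r" for x r
  proof -
    obtain n where n: "1 / 2 ^ n < r" using power_half_less \<open>0 < r\<close> by blast
    obtain w where "agree n x (baire_seq w)" using word_exists agree_sym by blast
    then show ?thesis using n baire_dist_le_iff[of x "baire_seq w" n] by (intro exI[of _ w]) simp
  qed
  then show ?thesis by (auto simp: mtopology_of_baire Baire.metric_closure_of)
qed

text \<open>
  At precision \<open>t\<close> only the first \<open>Suc t\<close> entries are compared, so the equality of two sequences need not
  be decided.
\<close>

definition baire_dist_name :: "baire \<Rightarrow> baire" where
  "baire_dist_name p t = (if (LEAST k. baire_seq (p 0) k \<noteq> baire_seq (p 1) k \<or> t < k) \<le> t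
     then half_pow (LEAST k. baire_seq (p 0) k \<noteq> baire_seq (p 1) k \<or> t < k) else 0)"

lemma orec_baire_dist_name: "orec UNIV baire_dist_name"
proof -
  have "orec UNIV (\<lambda>p t. LEAST k. baire_seq (p 0) k \<noteq> baire_seq (p 1) k \<or> t < k)"
    by (rule orec_Least) (auto intro!: orec_baire_seq orec_intros)
  then show ?thesis unfolding baire_dist_name_def by (intro orec_if odec_le orec_half_pow orec_id orec_const)
qed

lemma rat_seq_baire_dist_name:
  "rat_seq (baire_dist_name p t) =
     (if agree (Suc t) (baire_seq (p 0)) (baire_seq (p 1)) then 0 else baire_dist (baire_seq (p 0)) (baire_seq (p 1)))"
proof -
  let ?x = "baire_seq (p 0)" and ?y = "baire_seq (p 1)"
  define L where "L = (LEAST k. ?x k \<noteq> ?y k \<or> t < k)"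
  have L: "?x L \<noteq> ?y L \<or> t < L" unfolding L_def by (rule LeastI[of _ "Suc t"]) simp
  have below: "?x k = ?y k" if "k < L" for k using not_less_Least that unfolding L_def by blast
  have n: "baire_dist_name p t = (if L \<le> t then half_pow L else 0)" by (simp add: baire_dist_name_def L_def)
  show ?thesis
  proof (cases "L \<le> t")
    case True
    then have ne: "?x L \<noteq> ?y L" using L by simp
    then have "\<not> agree (Suc t) ?x ?y" "?x \<noteq> ?y" using le_imp_less_Suc[OF True] by (auto simp: agree_def)
    moreover have "(LEAST k. ?x k \<noteq> ?y k) = L" using ne below by (intro Least_equality) (auto simp: not_less[symmetric])
    ultimately show ?thesis using True by (simp add: n baire_dist_def)
  next
    case False
    then have "agree (Suc t) ?x ?y" using below by (auto simp: agree_def)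
    then show ?thesis using False by (simp add: n)
  qed
qed

lemma baire_dist_name: "real_rep (baire_dist_name p) = Some (baire_dist (baire_seq (p 0)) (baire_seq (p 1)))"
proof -
  let ?x = "baire_seq (p 0)" and ?y = "baire_seq (p 1)"
  have D: "0 \<le> baire_dist ?x ?y" by simp
  have small: "baire_dist ?x ?y < 1 / 2 ^ k" if "agree (Suc k) ?x ?y" for k
  proof -
    have "baire_dist ?x ?y \<le> 1 / 2 ^ Suc k" using that by (simp only: baire_dist_le_iff)
    also have "\<dots> < 1 / 2 ^ k" by (simp add: field_simps)
    finally show ?thesis .
  qed
  show ?thesis
    unfolding real_rep_def
  proof (rule cauchy_repI[where C = 1])
    show "mdist euclidean_metric (rat_seq (baire_dist_name p n)) (rat_seq (baire_dist_name p k)) < 1 / 2 ^ k"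
      if "k \<le> n" for n k
      using small[of k] D agree_mono[of "Suc n" ?x ?y "Suc k"] that
      by (auto simp: rat_seq_baire_dist_name dist_real_def)
    show "mdist euclidean_metric (rat_seq (baire_dist_name p k)) (baire_dist ?x ?y) \<le> 1 / 2 ^ k" for k
      using small[of k] D by (auto simp: rat_seq_baire_dist_name dist_real_def)
  qed auto
qed

lemma computable_Polish_baire: "computable_Polish baire_metric baire_seq"
proof -
  have "computable (\<lambda>p. Some (baire_dist_name p))"
    using computableI[OF orec_baire_dist_name] by simp
  moreover have "realizes (\<lambda>p. Some (baire_dist_name p)) \<lparr>in_rep = prod_rep nat_rep nat_rep, out_rep = real_rep,
      mv = (\<lambda>x. {(\<lambda>(i, j). mdist baire_metric (baire_seq i) (baire_seq j)) x})\<rparr>"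
    by (auto simp: realizes_def prod_rep_def nat_rep_def baire_dist_name)
  ultimately show ?thesis
    unfolding computable_Polish_def computable_map_def
    using complete_baire dense_baire by auto
qed

lemma perfect_baire: "perfect baire_metric"
proof -
  have "\<not> openin Baire.mtopology {x}" for x
  proof
    assume "openin Baire.mtopology {x}"
    then obtain r where r: "r > 0" "Baire.mball x r \<subseteq> {x}" by (auto simp: Baire.openin_mtopology)
    obtain n where n: "1 / 2 ^ n < r" using power_half_less r(1) by blast
    define y where "y = x(n := Suc (x n))"
    have "agree n x y" by (simp add: agree_def y_def)
    then have "baire_dist x y < r" using n baire_dist_le_iff[of x y n] by simp
    then have "y \<in> Baire.mball x r" by simp
    then have "y n = x n" using r(2) by blast
    then show False by (simp add: y_def)
  qed
  then show ?thesis by (simp add: perfect_def mtopology_of_baire)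
qed

lemma BCT_equiv_cyl:
  assumes "computable_Polish X \<alpha>" "perfect X"
  shows "BCT0 X \<alpha> \<equiv>\<^sub>s\<^sub>W cyl_BCT0" "BCT1 X \<alpha> \<equiv>\<^sub>s\<^sub>W cyl_BCT1" "BCT2 X \<alpha> \<equiv>\<^sub>s\<^sub>W cyl_BCT2" "BCT3 X \<alpha> \<equiv>\<^sub>s\<^sub>W cyl_BCT3"
proof -
  obtain dn where "approximated_polish X \<alpha> dn" using computable_Polish_dn[OF assms(1)] by blast
  then interpret perfect_polish X \<alpha> dn
    using assms(2) by (intro perfect_polish.intro perfect_polish_axioms.intro)
  show "BCT0 X \<alpha> \<equiv>\<^sub>s\<^sub>W cyl_BCT0" "BCT1 X \<alpha> \<equiv>\<^sub>s\<^sub>W cyl_BCT1" "BCT2 X \<alpha> \<equiv>\<^sub>s\<^sub>W cyl_BCT2" "BCT3 X \<alpha> \<equiv>\<^sub>s\<^sub>W cyl_BCT3"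
    unfolding sW_equiv_def
    using BCT0_le_cyl_BCT0 BCT1_le_cyl_BCT1 BCT2_le_cyl_BCT2 BCT3_le_cyl_BCT3 cyl_BCT0_le_BCT0 cyl_BCT1_le_BCT1 cyl_BCT2_le_BCT2 cyl_BCT3_le_BCT3
    by blast+
qed

lemma sW_equiv_via: "f \<equiv>\<^sub>s\<^sub>W j \<Longrightarrow> g \<equiv>\<^sub>s\<^sub>W j \<Longrightarrow> f \<equiv>\<^sub>s\<^sub>W g"
  unfolding sW_equiv_def by (blast intro: sW_le_trans)

theorem corollary6p7:
  fixes X :: "'a metric" and \<alpha> :: "nat \<Rightarrow> 'a"
  assumes "computable_Polish X \<alpha>" and "perfect X"
  shows "BCT0 X \<alpha> \<equiv>\<^sub>s\<^sub>W BCT0 baire_metric baire_seq \<and>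
         BCT1 X \<alpha> \<equiv>\<^sub>s\<^sub>W BCT1 baire_metric baire_seq \<and>
         BCT2 X \<alpha> \<equiv>\<^sub>s\<^sub>W BCT2 baire_metric baire_seq \<and>
         BCT3 X \<alpha> \<equiv>\<^sub>s\<^sub>W BCT3 baire_metric baire_seq"
proof -
  note X = BCT_equiv_cyl[OF assms]
  note B = BCT_equiv_cyl[OF computable_Polish_baire perfect_baire]
  show ?thesis
    using sW_equiv_via[OF X(1) B(1)] sW_equiv_via[OF X(2) B(2)]
      sW_equiv_via[OF X(3) B(3)] sW_equiv_via[OF X(4) B(4)] by blast
qed

end
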